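(* Let $G$ be a discrete group and let $B$ be any $G$-boundary. Then there is a continuous $G$-equivariant map from the Hamana boundary $\partial_H G$ onto $B$. Consequently $\partial_H G$ is the universal $G$-boundary, i.e. it is $G$-equivariantly homeomorphic to the Furstenberg boundary $\partial_F G$.
   Context: A compact $G$-space is a $G$-boundary if it is minimal (all orbits dense) and strongly proximal (for every probability measure $\nu$ the weak* closure of $G\nu$ contains a point mass). Furstenberg: there is a unique $G$-boundary $\partial_F G$ such that every $G$-boundary is a continuous $G$-equivariant image of $\partial_F G$; this is the Furstenberg boundary. The Hamana boundary $\partial_H G$ is the compact $G$-space with $C(\partial_H G)=I_G(\mathbb{C})$, the $G$-injective envelope (in Hamana's sense) of $\mathbb{C}$ with trivial action, realized inside $\ell^\infty(G)$ (left translation) as the range of a unital positive $G$-equivariant idempotent, with the Choi–Effros product. *)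

theory Defs
  imports "HOL-Analysis.Analysis" "HOL-Probability.Probability" "HOL-Algebra.Group"
begin

definition compact_G_space :: "('g, 'm) monoid_scheme \<Rightarrow> 'b topology \<Rightarrow> ('g \<Rightarrow> 'b \<Rightarrow> 'b) \<Rightarrow> bool" where
  "compact_G_space G X act \<longleftrightarrow>
     topspace X \<noteq> {} \<and> compact_space X \<and> Hausdorff_space X \<and>
     (\<forall>g\<in>carrier G. continuous_map X X (act g)) \<and>
     (\<forall>x\<in>topspace X. act \<one>\<^bsub>G\<^esub> x = x) \<and>
     (\<forall>g\<in>carrier G. \<forall>h\<in>carrier G. \<forall>x\<in>topspace X. act (g \<otimes>\<^bsub>G\<^esub> h) x = act g (act h x))"

definition G_minimal :: "('g, 'm) monoid_scheme \<Rightarrow> 'b topology \<Rightarrow> ('g \<Rightarrow> 'b \<Rightarrow> 'b) \<Rightarrow> bool" where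
  "G_minimal G X act \<longleftrightarrow>
     (\<forall>x\<in>topspace X. X closure_of ((\<lambda>g. act g x) ` carrier G) = topspace X)"

definition borel_of :: "'b topology \<Rightarrow> 'b measure" where
  "borel_of X = sigma (topspace X) {U. openin X U}"

text \<open>Strongly proximal: for every (Borel) probability measure \<nu> on X, the weak* closure of the
  orbit G\<nu> contains a point mass \<delta>_x.  Weak* closure is with respect to the pairing with C(X):
  every basic weak* neighbourhood of \<delta>_x (finitely many continuous functions, tolerance \<epsilon>)
  meets the orbit; here g\<nu> is the push-forward of \<nu> under act g, so
  \<integral> f d(g\<nu>) = \<integral> f(g y) d\<nu>(y).\<close>
definition G_strongly_proximal :: "('g, 'm) monoid_scheme \<Rightarrow> 'b topology \<Rightarrow> ('g \<Rightarrow> 'b \<Rightarrow> 'b) \<Rightarrow> bool" where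
  "G_strongly_proximal G X act \<longleftrightarrow>
     (\<forall>\<nu>::'b measure. prob_space \<nu> \<and> sets \<nu> = sets (borel_of X) \<longrightarrow>
        (\<exists>x\<in>topspace X. \<forall>F \<epsilon>. finite F \<and> F \<subseteq> {f. continuous_map X euclideanreal f} \<and> \<epsilon> > 0 \<longrightarrow>
           (\<exists>g\<in>carrier G. \<forall>f\<in>F. \<bar>(\<integral>y. f (act g y) \<partial>\<nu>) - f x\<bar> < \<epsilon>)))"

definition G_boundary :: "('g, 'm) monoid_scheme \<Rightarrow> 'b topology \<Rightarrow> ('g \<Rightarrow> 'b \<Rightarrow> 'b) \<Rightarrow> bool" where
  "G_boundary G X act \<longleftrightarrow> compact_G_space G X act \<and> G_minimal G X act \<and> G_strongly_proximal G X act"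

definition G_factor_map ::
  "('g, 'm) monoid_scheme \<Rightarrow> 'a topology \<Rightarrow> ('g \<Rightarrow> 'a \<Rightarrow> 'a) \<Rightarrow> 'b topology \<Rightarrow> ('g \<Rightarrow> 'b \<Rightarrow> 'b) \<Rightarrow> ('a \<Rightarrow> 'b) \<Rightarrow> bool" where
  "G_factor_map G X actX Y actY f \<longleftrightarrow>
     continuous_map X Y f \<and> f ` topspace X = topspace Y \<and>
     (\<forall>g\<in>carrier G. \<forall>x\<in>topspace X. f (actX g x) = actY g (f x))"

definition linf :: "('g, 'm) monoid_scheme \<Rightarrow> ('g \<Rightarrow> complex) set" where
  "linf G = {a. bounded (a ` carrier G) \<and> (\<forall>h. h \<notin> carrier G \<longrightarrow> a h = 0)}"

definition linf_one :: "('g, 'm) monoid_scheme \<Rightarrow> 'g \<Rightarrow> complex" where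
  "linf_one G = (\<lambda>h. if h \<in> carrier G then 1 else 0)"

definition ltr :: "('g, 'm) monoid_scheme \<Rightarrow> 'g \<Rightarrow> ('g \<Rightarrow> complex) \<Rightarrow> 'g \<Rightarrow> complex" where
  "ltr G g a = (\<lambda>h. if h \<in> carrier G then a (inv\<^bsub>G\<^esub> g \<otimes>\<^bsub>G\<^esub> h) else 0)"

definition linf_pos :: "('g \<Rightarrow> complex) \<Rightarrow> bool" where
  "linf_pos a \<longleftrightarrow> (\<forall>h. Im (a h) = 0 \<and> Re (a h) \<ge> 0)"

text \<open>A G-projection on l-infinity(G): unital positive linear G-equivariant idempotent
  (positive maps into the commutative algebra l-infinity(G) are automatically completely positive).\<close>
definition G_projection :: "('g, 'm) monoid_scheme \<Rightarrow> (('g \<Rightarrow> complex) \<Rightarrow> ('g \<Rightarrow> complex)) \<Rightarrow> bool" where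
  "G_projection G \<phi> \<longleftrightarrow>
     (\<forall>a\<in>linf G. \<phi> a \<in> linf G) \<and>
     (\<forall>a\<in>linf G. \<forall>b\<in>linf G. \<phi> (\<lambda>h. a h + b h) = (\<lambda>h. \<phi> a h + \<phi> b h)) \<and>
     (\<forall>a\<in>linf G. \<forall>c::complex. \<phi> (\<lambda>h. c * a h) = (\<lambda>h. c * \<phi> a h)) \<and>
     \<phi> (linf_one G) = linf_one G \<and>
     (\<forall>a\<in>linf G. linf_pos a \<longrightarrow> linf_pos (\<phi> a)) \<and>
     (\<forall>g\<in>carrier G. \<forall>a\<in>linf G. \<phi> (ltr G g a) = ltr G g (\<phi> a)) \<and>
     (\<forall>a\<in>linf G. \<phi> (\<phi> a) = \<phi> a)"

text \<open>Minimal G-projection (Hamana): minimal w.r.t. \<psi> \<prec> \<phi> iff \<psi>\<phi> = \<phi>\<psi> = \<psi> on l-infinity(G);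
  equivalently, no G-projection has strictly smaller range.  Its range is the G-injective
  envelope I_G(\<complex>).\<close>
definition minimal_G_projection :: "('g, 'm) monoid_scheme \<Rightarrow> (('g \<Rightarrow> complex) \<Rightarrow> ('g \<Rightarrow> complex)) \<Rightarrow> bool" where
  "minimal_G_projection G \<phi> \<longleftrightarrow> G_projection G \<phi> \<and>
     (\<forall>\<psi>. G_projection G \<psi> \<and> (\<forall>a\<in>linf G. \<psi> (\<phi> a) = \<psi> a \<and> \<phi> (\<psi> a) = \<psi> a)
          \<longrightarrow> (\<forall>a\<in>linf G. \<psi> a = \<phi> a))"

text \<open>I_G(\<complex>) realised as the range of \<phi>, with the Choi--Effros product a \<circ> b = \<phi>(ab).\<close>
definition IG :: "('g, 'm) monoid_scheme \<Rightarrow> (('g \<Rightarrow> complex) \<Rightarrow> ('g \<Rightarrow> complex)) \<Rightarrow> ('g \<Rightarrow> complex) set" where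
  "IG G \<phi> = \<phi> ` linf G"

definition hamana_chars :: "('g, 'm) monoid_scheme \<Rightarrow> (('g \<Rightarrow> complex) \<Rightarrow> ('g \<Rightarrow> complex)) \<Rightarrow> (('g \<Rightarrow> complex) \<Rightarrow> complex) set" where
  "hamana_chars G \<phi> = {\<kappa>. \<kappa> \<in> extensional (IG G \<phi>) \<and>
      (\<forall>a\<in>IG G \<phi>. \<forall>b\<in>IG G \<phi>. \<kappa> (\<lambda>h. a h + b h) = \<kappa> a + \<kappa> b) \<and>
      (\<forall>a\<in>IG G \<phi>. \<forall>c. \<kappa> (\<lambda>h. c * a h) = c * \<kappa> a) \<and>
      \<kappa> (linf_one G) = 1 \<and>
      (\<forall>a\<in>IG G \<phi>. \<forall>b\<in>IG G \<phi>. \<kappa> (\<phi> (\<lambda>h. a h * b h)) = \<kappa> a * \<kappa> b)}"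

definition hamana_topology :: "('g, 'm) monoid_scheme \<Rightarrow> (('g \<Rightarrow> complex) \<Rightarrow> ('g \<Rightarrow> complex)) \<Rightarrow> (('g \<Rightarrow> complex) \<Rightarrow> complex) topology" where
  "hamana_topology G \<phi> = subtopology (product_topology (\<lambda>_. euclidean) (IG G \<phi>)) (hamana_chars G \<phi>)"

text \<open>Induced action: (g.\<kappa>)(a) = \<kappa>(g\<inverse>.a), so that the Gelfand transform is equivariant.\<close>
definition hamana_act :: "('g, 'm) monoid_scheme \<Rightarrow> (('g \<Rightarrow> complex) \<Rightarrow> ('g \<Rightarrow> complex)) \<Rightarrow> 'g \<Rightarrow> (('g \<Rightarrow> complex) \<Rightarrow> complex) \<Rightarrow> (('g \<Rightarrow> complex) \<Rightarrow> complex)" where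
  "hamana_act G \<phi> g \<kappa> = restrict (\<lambda>a. \<kappa> (ltr G (inv\<^bsub>G\<^esub> g) a)) (IG G \<phi>)"

end

theory Submission
  imports Defs
begin

text \<open>
  The unital positive equivariant linear maps on \<open>\<ell>\<^sup>\<infinity>(G)\<close> form, under composition and pointwise
  convergence, a compact right topological semigroup, so minimal idempotents \<open>\<phi>\<close> exist. Averaging
  powers and the Ellis--Numakura lemma show rigidity: \<open>\<phi>\<close> is the only element \<open>u\<close> with
  \<open>u = \<phi> u = u \<phi>\<close>. Applied to \<open>\<phi>\<close> after the Poisson transform \<open>a \<mapsto> (g \<mapsto> L(g\<^sup>-\<^sup>1 a))\<close> of a state \<open>L\<close> on
  the range of \<open>\<phi>\<close>, rigidity says that \<open>\<phi>\<close> inverts the Poisson transform; hence every character of the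
  range is a weak* limit of translates of \<open>L\<close>. For \<open>L\<close> a character this is minimality of the Hamana
  boundary, for \<open>L\<close> a probability measure it is strong proximality.

  Given a boundary \<open>X\<close> with base point \<open>x\<^sub>0\<close>, a character \<open>\<kappa>\<close> yields the state
  \<open>f \<mapsto> \<kappa>(\<phi>(h \<mapsto> f(h x\<^sub>0)))\<close> on \<open>C(X)\<close>, which by the Riesz theorem is a measure. Strong proximality of
  \<open>X\<close> and compactness make it a point mass for one \<open>\<kappa>\<close>, and minimality of the Hamana boundary for all.
\<close>

subsection \<open>Idempotents in compact right topological semigroups\<close>

text \<open>The obstacle is that the range of \<open>\<phi>\<close> need not be closed under the
  pointwise product. Evaluation at a group element therefore need not be a character, and positivity
  of a character is not visible from its definition. Both are repaired by
  \<open>\<phi> (a * \<phi> x) = \<phi> (a * x)\<close> for \<open>a\<close> in the range. It makes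
  \<open>\<phi>\<close> annihilate the squared moduli of the defects
  \<open>a * b - \<phi> (a * b)\<close>, so some evaluations are nearly multiplicative and cluster
  at characters. It also turns bounded pointwise inverses into inverses for the new product, so a
  character value at \<open>a\<close> is a limit of values of \<open>a\<close>.

  Composition is continuous in its left factor only: \<open>w \<circ> u = w\<close> is a closed
  condition on \<open>w\<close>, while \<open>u \<circ> w = w\<close> need not be. Rigidity
  therefore absorbs \<open>u\<close> on the right by averaging and multiplies by
  \<open>\<phi>\<close> on the left only afterwards.

  Continuous functions on the Hamana boundary are controlled by domination, using elements of the
  range that vanish at a chosen character and are large away from it. A state that is small on such
  an element is concentrated near that character.\<close>

text \<open>Zorn's lemma for reverse inclusion: a finite part of a chain has a least member, so
  compactness makes the intersection of the chain nonempty. \<open>Q\<close> stays abstract because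
  it stands for closed subsemigroups in one use and closed left ideals in the other.\<close>

lemma compact_space_minimal_closed:
  assumes cpt: "compact_space Z"
    and C0: "closedin Z C0" "C0 \<noteq> {}" "Q C0"
    and chain: "\<And>\<C>. \<C> \<noteq> {} \<Longrightarrow> \<forall>C\<in>\<C>. closedin Z C \<and> C \<noteq> {} \<and> Q C \<Longrightarrow> \<Inter>\<C> \<noteq> {} \<Longrightarrow> Q (\<Inter>\<C>)"
  shows "\<exists>M. closedin Z M \<and> M \<noteq> {} \<and> Q M \<and> M \<subseteq> C0 \<and>
           (\<forall>C. closedin Z C \<and> C \<noteq> {} \<and> Q C \<and> C \<subseteq> M \<longrightarrow> C = M)"
proof -
  define A where "A = {C. closedin Z C \<and> C \<noteq> {} \<and> Q C \<and> C \<subseteq> C0}"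
  have "\<exists>m\<in>A. \<forall>a\<in>A. m \<supseteq> a \<longrightarrow> a = m"
  proof (rule predicate_Zorn)
    show "partial_order_on A (relation_of (\<supseteq>) A)"
      by (rule partial_order_on_relation_ofI) auto
  next
    fix \<C> assume ch: "\<C> \<in> Chains (relation_of (\<supseteq>) A)"
    have sub: "\<C> \<subseteq> A"
      using ch unfolding Chains_def relation_of_def by auto
    have tot: "C \<subseteq> D \<or> D \<subseteq> C" if "C \<in> \<C>" "D \<in> \<C>" for C D
      using ch that unfolding Chains_def relation_of_def by auto
    show "\<exists>u\<in>A. \<forall>a\<in>\<C>. a \<supseteq> u"
    proof (cases "\<C> = {}")
      case True
      then show ?thesis using C0 by (auto simp: A_def)
    next
      case False
      have fin: "\<exists>C\<in>\<C>. C \<subseteq> \<Inter>\<F>" if "finite \<F>" "\<F> \<subseteq> \<C>" for \<F>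
        using that
      proof (induction \<F> rule: finite_induct)
        case empty
        then show ?case using False by auto
      next
        case (insert D \<F>)
        then obtain C where "C \<in> \<C>" "C \<subseteq> \<Inter>\<F>" by auto
        with tot[of C D] insert.prems have "C \<subseteq> \<Inter>(insert D \<F>) \<or> D \<subseteq> \<Inter>(insert D \<F>)" by auto
        with \<open>C \<in> \<C>\<close> insert.prems show ?case by blast
      qed
      have fip: "\<Inter>\<F> \<noteq> {}" if "finite \<F>" "\<F> \<subseteq> \<C>" for \<F>
      proof -
        have "\<exists>C\<in>\<C>. C \<subseteq> \<Inter>\<F>" using fin[OF that] .
        then obtain C where C: "C \<in> \<C>" "C \<subseteq> \<Inter>\<F>" by blast
        then have "C \<noteq> {}" using sub by (auto simp: A_def)
        with C(2) show ?thesis by blast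
      qed
      have cl: "\<forall>C\<in>\<C>. closedin Z C"
        using sub by (auto simp: A_def)
      have ne: "\<Inter>\<C> \<noteq> {}"
        using cpt[unfolded compact_space_fip, rule_format, of \<C>] cl fip by simp
      have "closedin Z (\<Inter>\<C>)"
        using False cl by (intro closedin_Inter) auto
      moreover have "Q (\<Inter>\<C>)"
        using sub False ne by (intro chain) (auto simp: A_def)
      moreover have "\<Inter>\<C> \<subseteq> C0" using False sub by (auto simp: A_def)
      ultimately have "\<Inter>\<C> \<in> A" using ne by (simp add: A_def)
      then show ?thesis by blast
    qed
  qed
  then obtain M where M: "M \<in> A" and min: "\<And>C. C \<in> A \<Longrightarrow> C \<subseteq> M \<Longrightarrow> C = M" by blast
  show ?thesis
  proof (intro exI[of _ M] conjI allI impI)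
    fix C assume "closedin Z C \<and> C \<noteq> {} \<and> Q C \<and> C \<subseteq> M"
    with M show "C = M" by (intro min) (auto simp: A_def)
  qed (use M in \<open>auto simp: A_def\<close>)
qed

text \<open>Only \<open>\<lambda>x. m x y\<close> is continuous, which is what composition offers
  under pointwise convergence: \<open>(F \<circ> H) a = F (H a)\<close> is a coordinate of
  \<open>F\<close>, while \<open>F\<close> itself may be discontinuous. Associativity is demanded of
  all elements, as composition has it.\<close>

locale compact_right_semigroup =
  fixes Z :: "'a topology" and m :: "'a \<Rightarrow> 'a \<Rightarrow> 'a"
  assumes compact_Z: "compact_space Z" and Hausdorff_Z: "Hausdorff_space Z"
    and m_closed: "\<And>x y. x \<in> topspace Z \<Longrightarrow> y \<in> topspace Z \<Longrightarrow> m x y \<in> topspace Z"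
    and m_assoc: "\<And>x y z. m (m x y) z = m x (m y z)"
    and m_cont: "\<And>y. y \<in> topspace Z \<Longrightarrow> continuous_map Z Z (\<lambda>x. m x y)"
begin

lemma closedin_image_right_mult:
  assumes "closedin Z K" "w \<in> topspace Z"
  shows "closedin Z ((\<lambda>x. m x w) ` K)"
proof -
  have "compactin Z K"
    using assms(1) compact_Z by (rule closedin_compact_space[rotated])
  then have "compactin Z ((\<lambda>x. m x w) ` K)"
    using m_cont[OF assms(2)] by (rule image_compactin)
  then show ?thesis using Hausdorff_Z compactin_imp_closedin by blast
qed

lemma closedin_right_solutions:
  assumes "closedin Z K" "w \<in> topspace Z" "y \<in> topspace Z"
  shows "closedin Z {k \<in> K. m k w = y}"
proof -
  have "closedin Z {y}"
    using Hausdorff_Z assms(3) by (simp add: closedin_Hausdorff_singleton)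
  then have "closedin Z {x \<in> topspace Z. m x w \<in> {y}}"
    using m_cont[OF assms(2)] closedin_continuous_map_preimage by blast
  then have "closedin Z (K \<inter> {x \<in> topspace Z. m x w \<in> {y}})"
    using assms(1) by blast
  moreover have "K \<inter> {x \<in> topspace Z. m x w \<in> {y}} = {k \<in> K. m k w = y}"
    using closedin_subset[OF assms(1)] by auto
  ultimately show ?thesis by simp
qed

text \<open>In a minimal closed subsemigroup \<open>M\<close> the set \<open>M w\<close> is again a
  closed subsemigroup, hence all of \<open>M\<close>, so \<open>k w = w\<close> is solvable in
  \<open>M\<close>. The solutions form a closed subsemigroup, hence again all of \<open>M\<close>,
  and \<open>w\<close> itself is one of them.\<close>

lemma ellis_numakura:
  assumes T: "closedin Z T" "T \<noteq> {}" and mult: "\<And>x y. x \<in> T \<Longrightarrow> y \<in> T \<Longrightarrow> m x y \<in> T"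
  shows "\<exists>e\<in>T. m e e = e"
proof -
  define Q where "Q = (\<lambda>C. \<forall>x\<in>C. \<forall>y\<in>C. m x y \<in> C)"
  have "\<exists>M. closedin Z M \<and> M \<noteq> {} \<and> Q M \<and> M \<subseteq> T \<and>
           (\<forall>C. closedin Z C \<and> C \<noteq> {} \<and> Q C \<and> C \<subseteq> M \<longrightarrow> C = M)"
    by (rule compact_space_minimal_closed[OF compact_Z T]) (auto simp: Q_def mult)
  then obtain M where "closedin Z M \<and> M \<noteq> {} \<and> Q M \<and> M \<subseteq> T \<and>
           (\<forall>C. closedin Z C \<and> C \<noteq> {} \<and> Q C \<and> C \<subseteq> M \<longrightarrow> C = M)" by (elim exE)
  then have M: "closedin Z M" "M \<noteq> {}" "Q M" "M \<subseteq> T"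
    and min: "\<And>C. closedin Z C \<Longrightarrow> C \<noteq> {} \<Longrightarrow> Q C \<Longrightarrow> C \<subseteq> M \<Longrightarrow> C = M" by simp_all
  obtain w where w: "w \<in> M" using M by blast
  have wZ: "w \<in> topspace Z" using w M closedin_subset by blast
  have MM: "m x y \<in> M" if "x \<in> M" "y \<in> M" for x y using M that by (simp add: Q_def)
  have "(\<lambda>x. m x w) ` M = M"
  proof (rule min)
    show "closedin Z ((\<lambda>x. m x w) ` M)" by (rule closedin_image_right_mult[OF M(1) wZ])
    show "Q ((\<lambda>x. m x w) ` M)"
      unfolding Q_def
    proof (intro ballI)
      fix x y assume "x \<in> (\<lambda>x. m x w) ` M" "y \<in> (\<lambda>x. m x w) ` M"
      then obtain x' y' where "x' \<in> M" "y' \<in> M" "x = m x' w" "y = m y' w" by auto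
      then have "m x y = m (m x' (m w y')) w" "m x' (m w y') \<in> M"
        using w by (simp_all add: m_assoc MM)
      then show "m x y \<in> (\<lambda>x. m x w) ` M" by blast
    qed
  qed (use M w MM in auto)
  then have ne: "{k \<in> M. m k w = w} \<noteq> {}" using w by force
  have "{k \<in> M. m k w = w} = M"
    by (rule min) (use ne closedin_right_solutions[OF M(1) wZ wZ] MM in \<open>auto simp: Q_def m_assoc\<close>)
  then show ?thesis using w M by blast
qed

lemma ex_minimal_left_ideal:
  assumes "topspace Z \<noteq> {}"
  shows "\<exists>L. closedin Z L \<and> L \<noteq> {} \<and> (\<forall>s\<in>topspace Z. \<forall>l\<in>L. m s l \<in> L) \<and>
     (\<forall>C. closedin Z C \<and> C \<noteq> {} \<and> (\<forall>s\<in>topspace Z. \<forall>l\<in>C. m s l \<in> C) \<and> C \<subseteq> L \<longrightarrow> C = L)"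
proof -
  define Q where "Q = (\<lambda>C. \<forall>s\<in>topspace Z. \<forall>l\<in>C. m s l \<in> C)"
  have "\<exists>M. closedin Z M \<and> M \<noteq> {} \<and> Q M \<and> M \<subseteq> topspace Z \<and>
           (\<forall>C. closedin Z C \<and> C \<noteq> {} \<and> Q C \<and> C \<subseteq> M \<longrightarrow> C = M)"
    by (rule compact_space_minimal_closed[OF compact_Z]) (use assms in \<open>auto simp: Q_def m_closed\<close>)
  then show ?thesis unfolding Q_def by (rule ex_forward) simp
qed

text \<open>Let \<open>e\<close> be an idempotent in a minimal left ideal \<open>L\<close> and
  \<open>p\<close> an idempotent below it. Then \<open>p = p e\<close> lies in \<open>L\<close> and
  \<open>Z p\<close> is a closed left ideal inside \<open>L\<close>, so \<open>e = s p\<close> for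
  some \<open>s\<close>. Multiplying by \<open>p\<close> on the right gives \<open>e p = e\<close>,
  while \<open>e p = p\<close> by assumption.\<close>

lemma ex_minimal_idempotent:
  assumes "topspace Z \<noteq> {}"
  shows "\<exists>e\<in>topspace Z. m e e = e \<and>
    (\<forall>p\<in>topspace Z. m p p = p \<and> m p e = p \<and> m e p = p \<longrightarrow> p = e)"
proof -
  obtain L where "closedin Z L \<and> L \<noteq> {} \<and> (\<forall>s\<in>topspace Z. \<forall>l\<in>L. m s l \<in> L) \<and>
     (\<forall>C. closedin Z C \<and> C \<noteq> {} \<and> (\<forall>s\<in>topspace Z. \<forall>l\<in>C. m s l \<in> C) \<and> C \<subseteq> L \<longrightarrow> C = L)"
    using ex_minimal_left_ideal[OF assms] by (elim exE)
  then have L: "closedin Z L" "L \<noteq> {}" and ideal: "\<And>s l. s \<in> topspace Z \<Longrightarrow> l \<in> L \<Longrightarrow> m s l \<in> L"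
    and min: "\<And>C. closedin Z C \<Longrightarrow> C \<noteq> {} \<Longrightarrow> (\<forall>s\<in>topspace Z. \<forall>l\<in>C. m s l \<in> C) \<Longrightarrow> C \<subseteq> L \<Longrightarrow> C = L"
    by simp_all
  have LZ: "L \<subseteq> topspace Z" using L closedin_subset by blast
  obtain e where e: "e \<in> L" "m e e = e"
    using ellis_numakura[OF L] ideal LZ by blast
  have "p = e" if p: "p \<in> topspace Z" "m p p = p" "m p e = p" "m e p = p" for p
  proof -
    have pL: "p \<in> L" using ideal[OF p(1) e(1)] p(3) by simp
    have "(\<lambda>x. m x p) ` topspace Z = L"
    proof (rule min)
      show "closedin Z ((\<lambda>x. m x p) ` topspace Z)"
        by (rule closedin_image_right_mult[OF closedin_topspace p(1)])
      show "\<forall>s\<in>topspace Z. \<forall>l\<in>(\<lambda>x. m x p) ` topspace Z. m s l \<in> (\<lambda>x. m x p) ` topspace Z"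
      proof (intro ballI)
        fix s l assume s: "s \<in> topspace Z" and "l \<in> (\<lambda>x. m x p) ` topspace Z"
        then obtain x where "x \<in> topspace Z" "l = m x p" by blast
        then have "m s l = m (m s x) p" "m s x \<in> topspace Z" using s by (simp_all add: m_assoc m_closed)
        then show "m s l \<in> (\<lambda>x. m x p) ` topspace Z" by blast
      qed
    qed (use assms ideal pL in auto)
    then obtain s where "e = m s p" using e by blast
    then have "m e p = e" using p(2) by (simp add: m_assoc)
    with p(4) show ?thesis by simp
  qed
  with e LZ show ?thesis by blast
qed

end

subsection \<open>Riesz representation on compact Hausdorff spaces\<close>

text \<open>Strong proximality speaks of Borel measures, whereas a character of the Hamana algebra
  only yields a positive normalised functional; this locale is the bridge. Functions are total on
  the type, but linearity and \<open>L_nonneg\<close> make \<open>L f\<close> depend only on the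
  values of a continuous \<open>f\<close> on \<open>topspace X\<close>.\<close>

locale compact_state =
  fixes X :: "'b topology" and L :: "('b \<Rightarrow> real) \<Rightarrow> real"
  assumes compact_X: "compact_space X" and Hausdorff_X: "Hausdorff_space X"
    and L_add: "\<And>f g. continuous_map X euclideanreal f \<Longrightarrow> continuous_map X euclideanreal g \<Longrightarrow>
                  L (\<lambda>x. f x + g x) = L f + L g"
    and L_scale: "\<And>f c. continuous_map X euclideanreal f \<Longrightarrow> L (\<lambda>x. c * f x) = c * L f"
    and L_nonneg: "\<And>f. continuous_map X euclideanreal f \<Longrightarrow> (\<And>x. x \<in> topspace X \<Longrightarrow> 0 \<le> f x) \<Longrightarrow> 0 \<le> L f"
    and L_one: "L (\<lambda>_. 1) = 1"
begin

abbreviation cts :: "('b \<Rightarrow> real) \<Rightarrow> bool" where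
  "cts \<equiv> continuous_map X euclideanreal"

lemma L_const: "L (\<lambda>_. c) = c"
  using L_scale[of "\<lambda>_. 1" c] L_one by simp

lemma L_diff: "cts f \<Longrightarrow> cts g \<Longrightarrow> L (\<lambda>x. f x - g x) = L f - L g"
  using L_add[of f "\<lambda>x. (-1) * g x"] L_scale[of g "-1"] by simp

lemma L_mono:
  assumes "cts f" "cts g" "\<And>x. x \<in> topspace X \<Longrightarrow> f x \<le> g x"
  shows "L f \<le> L g"
  using L_nonneg[of "\<lambda>x. g x - f x"] assms by (simp add: L_diff continuous_map_diff)

lemma L_sum:
  assumes "finite A" "\<And>i. i \<in> A \<Longrightarrow> cts (f i)"
  shows "L (\<lambda>x. \<Sum>i\<in>A. f i x) = (\<Sum>i\<in>A. L (f i))"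
  using assms
  by (induction A rule: finite_induct) (simp_all add: L_const L_add continuous_map_sum)

definition below :: "'b set \<Rightarrow> ('b \<Rightarrow> real) set" where
  "below U = {g. cts g \<and> (\<forall>x\<in>topspace X. 0 \<le> g x \<and> g x \<le> 1 \<and> (x \<notin> U \<longrightarrow> g x = 0))}"

definition open_content :: "'b set \<Rightarrow> ennreal" where
  "open_content U = (SUP g\<in>below U. ennreal (L g))"

definition outer :: "'b set \<Rightarrow> ennreal" where
  "outer A = (INF U\<in>{U. openin X U \<and> A \<subseteq> U}. open_content U)"

lemma zero_below: "(\<lambda>_. 0) \<in> below U"
  by (simp add: below_def)

lemma belowD:
  assumes "g \<in> below U"
  shows "cts g" "x \<in> topspace X \<Longrightarrow> 0 \<le> g x" "x \<in> topspace X \<Longrightarrow> g x \<le> 1"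
    "x \<in> topspace X \<Longrightarrow> x \<notin> U \<Longrightarrow> g x = 0"
  using assms by (auto simp: below_def)

lemma below_L_nonneg: "g \<in> below U \<Longrightarrow> 0 \<le> L g"
  by (intro L_nonneg) (auto simp: below_def)

lemma open_content_upper: "g \<in> below U \<Longrightarrow> ennreal (L g) \<le> open_content U"
  unfolding open_content_def by (rule SUP_upper)

lemma open_content_mono: "U \<subseteq> V \<Longrightarrow> open_content U \<le> open_content V"
  unfolding open_content_def by (rule SUP_subset_mono) (auto simp: below_def)

lemma open_content_empty: "open_content {} = 0"
proof -
  have "L g = 0" if "g \<in> below {}" for g
  proof -
    have "L g \<le> L (\<lambda>_. 0)" using belowD[OF that] by (intro L_mono) auto
    then show ?thesis using below_L_nonneg[OF that] by (simp add: L_const)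
  qed
  then have "open_content {} = (SUP g\<in>below {}. 0)"
    unfolding open_content_def by (intro SUP_cong) auto
  then show ?thesis using zero_below by (metis SUP_const empty_iff)
qed

lemma open_content_topspace: "open_content (topspace X) = 1"
proof (rule antisym)
  show "open_content (topspace X) \<le> 1"
    unfolding open_content_def
  proof (rule SUP_least)
    fix g assume "g \<in> below (topspace X)"
    then have "L g \<le> L (\<lambda>_. 1)" using belowD by (intro L_mono) auto
    then show "ennreal (L g) \<le> 1" by (simp add: L_one ennreal_le_1)
  qed
  have "(\<lambda>_. 1) \<in> below (topspace X)" by (simp add: below_def)
  from open_content_upper[OF this] show "1 \<le> open_content (topspace X)" by (simp add: L_one)
qed

text \<open>Members of \<open>below U\<close> vanish off \<open>U\<close>, but their supports may
  reach the boundary of \<open>U\<close>. Cutting off the part below \<open>\<delta>\<close> gives a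
  function that vanishes off the closed set \<open>\<delta> \<le> g\<close> inside \<open>U\<close>,
  at a cost of at most \<open>\<delta>\<close> in \<open>L\<close>; compactness and Urysohn
  arguments apply to that set.\<close>

lemma below_truncate:
  assumes g: "g \<in> below U" and "\<delta> > 0"
  shows "(\<lambda>x. max 0 (g x - \<delta>)) \<in> below U" "L g \<le> L (\<lambda>x. max 0 (g x - \<delta>)) + \<delta>"
proof -
  have c: "cts (\<lambda>x. max 0 (g x - \<delta>))"
    using belowD(1)[OF g] by (intro continuous_map_real_max continuous_map_diff) auto
  show "(\<lambda>x. max 0 (g x - \<delta>)) \<in> below U"
    unfolding below_def
  proof (intro CollectI conjI ballI impI c)
    fix x assume x: "x \<in> topspace X"
    show "0 \<le> max 0 (g x - \<delta>)" "max 0 (g x - \<delta>) \<le> 1"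
      using belowD(3)[OF g x] \<open>\<delta> > 0\<close> by auto
    assume "x \<notin> U"
    then show "max 0 (g x - \<delta>) = 0" using belowD(4)[OF g x] \<open>\<delta> > 0\<close> by auto
  qed
  have "L g \<le> L (\<lambda>x. max 0 (g x - \<delta>) + \<delta>)"
    using c belowD(1)[OF g] by (intro L_mono continuous_map_add) auto
  also have "\<dots> = L (\<lambda>x. max 0 (g x - \<delta>)) + \<delta>"
    using c L_add[of "\<lambda>x. max 0 (g x - \<delta>)" "\<lambda>_. \<delta>"] by (simp add: L_const)
  finally show "L g \<le> L (\<lambda>x. max 0 (g x - \<delta>)) + \<delta>" .
qed

lemma closedin_superlevel: "cts g \<Longrightarrow> closedin X {x \<in> topspace X. \<delta> \<le> g x}"
  using closedin_continuous_map_preimage[of X euclideanreal g "{\<delta>..}"] by simp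

text \<open>After truncation everything happens on a closed set \<open>K\<close> inside
  \<open>U \<union> V\<close>, so \<open>K - U\<close> and \<open>K - V\<close> are disjoint and
  closed. A Urysohn function \<open>p\<close> that is 0 on the first and 1 on the second splits
  \<open>h\<close> into \<open>h * p\<close> below \<open>U\<close> and \<open>h * (1 - p)\<close>
  below \<open>V\<close>.\<close>

lemma open_content_Un:
  assumes U: "openin X U" and V: "openin X V"
  shows "open_content (U \<union> V) \<le> open_content U + open_content V"
  unfolding open_content_def[of "U \<union> V"]
proof (rule SUP_least)
  fix g assume g: "g \<in> below (U \<union> V)"
  show "ennreal (L g) \<le> open_content U + open_content V"
  proof (rule ennreal_le_epsilon)
    fix \<delta> :: real assume \<delta>: "\<delta> > 0"
    define h where "h = (\<lambda>x. max 0 (g x - \<delta>))"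
    have h: "h \<in> below (U \<union> V)" "L g \<le> L h + \<delta>"
      unfolding h_def using below_truncate[OF g \<delta>] by auto
    define K where "K = {x \<in> topspace X. \<delta> \<le> g x}"
    have K: "closedin X K" unfolding K_def by (rule closedin_superlevel[OF belowD(1)[OF g]])
    have h0: "h x = 0" if "x \<in> topspace X" "x \<notin> K" for x
      using that by (auto simp: K_def h_def)
    have KUV: "K \<subseteq> U \<union> V"
      using belowD(4)[OF g] \<delta> by (force simp: K_def)
    have "closedin X (K - U)" "closedin X (K - V)" using K U V by auto
    moreover have "disjnt (K - U) (K - V)" using KUV by (auto simp: disjnt_def)
    moreover have "normal_space X"
      using compact_X Hausdorff_X compact_Hausdorff_or_regular_imp_normal_space by blast
    ultimately obtain p where p: "continuous_map X (top_of_set {0..1::real}) p"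
        "p ` (K - U) \<subseteq> {0}" "p ` (K - V) \<subseteq> {1}"
      using Urysohn_lemma[of X "K - U" "K - V" 0 1] by auto
    have pc: "cts p" and p01: "\<And>x. x \<in> topspace X \<Longrightarrow> 0 \<le> p x \<and> p x \<le> 1"
      using p(1) by (auto simp: continuous_map_in_subtopology)
    have hc: "cts h" using h belowD by blast
    have b1: "(\<lambda>x. h x * p x) \<in> below U"
      unfolding below_def
    proof (intro CollectI conjI ballI impI)
      show "cts (\<lambda>x. h x * p x)" using hc pc by (rule continuous_map_real_mult)
      fix x assume x: "x \<in> topspace X"
      note hx = belowD(2,3)[OF h(1) x]
      show "0 \<le> h x * p x" "h x * p x \<le> 1" using hx p01[OF x] by (auto intro: mult_le_one)
      assume "x \<notin> U"
      then show "h x * p x = 0" using h0[OF x] p(2) by (cases "x \<in> K") auto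
    qed
    have b2: "(\<lambda>x. h x * (1 - p x)) \<in> below V"
      unfolding below_def
    proof (intro CollectI conjI ballI impI)
      show "cts (\<lambda>x. h x * (1 - p x))"
        using hc pc by (intro continuous_map_real_mult continuous_map_diff) auto
      fix x assume x: "x \<in> topspace X"
      note hx = belowD(2,3)[OF h(1) x]
      show "0 \<le> h x * (1 - p x)" "h x * (1 - p x) \<le> 1" using hx p01[OF x] by (auto intro: mult_le_one)
      assume "x \<notin> V"
      then show "h x * (1 - p x) = 0" using h0[OF x] p(3) by (cases "x \<in> K") auto
    qed
    have "L h = L (\<lambda>x. h x * p x + h x * (1 - p x))" by (simp add: algebra_simps)
    also have "\<dots> = L (\<lambda>x. h x * p x) + L (\<lambda>x. h x * (1 - p x))"
      using belowD(1)[OF b1] belowD(1)[OF b2] by (rule L_add)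
    finally have "ennreal (L h) = ennreal (L (\<lambda>x. h x * p x)) + ennreal (L (\<lambda>x. h x * (1 - p x)))"
      using below_L_nonneg[OF b1] below_L_nonneg[OF b2] by (simp add: ennreal_plus)
    also have "\<dots> \<le> open_content U + open_content V"
      using open_content_upper[OF b1] open_content_upper[OF b2] by (rule add_mono)
    finally have "ennreal (L h) + ennreal \<delta> \<le> open_content U + open_content V + ennreal \<delta>"
      by (rule add_right_mono)
    moreover have "ennreal (L g) \<le> ennreal (L h) + ennreal \<delta>"
      using h(2) \<delta> below_L_nonneg[OF h(1)] by (simp add: ennreal_plus[symmetric] del: ennreal_plus)
    ultimately show "ennreal (L g) \<le> open_content U + open_content V + ennreal \<delta>" by order
  qed
qed

lemma open_content_UN_finite:
  assumes "\<And>i::nat. openin X (U i)"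
  shows "open_content (\<Union>i<n. U i) \<le> (\<Sum>i<n. open_content (U i))"
proof (induction n)
  case 0
  then show ?case by (simp add: open_content_empty)
next
  case (Suc n)
  have "open_content (\<Union>i<Suc n. U i) = open_content ((\<Union>i<n. U i) \<union> U n)"
    by (simp add: lessThan_Suc Un_commute)
  also have "\<dots> \<le> open_content (\<Union>i<n. U i) + open_content (U n)"
    using assms by (intro open_content_Un) auto
  also have "\<dots> \<le> (\<Sum>i<n. open_content (U i)) + open_content (U n)"
    using Suc by (rule add_right_mono)
  finally show ?case by simp
qed

text \<open>The truncation of \<open>g\<close> vanishes off a compact set that finitely many
  \<open>U i\<close> already cover, so finite subadditivity is enough.\<close>

lemma open_content_UN:
  assumes U: "\<And>i::nat. openin X (U i)"
  shows "open_content (\<Union>i. U i) \<le> (\<Sum>i. open_content (U i))"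
  unfolding open_content_def[of "\<Union>i. U i"]
proof (rule SUP_least)
  fix g assume g: "g \<in> below (\<Union>i. U i)"
  show "ennreal (L g) \<le> (\<Sum>i. open_content (U i))"
  proof (rule ennreal_le_epsilon)
    fix \<delta> :: real assume \<delta>: "\<delta> > 0"
    define h where "h = (\<lambda>x. max 0 (g x - \<delta>))"
    have h: "h \<in> below (\<Union>i. U i)" "L g \<le> L h + \<delta>"
      unfolding h_def using below_truncate[OF g \<delta>] by auto
    define K where "K = {x \<in> topspace X. \<delta> \<le> g x}"
    have K: "closedin X K" unfolding K_def by (rule closedin_superlevel[OF belowD(1)[OF g]])
    have "compactin X K" using compact_X K by (rule closedin_compact_space)
    moreover have "K \<subseteq> \<Union>(range U)"
      using belowD(4)[OF g] \<delta> by (force simp: K_def)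
    ultimately obtain \<F> where \<F>: "finite \<F>" "\<F> \<subseteq> range U" "K \<subseteq> \<Union>\<F>"
      using compactinD[of X K "range U"] U by auto
    then obtain J where J: "finite J" "\<F> = U ` J"
      by (meson finite_subset_image)
    then obtain n where n: "J \<subseteq> {..<n}" using finite_nat_iff_bounded by blast
    have Kn: "K \<subseteq> (\<Union>i<n. U i)" using \<F> J n by blast
    have "h \<in> below (\<Union>i<n. U i)"
      unfolding below_def
    proof (intro CollectI conjI ballI impI)
      fix x assume "x \<in> topspace X" "x \<notin> (\<Union>i<n. U i)"
      then show "h x = 0" using Kn by (auto simp: K_def h_def max_def)
    qed (use h in \<open>auto simp: below_def\<close>)
    then have "ennreal (L h) \<le> open_content (\<Union>i<n. U i)" by (rule open_content_upper)
    also have "\<dots> \<le> (\<Sum>i<n. open_content (U i))" by (rule open_content_UN_finite[OF U])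
    also have "\<dots> \<le> (\<Sum>i. open_content (U i))" by (rule sum_le_suminf) auto
    finally have "ennreal (L h) + ennreal \<delta> \<le> (\<Sum>i. open_content (U i)) + ennreal \<delta>"
      by (rule add_right_mono)
    moreover have "ennreal (L g) \<le> ennreal (L h) + ennreal \<delta>"
      using h(2) \<delta> below_L_nonneg[OF h(1)] by (simp add: ennreal_plus[symmetric] del: ennreal_plus)
    ultimately show "ennreal (L g) \<le> (\<Sum>i. open_content (U i)) + ennreal \<delta>" by order
  qed
qed

lemma outer_open: "openin X U \<Longrightarrow> outer U = open_content U"
  unfolding outer_def by (intro antisym INF_greatest INF_lower) (auto intro: open_content_mono)

lemma outer_le: "openin X U \<Longrightarrow> A \<subseteq> U \<Longrightarrow> outer A \<le> open_content U"
  unfolding outer_def by (rule INF_lower) auto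

lemma outer_mono: "A \<subseteq> B \<Longrightarrow> outer A \<le> outer B"
  unfolding outer_def by (rule INF_superset_mono) auto

lemma outer_space: "outer_measure_space (Pow (topspace X)) outer"
  unfolding outer_measure_space_def
proof (intro conjI)
  show "positive (Pow (topspace X)) outer"
    using outer_open[of "{}"] by (simp add: positive_def open_content_empty)
  show "increasing (Pow (topspace X)) outer"
    by (simp add: increasing_def outer_mono)
  show "countably_subadditive (Pow (topspace X)) outer"
    unfolding countably_subadditive_def
  proof (intro allI impI)
    fix A :: "nat \<Rightarrow> 'b set"
    assume A: "range A \<subseteq> Pow (topspace X)"
    show "outer (\<Union>i. A i) \<le> (\<Sum>i. outer (A i))"
    proof (rule ennreal_le_epsilon)
      fix e :: real assume "0 < e" and fin: "(\<Sum>i. outer (A i)) < Orderings.top"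
      then have less: "outer (A n) < outer (A n) + ennreal (e * (1/2) ^ Suc n)" for n
        by (auto simp add: less_top dest!: ennreal_suminf_lessD)
      have "\<exists>U. openin X U \<and> A n \<subseteq> U \<and> open_content U \<le> outer (A n) + ennreal (e * (1/2) ^ Suc n)" for n
        using less[of n] unfolding outer_def[of "A n"] INF_less_iff
        by (auto intro: less_imp_le)
      then obtain U where U: "\<And>n. openin X (U n)" "\<And>n. A n \<subseteq> U n"
        "\<And>n. open_content (U n) \<le> outer (A n) + ennreal (e * (1/2) ^ Suc n)" by metis
      have "outer (\<Union>i. A i) \<le> open_content (\<Union>i. U i)"
        using U by (intro outer_le) auto
      also have "\<dots> \<le> (\<Sum>i. open_content (U i))" by (rule open_content_UN[OF U(1)])
      also have "\<dots> \<le> (\<Sum>i. outer (A i) + ennreal (e * (1/2) ^ Suc i))"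
        by (intro suminf_le U) auto
      also have "\<dots> = (\<Sum>i. outer (A i)) + (\<Sum>i. ennreal e * ennreal ((1/2) ^ Suc i))"
        using \<open>0 < e\<close> by (subst suminf_add[symmetric])
          (auto simp del: ennreal_suminf_cmult simp add: ennreal_mult[symmetric])
      also have "\<dots> = (\<Sum>i. outer (A i)) + e"
        unfolding ennreal_suminf_cmult
        by (subst suminf_ennreal_eq[OF zero_le_power power_half_series]) auto
      finally show "outer (\<Union>i. A i) \<le> (\<Sum>i. outer (A i)) + e" .
    qed
  qed
qed

text \<open>This is the nontrivial half of Caratheodory's criterion for \<open>V\<close>, tested on
  open \<open>U\<close>. The truncation \<open>h\<close> of a function below
  \<open>U \<inter> V\<close> vanishes off a closed \<open>K\<close> inside \<open>V\<close>, and
  \<open>U - V\<close> lies in the open set \<open>U - K\<close>. A function \<open>k\<close> below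
  \<open>U - K\<close> vanishes on \<open>K\<close>, so at each point at most one of
  \<open>h\<close> and \<open>k\<close> is nonzero and \<open>h + k\<close> is still below
  \<open>U\<close>.\<close>

lemma outer_split:
  assumes V: "openin X V" and U: "openin X U"
  shows "outer (U \<inter> V) + outer (U - V) \<le> open_content U"
proof -
  have "outer (U \<inter> V) = open_content (U \<inter> V)" using U V by (intro outer_open) auto
  also have "\<dots> + outer (U - V) = (SUP g\<in>below (U \<inter> V). ennreal (L g) + outer (U - V))"
    unfolding open_content_def using zero_below by (subst ennreal_SUP_add_left) auto
  also have "\<dots> \<le> open_content U"
  proof (rule SUP_least)
    fix g assume g: "g \<in> below (U \<inter> V)"
    show "ennreal (L g) + outer (U - V) \<le> open_content U"
    proof (rule ennreal_le_epsilon)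
      fix \<delta> :: real assume \<delta>: "\<delta> > 0"
      define h where "h = (\<lambda>x. max 0 (g x - \<delta>))"
      have h: "h \<in> below (U \<inter> V)" "L g \<le> L h + \<delta>"
        unfolding h_def using below_truncate[OF g \<delta>] by auto
      define K where "K = {x \<in> topspace X. \<delta> \<le> g x}"
      have K: "closedin X K" unfolding K_def by (rule closedin_superlevel[OF belowD(1)[OF g]])
      have h0: "h x = 0" if "x \<in> topspace X" "x \<notin> K" for x
        using that by (auto simp: K_def h_def)
      have KV: "K \<subseteq> V" using belowD(4)[OF g] \<delta> by (force simp: K_def)
      have "ennreal (L h) + outer (U - V) \<le> ennreal (L h) + open_content (U - K)"
        using U K KV by (intro add_left_mono outer_le openin_diff) auto
      also have "\<dots> = (SUP k\<in>below (U - K). ennreal (L h) + ennreal (L k))"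
        unfolding open_content_def using zero_below by (subst ennreal_SUP_add_right) auto
      also have "\<dots> \<le> open_content U"
      proof (rule SUP_least)
        fix k assume k: "k \<in> below (U - K)"
        have "(\<lambda>x. h x + k x) \<in> below U"
          unfolding below_def
        proof (intro CollectI conjI ballI impI)
          show "cts (\<lambda>x. h x + k x)" using belowD(1)[OF h(1)] belowD(1)[OF k] by (rule continuous_map_add)
          fix x assume x: "x \<in> topspace X"
          note hx = belowD(2,3,4)[OF h(1) x] belowD(2,3,4)[OF k x] h0[OF x]
          show "0 \<le> h x + k x" using hx by auto
          show "h x + k x \<le> 1" using hx by (cases "x \<in> K") auto
          assume "x \<notin> U"
          then show "h x + k x = 0" using hx by auto
        qed
        then have "ennreal (L (\<lambda>x. h x + k x)) \<le> open_content U" by (rule open_content_upper)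
        then show "ennreal (L h) + ennreal (L k) \<le> open_content U"
          using L_add[OF belowD(1)[OF h(1)] belowD(1)[OF k]] below_L_nonneg[OF h(1)] below_L_nonneg[OF k]
          by (simp add: ennreal_plus)
      qed
      finally have "ennreal (L h) + outer (U - V) + ennreal \<delta> \<le> open_content U + ennreal \<delta>"
        by (rule add_right_mono)
      moreover have "ennreal (L g) \<le> ennreal (L h) + ennreal \<delta>"
        using h(2) \<delta> below_L_nonneg[OF h(1)] by (simp add: ennreal_plus[symmetric] del: ennreal_plus)
      then have "ennreal (L g) + outer (U - V) \<le> ennreal (L h) + ennreal \<delta> + outer (U - V)"
        by (rule add_right_mono)
      moreover have "ennreal (L h) + ennreal \<delta> + outer (U - V) = ennreal (L h) + outer (U - V) + ennreal \<delta>"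
        by (simp only: add_ac)
      ultimately show "ennreal (L g) + outer (U - V) \<le> open_content U + ennreal \<delta>"
        by order
    qed
  qed
  finally show ?thesis .
qed

lemma open_in_lambda_system:
  assumes V: "openin X V"
  shows "V \<in> lambda_system (topspace X) (Pow (topspace X)) outer"
proof -
  interpret sigma_algebra "topspace X" "Pow (topspace X)" by (rule sigma_algebra_Pow)
  have "outer (A \<inter> V) + outer (A - V) = outer A" if A: "A \<subseteq> topspace X" for A
  proof (rule antisym)
    show "outer (A \<inter> V) + outer (A - V) \<le> outer A"
      unfolding outer_def[of A]
    proof (rule INF_greatest)
      fix U assume "U \<in> {U. openin X U \<and> A \<subseteq> U}"
      then have U: "openin X U" "A \<subseteq> U" by auto
      have "outer (A \<inter> V) + outer (A - V) \<le> outer (U \<inter> V) + outer (U - V)"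
        using U by (intro add_mono outer_mono) auto
      also have "\<dots> \<le> open_content U" by (rule outer_split[OF V U(1)])
      finally show "outer (A \<inter> V) + outer (A - V) \<le> open_content U" .
    qed
    have "subadditive (Pow (topspace X)) outer"
      using outer_space countably_subadditive_subadditive[of outer]
      by (auto simp: outer_measure_space_def)
    then have "outer ((A \<inter> V) \<union> (A - V)) \<le> outer (A \<inter> V) + outer (A - V)"
      using A by (intro subadditiveD) auto
    then show "outer A \<le> outer (A \<inter> V) + outer (A - V)"
      by (simp add: Int_Diff_Un)
  qed
  then show ?thesis
    using openin_subset[OF V] by (simp add: lambda_system_eq)
qed

text \<open>Caratheodory's construction gives a measure on the whole lambda system of
  \<open>outer\<close>; restricting it to the \<sigma>-algebra generated by the open sets makes it
  one of the measures over which strong proximality quantifies.\<close>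

definition riesz_measure :: "'b measure" where
  "riesz_measure = measure_of (topspace X) (sigma_sets (topspace X) {U. openin X U}) outer"

lemma open_subset_Pow: "{U. openin X U} \<subseteq> Pow (topspace X)"
  using openin_subset by auto

lemma sets_riesz: "sets riesz_measure = sets (borel_of X)"
  unfolding riesz_measure_def borel_of_def
  using open_subset_Pow sigma_sets_into_sp[OF open_subset_Pow]
  by (subst (1 2) sets_measure_of) (auto simp: sigma_sets_sigma_sets_eq)

lemma space_riesz: "space riesz_measure = topspace X"
  unfolding riesz_measure_def
  by (rule space_measure_of) (use sigma_sets_into_sp[OF open_subset_Pow] in auto)

lemma emeasure_riesz_open:
  assumes "openin X U"
  shows "emeasure riesz_measure U = open_content U"
proof -
  interpret sigma_algebra "topspace X" "Pow (topspace X)" by (rule sigma_algebra_Pow)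
  let ?\<Lambda> = "lambda_system (topspace X) (Pow (topspace X)) outer"
  have ms: "measure_space (topspace X) ?\<Lambda> outer"
    by (rule caratheodory_lemma[OF outer_space])
  then have sa: "sigma_algebra (topspace X) ?\<Lambda>" by (simp add: measure_space_def)
  have sub: "sigma_sets (topspace X) {U. openin X U} \<subseteq> ?\<Lambda>"
    using open_in_lambda_system by (intro sigma_algebra.sigma_sets_subset[OF sa]) auto
  have "sigma_algebra (topspace X) (sigma_sets (topspace X) {U. openin X U})"
    by (rule sigma_algebra_sigma_sets[OF open_subset_Pow])
  from measure_down[OF ms this sub] have "emeasure riesz_measure U = outer U"
    unfolding riesz_measure_def using assms
    by (intro emeasure_measure_of_sigma) (auto simp: measure_space_def)
  then show ?thesis using outer_open[OF assms] by simp
qed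

lemma prob_space_riesz: "prob_space riesz_measure"
  by (rule prob_spaceI) (simp add: space_riesz emeasure_riesz_open open_content_topspace)

end

section \<open>Integration of continuous functions against Borel probability measures\<close>

lemma sets_borel_of_open: "openin X U \<Longrightarrow> U \<in> sets (borel_of X)"
  unfolding borel_of_def using openin_subset by (subst sets_measure_of) auto

lemma space_borel_of: "space (borel_of X) = topspace X"
  unfolding borel_of_def using openin_subset by (subst space_measure_of) auto

lemma borel_measurable_continuous_map:
  fixes f :: "'b \<Rightarrow> 'c::topological_space"
  assumes f: "continuous_map X euclidean f" and M: "sets M = sets (borel_of X)"
  shows "f \<in> borel_measurable M"
proof (rule borel_measurableI)
  fix S :: "'c set" assume "open S"
  then have "openin X {x \<in> topspace X. f x \<in> S}"
    using f by (intro openin_continuous_map_preimage) auto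
  moreover have "f -` S \<inter> space M = {x \<in> topspace X. f x \<in> S}"
    using sets_eq_imp_space_eq[OF M] by (auto simp: space_borel_of)
  ultimately show "f -` S \<inter> space M \<in> sets M"
    using M sets_borel_of_open by metis
qed

lemma continuous_map_bounded:
  fixes f :: "'b \<Rightarrow> 'c::real_normed_vector"
  assumes "compact_space X" "continuous_map X euclidean f"
  obtains B where "B > 0" "\<And>x. x \<in> topspace X \<Longrightarrow> norm (f x) \<le> B"
proof -
  have "compactin euclidean (f ` topspace X)"
    using assms image_compactin[of X "topspace X" euclidean f] by (simp add: compact_space_def)
  then have "bounded (f ` topspace X)" by (simp add: compact_imp_bounded)
  then show ?thesis using that unfolding bounded_pos by auto
qed

lemma integrable_continuous_map:
  fixes f :: "'b \<Rightarrow> 'c::{banach, second_countable_topology}"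
  assumes "compact_space X" and f: "continuous_map X euclidean f" and M: "sets M = sets (borel_of X)"
    and "prob_space M"
  shows "integrable M f"
proof -
  interpret prob_space M by fact
  obtain B where "\<And>x. x \<in> topspace X \<Longrightarrow> norm (f x) \<le> B"
    using continuous_map_bounded[OF assms(1) f] by blast
  then show ?thesis
    using borel_measurable_continuous_map[OF f M] sets_eq_imp_space_eq[OF M]
    by (intro integrable_const_bound[of _ B]) (auto simp: space_borel_of)
qed

text \<open>A discrete layer-cake decomposition: the summand for \<open>k\<close> is the part of
  \<open>t\<close> lying between the heights \<open>k\<close> and \<open>k + 1\<close>.\<close>

lemma sum_unit_slices:
  fixes t :: real
  assumes "0 \<le> t"
  shows "(\<Sum>k<n. min 1 (max 0 (t - real k))) = min t (real n)"
  using assms by (induction n) (auto simp: min_def max_def)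

context compact_state
begin

text \<open>Cut \<open>n * f\<close> into unit slices \<open>s k\<close> and let \<open>U k\<close>
  be the open set \<open>n * f > k\<close>. Then \<open>s k\<close> is below \<open>U k\<close>,
  which bounds \<open>L (s k)\<close> by the measure of \<open>U k\<close>, and \<open>s k\<close>
  dominates the indicator of \<open>U (Suc k)\<close>. Summing, the index shift costs only the
  measure of \<open>U 0\<close>, at most 1, and division by \<open>n\<close> makes this
  small.\<close>

lemma L_le_integral:
  assumes f: "cts f" and f01: "\<And>x. x \<in> topspace X \<Longrightarrow> 0 \<le> f x \<and> f x \<le> 1"
  shows "L f \<le> (\<integral>x. f x \<partial>riesz_measure)"
proof (rule field_le_epsilon)
  fix e :: real assume "e > 0"
  interpret prob_space riesz_measure by (rule prob_space_riesz)
  note int = integrable_continuous_map[OF compact_X _ sets_riesz prob_space_riesz]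
  obtain n where n: "n > 0" "1 / real n < e"
    by (rule nat_approx_posE[OF \<open>e > 0\<close>]) (rule that, auto)
  define s where "s = (\<lambda>k x. min 1 (max 0 (real n * f x - real k)))"
  define U where "U = (\<lambda>k. {x \<in> topspace X. real k < real n * f x})"
  have s: "cts (s k)" for k
    unfolding s_def using f
    by (intro continuous_map_real_min continuous_map_real_max continuous_map_diff continuous_map_real_mult_left) auto
  have nf: "cts (\<lambda>x. real n * f x)" using f by (rule continuous_map_real_mult_left)
  have U: "openin X (U k)" for k
    using openin_continuous_map_preimage[OF nf, of "{real k<..}"] by (simp add: U_def)
  have sumf: "(\<Sum>k<n. s k x) = real n * f x" if "x \<in> topspace X" for x
    using sum_unit_slices[of "real n * f x" n] f01[OF that] by (simp add: s_def mult_left_le)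
  have up: "L (s k) \<le> measure riesz_measure (U k)" for k
  proof -
    have "s k \<in> below (U k)"
      using s by (auto simp: below_def s_def U_def)
    from open_content_upper[OF this] have "ennreal (L (s k)) \<le> emeasure riesz_measure (U k)"
      by (simp add: emeasure_riesz_open U)
    then show ?thesis by (simp add: emeasure_eq_measure)
  qed
  have low: "measure riesz_measure (U (Suc k)) \<le> (\<integral>x. s k x \<partial>riesz_measure)" for k
  proof -
    have Us: "U (Suc k) \<in> sets riesz_measure" using U sets_borel_of_open sets_riesz by blast
    have "measure riesz_measure (U (Suc k)) = (\<integral>x. indicator (U (Suc k)) x \<partial>riesz_measure)"
      using Us sets.sets_into_space by (simp add: Int_absorb2)
    also have "\<dots> \<le> (\<integral>x. s k x \<partial>riesz_measure)"
    proof (rule integral_mono)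
      show "integrable riesz_measure (indicator (U (Suc k)) :: 'b \<Rightarrow> real)"
        using Us by (simp add: emeasure_eq_measure)
    qed (use int[OF s] in \<open>auto simp: indicator_def s_def U_def\<close>)
    finally show ?thesis .
  qed
  have "real n * L f = L (\<lambda>x. real n * f x)" using f by (simp add: L_scale)
  also have "\<dots> \<le> L (\<lambda>x. \<Sum>k<n. s k x)"
    using nf s sumf by (intro L_mono continuous_map_sum) auto
  also have "\<dots> = (\<Sum>k<n. L (s k))" using s by (intro L_sum) auto
  also have "\<dots> \<le> (\<Sum>k<n. measure riesz_measure (U k))" by (intro sum_mono up)
  also have "\<dots> \<le> 1 + (\<Sum>k<n. measure riesz_measure (U (Suc k)))"
  proof -
    have "(\<Sum>k<n. measure riesz_measure (U k)) \<le> (\<Sum>k<Suc n. measure riesz_measure (U k))" by simp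
    also have "\<dots> = measure riesz_measure (U 0) + (\<Sum>k<n. measure riesz_measure (U (Suc k)))"
      by (rule sum.lessThan_Suc_shift)
    finally show ?thesis using prob_le_1[of "U 0"] by linarith
  qed
  also have "\<dots> \<le> 1 + (\<Sum>k<n. \<integral>x. s k x \<partial>riesz_measure)"
    by (intro add_left_mono sum_mono low)
  also have "\<dots> = 1 + (\<integral>x. (\<Sum>k<n. s k x) \<partial>riesz_measure)"
    using int[OF s] by simp
  also have "\<dots> = 1 + (\<integral>x. real n * f x \<partial>riesz_measure)"
    using sumf by (intro arg_cong2[where f="(+)"] Bochner_Integration.integral_cong) (auto simp: space_riesz)
  also have "\<dots> = 1 + real n * (\<integral>x. f x \<partial>riesz_measure)" by simp
  finally have "L f \<le> 1 / real n + (\<integral>x. f x \<partial>riesz_measure)"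
    using n by (simp add: field_simps)
  then show "L f \<le> (\<integral>x. f x \<partial>riesz_measure) + e" using n by linarith
qed

text \<open>An inequality between linear functionals becomes an equality once it is applied to
  \<open>f\<close> and to \<open>- f\<close>. It is available for values in [0,1] only, so both are
  first scaled by \<open>1 / (2 * B)\<close> and shifted by \<open>1/2\<close>.\<close>

lemma integral_riesz:
  assumes f: "cts f"
  shows "(\<integral>x. f x \<partial>riesz_measure) = L f"
proof -
  interpret prob_space riesz_measure by (rule prob_space_riesz)
  have int: "integrable riesz_measure f"
    by (rule integrable_continuous_map[OF compact_X f sets_riesz prob_space_riesz])
  obtain B where B: "B > 0" "\<And>x. x \<in> topspace X \<Longrightarrow> norm (f x) \<le> B"
    using continuous_map_bounded[OF compact_X f] by blast
  define c where "c = 1 / (2 * B)"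
  have cf: "cts (\<lambda>x. c * f x)" using f by (rule continuous_map_real_mult_left)
  have Lc: "L (\<lambda>x. c * f x + 1/2) = c * L f + 1/2"
    using L_add[OF cf, of "\<lambda>_. 1/2"] f by (simp add: L_const L_scale)
  have Lc': "L (\<lambda>x. 1/2 - c * f x) = 1/2 - c * L f"
    using L_diff[OF _ cf, of "\<lambda>_. 1/2"] f by (simp add: L_const L_scale)
  have half: "\<bar>c * f x\<bar> \<le> 1/2" if "x \<in> topspace X" for x
    using B(2)[OF that] B(1) by (simp add: c_def abs_mult field_simps)
  have bounds: "0 \<le> c * f x + 1/2" "c * f x + 1/2 \<le> 1" "0 \<le> 1/2 - c * f x" "1/2 - c * f x \<le> 1"
    if "x \<in> topspace X" for x
    using half[OF that] by linarith+
  have "L (\<lambda>x. c * f x + 1/2) \<le> (\<integral>x. c * f x + 1/2 \<partial>riesz_measure)"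
    using bounds by (intro L_le_integral continuous_map_add cf) auto
  moreover have "(\<integral>x. c * f x + 1/2 \<partial>riesz_measure) = c * (\<integral>x. f x \<partial>riesz_measure) + 1/2"
    using int by (simp add: prob_space)
  moreover have "L (\<lambda>x. 1/2 - c * f x) \<le> (\<integral>x. 1/2 - c * f x \<partial>riesz_measure)"
    using bounds by (intro L_le_integral continuous_map_diff cf) auto
  moreover have "(\<integral>x. 1/2 - c * f x \<partial>riesz_measure) = 1/2 - c * (\<integral>x. f x \<partial>riesz_measure)"
    using int by (simp add: prob_space)
  ultimately have "c * L f = c * (\<integral>x. f x \<partial>riesz_measure)"
    using Lc Lc' by linarith
  moreover have "c \<noteq> 0" using B(1) by (simp add: c_def)
  ultimately show ?thesis by simp
qed

end

subsection \<open>Unital positive equivariant maps on bounded functions\<close>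

text \<open>The sets on which equation \<open>e\<close> holds up to \<open>1 / Suc n\<close> are
  closed and have the finite intersection property. Limit arguments below take this form: instead of
  nets, finitely many approximate equations at a time.\<close>

lemma compact_space_approx_solution:
  fixes u :: "'e \<Rightarrow> 'a \<Rightarrow> real" and c :: "'e \<Rightarrow> real"
  assumes cpt: "compact_space Z"
    and cont: "\<And>e. e \<in> E \<Longrightarrow> continuous_map Z euclideanreal (u e)"
    and approx: "\<And>F \<epsilon>. finite F \<Longrightarrow> F \<subseteq> E \<Longrightarrow> \<epsilon> > 0 \<Longrightarrow> \<exists>x\<in>topspace Z. \<forall>e\<in>F. \<bar>u e x - c e\<bar> \<le> \<epsilon>"
  shows "\<exists>x\<in>topspace Z. \<forall>e\<in>E. u e x = c e"
proof -
  define C where "C = (\<lambda>(e, n::nat). {x \<in> topspace Z. u e x \<in> cball (c e) (1 / Suc n)})"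
  \<comment> \<open>The whole space is included so that the common point lies in it even if
    \<open>E\<close> is empty.\<close>
  define \<U> where "\<U> = insert (topspace Z) (C ` (E \<times> UNIV))"
  have "\<Inter>\<U> \<noteq> {}"
  proof (rule cpt[unfolded compact_space_fip, rule_format], intro conjI ballI allI impI)
    fix K assume "K \<in> \<U>"
    then show "closedin Z K"
      using cont by (auto simp: \<U>_def C_def simp del: mem_cball intro!: closedin_continuous_map_preimage)
  next
    fix \<F> assume "finite \<F> \<and> \<F> \<subseteq> \<U>"
    then have "finite (\<F> - {topspace Z})" "\<F> - {topspace Z} \<subseteq> C ` (E \<times> UNIV)"
      by (auto simp: \<U>_def)
    then obtain P where P: "finite P" "P \<subseteq> E \<times> UNIV" "\<F> - {topspace Z} = C ` P"
      by (meson finite_subset_image)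
    define N where "N = Max (insert 0 (snd ` P))"
    have "\<exists>x\<in>topspace Z. \<forall>e\<in>fst ` P. \<bar>u e x - c e\<bar> \<le> 1 / Suc N"
      using P by (intro approx) auto
    then obtain x where x: "x \<in> topspace Z" "\<And>e. e \<in> fst ` P \<Longrightarrow> \<bar>u e x - c e\<bar> \<le> 1 / Suc N"
      by blast
    have xC: "x \<in> C p" if "p \<in> P" for p
    proof -
      obtain e n where p: "p = (e, n)" by (cases p)
      have "n \<le> N" unfolding N_def using that P p by (intro Max_ge) force+
      then have "1 / real (Suc N) \<le> 1 / real (Suc n)" by (simp add: frac_le)
      moreover have "\<bar>u e x - c e\<bar> \<le> 1 / Suc N" using x(2)[of e] that p by force
      ultimately show ?thesis using x(1) p
        by (simp add: C_def dist_real_def abs_minus_commute)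
    qed
    have "x \<in> K" if "K \<in> \<F>" for K
    proof (cases "K = topspace Z")
      case False
      then have "K \<in> C ` P" unfolding P(3)[symmetric] using that by simp
      then show ?thesis using xC by blast
    qed (simp add: x(1))
    then show "\<Inter>\<F> \<noteq> {}" by blast
  qed
  then obtain x where x: "x \<in> \<Inter>\<U>" by blast
  have "u e x = c e" if "e \<in> E" for e
  proof -
    have "\<bar>c e - u e x\<bar> \<le> 1 / Suc n" for n
      using x that by (auto simp: \<U>_def C_def dist_real_def)
    then have "\<bar>c e - u e x\<bar> \<le> 0"
      by (metis nat_approx_posE not_le order_less_le_trans less_irrefl)
    then show ?thesis by simp
  qed
  then show ?thesis using x by (auto simp: \<U>_def)
qed

lemma Hausdorff_space_euclidean_fun:
  "Hausdorff_space (euclidean :: ('a \<Rightarrow> 'b \<Rightarrow> 'c::metric_space) topology)"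
proof -
  have "Hausdorff_space (product_topology (\<lambda>_. product_topology (\<lambda>_. euclidean::'c topology) (UNIV::'b set)) (UNIV::'a set))"
    by (simp add: Hausdorff_space_product_topology)
  then show ?thesis by (simp only: euclidean_product_topology)
qed

lemma continuous_on_eval2:
  "continuous_on S (\<lambda>F :: 'a \<Rightarrow> 'b \<Rightarrow> 'c::topological_space. F a h)"
  using continuous_on_product_then_coordinatewise[OF continuous_on_product_coordinates[of a], of h]
  by (rule continuous_on_subset) simp

lemma compact_fun_box:
  fixes r :: "'a \<Rightarrow> 'b \<Rightarrow> real"
  shows "compact {F :: 'a \<Rightarrow> 'b \<Rightarrow> complex. \<forall>a h. norm (F a h) \<le> r a h}"
proof -
  have inner: "compactin euclidean (Pi\<^sub>E UNIV (\<lambda>h. cball (0::complex) (r a h)))" for a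
    unfolding euclidean_product_topology[symmetric] by (subst compactin_PiE) auto
  have "compactin euclidean (Pi\<^sub>E UNIV (\<lambda>a. Pi\<^sub>E UNIV (\<lambda>h. cball (0::complex) (r a h))))"
    by (subst euclidean_product_topology[symmetric], subst compactin_PiE) (use inner in auto)
  moreover have "Pi\<^sub>E UNIV (\<lambda>a. Pi\<^sub>E UNIV (\<lambda>h. cball (0::complex) (r a h))) = {F. \<forall>a h. norm (F a h) \<le> r a h}"
    by (auto simp: PiE_UNIV_domain Pi_iff)
  ultimately show ?thesis by simp
qed

section \<open>Bounded functions on the group and their left translates\<close>

lemma linfI: "(\<And>h. h \<in> carrier G \<Longrightarrow> norm (a h) \<le> B) \<Longrightarrow> (\<And>h. h \<notin> carrier G \<Longrightarrow> a h = 0) \<Longrightarrow> a \<in> linf G"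
  unfolding linf_def bounded_iff by blast

lemma linf_outside: "a \<in> linf G \<Longrightarrow> h \<notin> carrier G \<Longrightarrow> a h = 0"
  unfolding linf_def by auto

lemma linf_bound:
  assumes "a \<in> linf G"
  obtains B where "B \<ge> 0" "\<And>h. norm (a h) \<le> B"
proof -
  from assms obtain B where B: "B > 0" "\<And>h. h \<in> carrier G \<Longrightarrow> norm (a h) \<le> B"
    unfolding linf_def bounded_pos by auto
  have "norm (a h) \<le> B" for h
    using B linf_outside[OF assms] by (cases "h \<in> carrier G") auto
  then show ?thesis using that B(1) by (metis less_imp_le)
qed

text \<open>One argument serves many pointwise operations: \<open>f 0 0 = 0\<close> preserves the
  convention that members of \<open>linf G\<close> vanish off the carrier, and \<open>k\<close>
  bounds \<open>f\<close> on bounded arguments.\<close>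

lemma linf_comp2:
  assumes "a \<in> linf G" "b \<in> linf G" and f0: "f 0 0 = 0"
    and f: "\<And>B x y. norm x \<le> B \<Longrightarrow> norm y \<le> B \<Longrightarrow> norm (f x y) \<le> k B"
  shows "(\<lambda>h. f (a h) (b h)) \<in> linf G"
proof -
  obtain A where A: "\<And>h. norm (a h) \<le> A" using linf_bound assms(1) by blast
  obtain B where B: "\<And>h. norm (b h) \<le> B" using linf_bound assms(2) by blast
  show ?thesis
  proof (rule linfI)
    show "norm (f (a h) (b h)) \<le> k (max A B)" for h
      using A[of h] B[of h] by (intro f) auto
  qed (simp add: linf_outside[OF assms(1)] linf_outside[OF assms(2)] f0)
qed

lemma linf_add:
  assumes "a \<in> linf G" "b \<in> linf G"
  shows "(\<lambda>h. a h + b h) \<in> linf G"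
proof (rule linf_comp2[where f="(+)" and k="\<lambda>B. 2 * B", OF assms])
  show "norm (x + y) \<le> 2 * B" if "norm x \<le> B" "norm y \<le> B" for B and x y :: complex
    using norm_triangle_ineq[of x y] that by linarith
qed simp

lemma linf_mult: "a \<in> linf G \<Longrightarrow> b \<in> linf G \<Longrightarrow> (\<lambda>h. a h * b h) \<in> linf G"
  by (rule linf_comp2[where f="(*)" and k="\<lambda>B. B * B"])
     (auto simp: norm_mult intro!: mult_mono intro: order_trans[OF norm_ge_zero])

lemma linf_scale: "a \<in> linf G \<Longrightarrow> (\<lambda>h. c * a h) \<in> linf G"
  using linf_comp2[of a G a "\<lambda>x y. c * x" "\<lambda>B. norm c * B"] by (simp add: norm_mult mult_left_mono)

lemma linf_diff: "a \<in> linf G \<Longrightarrow> b \<in> linf G \<Longrightarrow> (\<lambda>h. a h - b h) \<in> linf G"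
  using linf_add[of a G "\<lambda>h. (-1) * b h"] linf_scale[of b G "-1"] by simp

lemma linf_cnj: "a \<in> linf G \<Longrightarrow> (\<lambda>h. cnj (a h)) \<in> linf G"
  using linf_comp2[of a G a "\<lambda>x y. cnj x" "\<lambda>B. B"] by simp

lemma linf_Re: "a \<in> linf G \<Longrightarrow> (\<lambda>h. complex_of_real (Re (a h))) \<in> linf G"
  using linf_comp2[of a G a "\<lambda>x y. complex_of_real (Re x)" "\<lambda>B. B"]
  by (simp add: order_trans[OF abs_Re_le_cmod])

lemma linf_Im: "a \<in> linf G \<Longrightarrow> (\<lambda>h. complex_of_real (Im (a h))) \<in> linf G"
  using linf_comp2[of a G a "\<lambda>x y. complex_of_real (Im x)" "\<lambda>B. B"]
  by (simp add: order_trans[OF abs_Im_le_cmod])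

lemma linf_one_in: "linf_one G \<in> linf G"
  by (rule linfI[of _ _ 1]) (auto simp: linf_one_def)

lemma linf_zero: "(\<lambda>h. 0) \<in> linf G"
  by (rule linfI[of _ _ 0]) auto

lemma linf_const: "(\<lambda>h. c * linf_one G h) \<in> linf G"
  by (rule linf_scale[OF linf_one_in])

lemma linf_sum: "finite A \<Longrightarrow> (\<And>i. i \<in> A \<Longrightarrow> a i \<in> linf G) \<Longrightarrow> (\<lambda>h. \<Sum>i\<in>A. a i h) \<in> linf G"
  by (induction A rule: finite_induct) (auto simp: linf_zero intro: linf_add)

lemma (in group) linf_ltr: "a \<in> linf G \<Longrightarrow> g \<in> carrier G \<Longrightarrow> ltr G g a \<in> linf G"
proof -
  assume a: "a \<in> linf G" and "g \<in> carrier G"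
  obtain B where "\<And>h. norm (a h) \<le> B" using linf_bound[OF a] by blast
  then show ?thesis by (intro linfI[of _ _ B]) (auto simp: ltr_def)
qed

lemma (in group) ltr_ltr:
  assumes "g \<in> carrier G" "k \<in> carrier G"
  shows "ltr G g (ltr G k a) = ltr G (g \<otimes> k) a"
  using assms by (auto simp: ltr_def fun_eq_iff inv_mult_group m_assoc)

lemma (in group) ltr_id: "a \<in> linf G \<Longrightarrow> ltr G \<one> a = a"
  by (auto simp: ltr_def fun_eq_iff linf_outside)

lemma (in group) ltr_one: "g \<in> carrier G \<Longrightarrow> ltr G g (linf_one G) = linf_one G"
  by (auto simp: ltr_def linf_one_def fun_eq_iff)

lemma ltr_add: "ltr G g (\<lambda>h. a h + b h) = (\<lambda>h. ltr G g a h + ltr G g b h)"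
  by (auto simp: ltr_def)

lemma ltr_scale: "ltr G g (\<lambda>h. c * a h) = (\<lambda>h. c * ltr G g a h)"
  by (auto simp: ltr_def)

lemma ltr_mult: "ltr G g (\<lambda>h. a h * b h) = (\<lambda>h. ltr G g a h * ltr G g b h)"
  by (auto simp: ltr_def)

lemma ltr_pos: "linf_pos a \<Longrightarrow> linf_pos (ltr G g a)"
  by (auto simp: ltr_def linf_pos_def)

text \<open>These are the conditions of \<open>G_projection\<close> except idempotence. Such maps,
  unlike projections, are closed under composition and averaging, and the maps built from Poisson
  transforms are of this kind.\<close>

locale linf_map = group G for G :: "('g, 'm) monoid_scheme" (structure) +
  fixes F :: "('g \<Rightarrow> complex) \<Rightarrow> ('g \<Rightarrow> complex)"
  assumes F_in: "a \<in> linf G \<Longrightarrow> F a \<in> linf G"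
    and F_add: "a \<in> linf G \<Longrightarrow> b \<in> linf G \<Longrightarrow> F (\<lambda>h. a h + b h) = (\<lambda>h. F a h + F b h)"
    and F_scale: "a \<in> linf G \<Longrightarrow> F (\<lambda>h. c * a h) = (\<lambda>h. c * F a h)"
    and F_one: "F (linf_one G) = linf_one G"
    and F_pos: "a \<in> linf G \<Longrightarrow> linf_pos a \<Longrightarrow> linf_pos (F a)"
    and F_ltr: "g \<in> carrier G \<Longrightarrow> a \<in> linf G \<Longrightarrow> F (ltr G g a) = ltr G g (F a)"
begin

lemma F_zero: "F (\<lambda>h. 0) = (\<lambda>h. 0)"
  using F_scale[OF linf_one_in, of 0] by simp

lemma F_diff: "a \<in> linf G \<Longrightarrow> b \<in> linf G \<Longrightarrow> F (\<lambda>h. a h - b h) = (\<lambda>h. F a h - F b h)"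
  using F_add[of a "\<lambda>h. (-1) * b h"] F_scale[of b "-1"] linf_scale[of b G "-1"] by simp

lemma F_sum:
  "finite A \<Longrightarrow> (\<And>i. i \<in> A \<Longrightarrow> a i \<in> linf G) \<Longrightarrow> F (\<lambda>h. \<Sum>i\<in>A. a i h) = (\<lambda>h. \<Sum>i\<in>A. F (a i) h)"
  by (induction A rule: finite_induct) (auto simp: F_zero F_add linf_sum)

lemma F_le:
  assumes "a \<in> linf G" "b \<in> linf G" "\<And>h. Im (a h) = 0" "\<And>h. Im (b h) = 0" "\<And>h. Re (a h) \<le> Re (b h)"
  shows "Re (F a h) \<le> Re (F b h)"
proof -
  have "linf_pos (F (\<lambda>h. b h - a h))"
    using assms by (intro F_pos linf_diff) (auto simp: linf_pos_def)
  then show ?thesis using assms by (simp add: F_diff linf_pos_def)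
qed

text \<open>Adding to \<open>a\<close> a bound \<open>B\<close> times the unit makes it positive,
  and \<open>F\<close> fixes the unit.\<close>

lemma F_real:
  assumes a: "a \<in> linf G" and re: "\<And>h. Im (a h) = 0"
  shows "Im (F a h) = 0"
proof -
  obtain B where B: "B \<ge> 0" "\<And>h. norm (a h) \<le> B" using linf_bound[OF a] by blast
  let ?b = "\<lambda>h. complex_of_real B * linf_one G h"
  have b: "?b \<in> linf G" by (rule linf_const)
  have "linf_pos (\<lambda>h. a h + ?b h)"
    unfolding linf_pos_def
  proof (intro allI conjI)
    fix h
    show "Im (a h + ?b h) = 0" by (simp add: re linf_one_def)
    show "0 \<le> Re (a h + ?b h)"
      using B(2)[of h] abs_Re_le_cmod[of "a h"] linf_outside[OF a, of h] by (auto simp: linf_one_def)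
  qed
  then have "linf_pos (F (\<lambda>h. a h + ?b h))" by (intro F_pos linf_add a b)
  then have "Im (F a h + complex_of_real B * linf_one G h) = 0"
    unfolding F_add[OF a b] F_scale[OF linf_one_in] F_one by (simp add: linf_pos_def)
  then show ?thesis by (simp add: linf_one_def split: if_splits)
qed

lemma F_ReIm:
  assumes a: "a \<in> linf G"
  shows "F a = (\<lambda>h. F (\<lambda>h. complex_of_real (Re (a h))) h + \<i> * F (\<lambda>h. complex_of_real (Im (a h))) h)"
proof -
  have "F a = F (\<lambda>h. complex_of_real (Re (a h)) + \<i> * complex_of_real (Im (a h)))"
    by (simp add: complex_eq[symmetric])
  also have "\<dots> = (\<lambda>h. F (\<lambda>h. complex_of_real (Re (a h))) h + \<i> * F (\<lambda>h. complex_of_real (Im (a h))) h)"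
    using linf_Re[OF a] linf_Im[OF a] by (simp add: F_add F_scale linf_scale)
  finally show ?thesis .
qed

lemma F_Re:
  assumes a: "a \<in> linf G"
  shows "F (\<lambda>h. complex_of_real (Re (a h))) h = complex_of_real (Re (F a h))"
  and F_Im: "F (\<lambda>h. complex_of_real (Im (a h))) h = complex_of_real (Im (F a h))"
  using fun_cong[OF F_ReIm[OF a], of h] F_real[OF linf_Re[OF a], of h] F_real[OF linf_Im[OF a], of h]
  by (auto simp: complex_eq_iff)

lemma F_cnj:
  assumes a: "a \<in> linf G"
  shows "F (\<lambda>h. cnj (a h)) = (\<lambda>h. cnj (F a h))"
proof
  fix h
  show "F (\<lambda>h. cnj (a h)) h = cnj (F a h)"
    using F_Re[OF linf_cnj[OF a], of h] F_Im[OF linf_cnj[OF a], of h] F_Re[OF a, of h] F_Im[OF a, of h]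
      F_scale[OF linf_Im[OF a], of "-1"]
    by (simp add: complex_eq_iff)
qed

text \<open>Contractivity by rotation: where \<open>F a h\<close> is nonzero, choose
  \<open>w\<close> of modulus 1 with \<open>w * F a h = norm (F a h)\<close>. The norm is then the
  value at \<open>h\<close> of the image of the real part of \<open>w * a\<close>, a function
  dominated by \<open>B\<close> times the unit.\<close>

lemma F_bound:
  assumes a: "a \<in> linf G" and B: "\<And>h. norm (a h) \<le> B"
  shows "norm (F a h) \<le> B"
proof (cases "h \<in> carrier G \<and> F a h \<noteq> 0")
  case False
  then have "F a h = 0" using linf_outside[OF F_in[OF a], of h] by blast
  then show ?thesis using order_trans[OF norm_ge_zero B] by simp
next
  case True
  define w where "w = cnj (F a h) / norm (F a h)"
  have nw: "norm w = 1" using True by (simp add: w_def norm_divide)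
  let ?b = "\<lambda>h. w * a h"
  have b: "?b \<in> linf G" using a by (rule linf_scale)
  have "F ?b h = w * F a h" by (simp add: F_scale[OF a])
  also have "\<dots> = complex_of_real (norm (F a h))"
    using True complex_norm_square[of "F a h"] by (simp add: w_def field_simps power2_eq_square)
  finally have "F ?b h = complex_of_real (norm (F a h))" .
  then have "norm (F a h) = Re (F (\<lambda>h. complex_of_real (Re (?b h))) h)"
    unfolding F_Re[OF b] by simp
  also have "\<dots> \<le> Re (F (\<lambda>h. complex_of_real B * linf_one G h) h)"
  proof (rule F_le[OF linf_Re[OF b] linf_const])
    fix k
    have "Re (?b k) \<le> B"
      using complex_Re_le_cmod[of "?b k"] B[of k] nw by (simp add: norm_mult)
    then show "Re (complex_of_real (Re (?b k))) \<le> Re (complex_of_real B * linf_one G k)"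
      using linf_outside[OF a, of k] by (simp add: linf_one_def)
  qed (auto simp: linf_one_def)
  also have "\<dots> = B" using True unfolding F_scale[OF linf_one_in] F_one by (simp add: linf_one_def)
  finally show ?thesis .
qed

end

section \<open>The compact semigroup of unital positive equivariant maps\<close>

lemma G_projection_iff:
  "group G \<Longrightarrow> G_projection G \<phi> \<longleftrightarrow> linf_map G \<phi> \<and> (\<forall>a\<in>linf G. \<phi> (\<phi> a) = \<phi> a)"
  unfolding G_projection_def linf_map_def linf_map_axioms_def Ball_def by (rule iffI; simp)

text \<open>Functions in HOL are total, so values outside \<open>linf G\<close> are fixed to be
  zero. Left free, they would be unconstrained coordinates, which compactness does not allow, and
  maps that agree on \<open>linf G\<close> could be different elements.\<close>

definition linf_maps :: "('g, 'm) monoid_scheme \<Rightarrow> (('g \<Rightarrow> complex) \<Rightarrow> ('g \<Rightarrow> complex)) set" where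
  "linf_maps G = {F. linf_map G F \<and> (\<forall>a. a \<notin> linf G \<longrightarrow> F a = (\<lambda>h. 0))}"

definition linf_normalise :: "('g, 'm) monoid_scheme \<Rightarrow> (('g \<Rightarrow> complex) \<Rightarrow> ('g \<Rightarrow> complex)) \<Rightarrow> ('g \<Rightarrow> complex) \<Rightarrow> ('g \<Rightarrow> complex)" where
  "linf_normalise G F = (\<lambda>a. if a \<in> linf G then F a else (\<lambda>h. 0))"

lemma linf_normalise_in:
  assumes "linf_map G F"
  shows "linf_normalise G F \<in> linf_maps G"
proof -
  interpret linf_map G F by fact
  have "linf_map G (linf_normalise G F)"
    by unfold_locales
      (auto simp: linf_normalise_def linf_add linf_scale linf_one_in linf_ltr F_in F_add F_scale F_one F_pos F_ltr)
  then show ?thesis by (simp add: linf_maps_def linf_normalise_def)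
qed

lemma linf_map_comp:
  assumes "linf_map G F" "linf_map G H"
  shows "linf_map G (F \<circ> H)"
proof -
  interpret F: linf_map G F by fact
  interpret H: linf_map G H by fact
  show ?thesis
    by unfold_locales (auto simp: F.F_in H.F_in F.F_add H.F_add F.F_scale H.F_scale F.F_one H.F_one F.F_pos H.F_pos F.F_ltr H.F_ltr)
qed

lemma linf_maps_comp: "F \<in> linf_maps G \<Longrightarrow> H \<in> linf_maps G \<Longrightarrow> F \<circ> H \<in> linf_maps G"
  unfolding linf_maps_def using linf_map_comp linf_map.F_zero by fastforce

lemma (in group) linf_map_id: "linf_map G (\<lambda>a. a)"
  by unfold_locales auto

text \<open>The first clause confines \<open>F\<close> to a product of discs, compact by Tychonoff;
  the others are closed conditions, each on finitely many coordinates \<open>F a h\<close>. The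
  radius is the sup norm of \<open>a\<close> by contractivity, and radius zero encodes both that
  \<open>F a\<close> vanishes off the carrier and that \<open>F\<close> vanishes off
  \<open>linf G\<close>.\<close>

lemma (in group) linf_maps_eq:
  "linf_maps G = {F. (\<forall>a h. norm (F a h) \<le> (if a \<in> linf G \<and> h \<in> carrier G then SUP k. norm (a k) else 0)) \<and>
     (\<forall>a\<in>linf G. \<forall>b\<in>linf G. \<forall>h. F (\<lambda>h. a h + b h) h = F a h + F b h) \<and>
     (\<forall>a\<in>linf G. \<forall>c h. F (\<lambda>h. c * a h) h = c * F a h) \<and>
     (\<forall>h. F (linf_one G) h = linf_one G h) \<and>
     (\<forall>a\<in>{a\<in>linf G. linf_pos a}. \<forall>h. Im (F a h) = 0) \<and>
     (\<forall>a\<in>{a\<in>linf G. linf_pos a}. \<forall>h. 0 \<le> Re (F a h)) \<and>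
     (\<forall>g\<in>carrier G. \<forall>a\<in>linf G. \<forall>h. F (ltr G g a) h = ltr G g (F a) h)}"
  (is "_ = ?R")
proof (intro equalityI subsetI)
  fix F assume "F \<in> linf_maps G"
  then interpret linf_map G F by (simp add: linf_maps_def)
  have out: "\<And>a. a \<notin> linf G \<Longrightarrow> F a = (\<lambda>h. 0)" using \<open>F \<in> linf_maps G\<close> by (simp add: linf_maps_def)
  have "norm (F a h) \<le> (if a \<in> linf G \<and> h \<in> carrier G then SUP k. norm (a k) else 0)" for a h
  proof (cases "a \<in> linf G \<and> h \<in> carrier G")
    case True
    then obtain B where "\<And>k. norm (a k) \<le> B" using linf_bound by blast
    then have "bdd_above (range (\<lambda>k. norm (a k)))" by (auto simp: bdd_above_def)
    then have "norm (F a h) \<le> (SUP k. norm (a k))"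
      using True by (intro F_bound cSUP_upper) auto
    then show ?thesis using True by simp
  next
    case False
    then have "F a h = 0" using out linf_outside[OF F_in] by (cases "a \<in> linf G") auto
    with False show ?thesis by auto
  qed
  then show "F \<in> ?R"
    using F_pos by (simp add: F_add F_scale F_one F_ltr linf_pos_def)
next
  fix F assume F: "F \<in> ?R"
  then have bd: "norm (F a h) \<le> (if a \<in> linf G \<and> h \<in> carrier G then SUP k. norm (a k) else 0)" for a h
    by blast
  have "linf_map G F"
  proof
    show "F a \<in> linf G" if "a \<in> linf G" for a
    proof (rule linfI)
      show "norm (F a h) \<le> (SUP k. norm (a k))" if "h \<in> carrier G" for h
        using bd[of a h] that \<open>a \<in> linf G\<close> by simp
      show "F a h = 0" if "h \<notin> carrier G" for h using bd[of a h] that by simp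
    qed
  qed (use F in \<open>simp_all add: linf_pos_def fun_eq_iff\<close>)
  moreover have "F a = (\<lambda>h. 0)" if "a \<notin> linf G" for a
    using bd[of a] that by (auto simp: fun_eq_iff)
  ultimately show "F \<in> linf_maps G" by (simp add: linf_maps_def)
qed

lemma closed_Collect_ball: "(\<And>a. a \<in> A \<Longrightarrow> closed {x. P a x}) \<Longrightarrow> closed {x. \<forall>a\<in>A. P a x}"
  unfolding Collect_ball_eq by (rule closed_INT) auto

lemma continuous_on_ltr_eval:
  "continuous_on S (\<lambda>F :: 'a \<Rightarrow> 'g \<Rightarrow> complex. ltr G g (F a) h)"
  by (cases "h \<in> carrier G") (simp_all add: ltr_def continuous_on_eval2)

lemma (in group) compact_linf_maps: "compact (linf_maps G)"
  unfolding linf_maps_eq Collect_conj_eq[of "\<lambda>F. \<forall>a h. norm (F a h) \<le> _ a h"]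
  by (intro compact_Int_closed compact_fun_box closed_Collect_conj closed_Collect_ball closed_Collect_all
      closed_Collect_eq closed_Collect_le continuous_on_eval2 continuous_on_ltr_eval continuous_on_add
      continuous_on_mult continuous_on_const continuous_on_Re continuous_on_Im)

subsection \<open>Existence and rigidity of minimal projections\<close>

lemma (in group) compact_right_semigroup_linf_maps:
  "compact_right_semigroup (top_of_set (linf_maps G)) (\<circ>)"
proof
  show "compact_space (top_of_set (linf_maps G))"
    using compact_linf_maps by (simp add: compact_space_subtopology)
  show "Hausdorff_space (top_of_set (linf_maps G))"
    by (intro Hausdorff_space_subtopology Hausdorff_space_euclidean_fun)
  show "continuous_map (top_of_set (linf_maps G)) (top_of_set (linf_maps G)) (\<lambda>F. F \<circ> H)"
    if "H \<in> topspace (top_of_set (linf_maps G))" for H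
  proof -
    have "continuous_on (linf_maps G) (\<lambda>F. F \<circ> H)"
      by (intro continuous_on_coordinatewise_then_product) (simp add: continuous_on_eval2)
    then show ?thesis using that linf_maps_comp by (auto simp: continuous_map_in_subtopology)
  qed
qed (auto simp: linf_maps_comp comp_assoc)

lemma G_projection_normalise:
  assumes "group G" "G_projection G \<psi>"
  shows "linf_normalise G \<psi> \<in> linf_maps G" "linf_normalise G \<psi> \<circ> linf_normalise G \<psi> = linf_normalise G \<psi>"
proof -
  have \<psi>: "linf_map G \<psi>" and idem: "\<And>a. a \<in> linf G \<Longrightarrow> \<psi> (\<psi> a) = \<psi> a"
    using assms by (auto simp: G_projection_iff)
  interpret linf_map G \<psi> by fact
  show "linf_normalise G \<psi> \<in> linf_maps G" by (rule linf_normalise_in[OF \<psi>])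
  show "linf_normalise G \<psi> \<circ> linf_normalise G \<psi> = linf_normalise G \<psi>"
    by (auto simp: fun_eq_iff linf_normalise_def F_in idem F_zero linf_zero)
qed

text \<open>The order on projections is the usual order on idempotents of the semigroup. Normalising
  \<open>\<psi>\<close> turns the hypotheses, which hold on \<open>linf G\<close> only, into
  equations between elements of the semigroup.\<close>

theorem ex_minimal_G_projection:
  assumes "group G"
  shows "\<exists>\<phi>. minimal_G_projection G \<phi>"
proof -
  interpret group G by fact
  interpret compact_right_semigroup "top_of_set (linf_maps G)" "(\<circ>)"
    by (rule compact_right_semigroup_linf_maps)
  have "topspace (top_of_set (linf_maps G)) \<noteq> {}"
    using linf_normalise_in[OF linf_map_id] by auto
  from ex_minimal_idempotent[OF this] obtain e where e: "e \<in> linf_maps G" "e \<circ> e = e"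
    and min: "\<And>p. p \<in> linf_maps G \<Longrightarrow> p \<circ> p = p \<Longrightarrow> p \<circ> e = p \<Longrightarrow> e \<circ> p = p \<Longrightarrow> p = e"
    by auto
  then interpret e: linf_map G e by (simp add: linf_maps_def)
  have "minimal_G_projection G e"
    unfolding minimal_G_projection_def
  proof (intro conjI allI impI)
    show "G_projection G e"
      using e by (simp add: G_projection_iff[OF assms] linf_maps_def fun_eq_iff)
    fix \<psi> assume \<psi>: "G_projection G \<psi> \<and> (\<forall>a\<in>linf G. \<psi> (e a) = \<psi> a \<and> e (\<psi> a) = \<psi> a)"
    then have "G_projection G \<psi>" by simp
    note n = G_projection_normalise[OF assms this]
    have e0: "e a = (\<lambda>h. 0)" if "a \<notin> linf G" for a
      using e(1) that by (simp add: linf_maps_def)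
    interpret \<psi>: linf_map G \<psi> using \<psi> by (simp add: G_projection_iff[OF assms])
    have "linf_normalise G \<psi> = e"
    proof (rule min[OF n])
      show "linf_normalise G \<psi> \<circ> e = linf_normalise G \<psi>"
        using \<psi> by (auto simp: fun_eq_iff linf_normalise_def e.F_in e0 linf_zero \<psi>.F_zero)
      show "e \<circ> linf_normalise G \<psi> = linf_normalise G \<psi>"
        using \<psi> by (auto simp: fun_eq_iff linf_normalise_def e.F_zero)
    qed
    then show "\<forall>a\<in>linf G. \<psi> a = e a" by (metis linf_normalise_def)
  qed
  then show ?thesis by blast
qed

lemma linf_map_average:
  assumes "group G" "n > 0" and u: "\<And>k. k < n \<Longrightarrow> linf_map G (u k)"
  shows "linf_map G (\<lambda>a h. (\<Sum>k<n. u k a h) / of_nat n)"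
proof -
  interpret group G by fact
  show ?thesis
  proof
    fix a assume a: "a \<in> linf G"
    have "(\<lambda>h. (1 / of_nat n) * (\<Sum>k<n. u k a h)) \<in> linf G"
      by (intro linf_scale linf_sum) (auto intro: linf_map.F_in[OF u] a)
    then show "(\<lambda>h. (\<Sum>k<n. u k a h) / of_nat n) \<in> linf G" by simp
    show "(\<lambda>h. (\<Sum>k<n. u k (\<lambda>h. c * a h) h) / of_nat n) = (\<lambda>h. c * ((\<Sum>k<n. u k a h) / of_nat n))" for c
      by (simp add: linf_map.F_scale[OF u a] sum_distrib_left)
    show "(\<lambda>h. (\<Sum>k<n. u k (\<lambda>h. a h + b h) h) / of_nat n)
       = (\<lambda>h. (\<Sum>k<n. u k a h) / of_nat n + (\<Sum>k<n. u k b h) / of_nat n)" if b: "b \<in> linf G" for b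
      by (simp add: linf_map.F_add[OF u a b] sum.distrib add_divide_distrib)
    show "linf_pos (\<lambda>h. (\<Sum>k<n. u k a h) / of_nat n)" if "linf_pos a"
    proof -
      have "linf_pos (u k a)" if "k < n" for k
        using linf_map.F_pos[OF u[OF that] a] \<open>linf_pos a\<close> by blast
      then show ?thesis
        by (auto simp: linf_pos_def Re_divide_of_nat Im_divide_of_nat intro!: divide_nonneg_nonneg sum_nonneg)
    qed
    show "(\<lambda>h. (\<Sum>k<n. u k (ltr G g a) h) / of_nat n) = ltr G g (\<lambda>h. (\<Sum>k<n. u k a h) / of_nat n)"
      if "g \<in> carrier G" for g
      using that by (simp add: linf_map.F_ltr[OF u that a] fun_eq_iff) (simp add: ltr_def)
  next
    show "(\<lambda>h. (\<Sum>k<n. u k (linf_one G) h) / of_nat n) = linf_one G"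
      using \<open>n > 0\<close> by (simp add: linf_map.F_one[OF u])
  qed
qed

text \<open>A cluster point of the Cesaro means of the powers of \<open>u\<close> is fixed by right multiplication with \<open>u\<close>.\<close>

lemma ex_right_fixed:
  fixes G :: "('a, 'm) monoid_scheme"
  assumes "group G" and u: "u \<in> linf_maps G" and uf: "u \<circ> f = u"
  shows "\<exists>w\<in>linf_maps G. w \<circ> u = w \<and> w \<circ> f = w"
proof -
  interpret group G by fact
  have ul: "linf_map G u" using u by (simp add: linf_maps_def)
  define Z where "Z = top_of_set (linf_maps G)"
  have cpt: "compact_space Z" unfolding Z_def
    using compact_linf_maps by (simp add: compact_space_subtopology)
  \<comment> \<open>The flag selects the equation, \<open>True\<close> for
    \<open>w \<circ> u = w\<close> and \<open>False\<close> for \<open>w \<circ> f = w\<close>, and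
    \<open>a\<close>, \<open>h\<close> select the coordinate at which its error is measured.\<close>
  define d where "d = (\<lambda>(t, a :: 'a \<Rightarrow> complex, h :: 'a) (w :: ('a \<Rightarrow> complex) \<Rightarrow> 'a \<Rightarrow> complex). if t then norm (w (u a) h - w a h) else norm (w (f a) h - w a h))"
  have "\<exists>w\<in>topspace Z. \<forall>e\<in>UNIV. d e w = 0"
  proof (rule compact_space_approx_solution[OF cpt])
    fix e :: "bool \<times> ('a \<Rightarrow> complex) \<times> 'a"
    obtain t a h where e: "e = (t, a, h)" by (cases e)
    show "continuous_map Z euclideanreal (d e)"
      unfolding Z_def e d_def
      by (cases t) (auto intro!: continuous_on_norm continuous_on_diff continuous_on_eval2)
  next
    fix E :: "(bool \<times> ('a \<Rightarrow> complex) \<times> 'a) set" and \<epsilon> :: real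
    assume E: "finite E" and \<epsilon>: "\<epsilon> > 0"
    have pw: "linf_map G (u ^^ Suc k)" for k
    proof (induction k)
      case 0
      then show ?case using ul by (simp add: comp_def)
    next
      case (Suc k)
      from linf_map_comp[OF ul this] show ?case by (simp add: comp_def)
    qed
    \<comment> \<open>The average starts at the first power and not at the identity, so that each
      summand absorbs \<open>f\<close> on the right and vanishes off \<open>linf G\<close>, as
      \<open>u\<close> does.\<close>
    define w where "w = (\<lambda>n a h. (\<Sum>k<n. (u ^^ Suc k) a h) / of_nat n)"
    \<comment> \<open>Precomposition with \<open>u\<close> shifts all powers by one, so only two
      terms survive. They are bounded uniformly in \<open>n\<close>, and the factor
      \<open>1 / n\<close> makes the difference small.\<close>
    have diff: "w n (u a) h - w n a h = ((u ^^ Suc n) a h - u a h) / of_nat n" for n a h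
    proof -
      have "w n (u a) h - w n a h = (\<Sum>k<n. (u ^^ Suc (Suc k)) a h - (u ^^ Suc k) a h) / of_nat n"
        by (simp add: w_def sum_subtractf diff_divide_distrib funpow_swap1)
      also have "(\<Sum>k<n. (u ^^ Suc (Suc k)) a h - (u ^^ Suc k) a h) = (u ^^ Suc n) a h - (u ^^ Suc 0) a h"
        by (rule sum_lessThan_telescope)
      finally show ?thesis by simp
    qed
    have bound: "\<exists>B. \<forall>n. norm ((u ^^ Suc n) a h - u a h) \<le> B" for a h
    proof (cases "a \<in> linf G")
      case True
      then obtain B where B: "\<And>h. norm (a h) \<le> B" using linf_bound by blast
      have "norm ((u ^^ Suc n) a h - u a h) \<le> B + B" for n
        using linf_map.F_bound[OF pw[of n] True B, of h] linf_map.F_bound[OF ul True B, of h]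
        by (intro order_trans[OF norm_triangle_ineq4] add_mono)
      then show ?thesis by blast
    next
      case False
      then have "u a = (\<lambda>h. 0)" using u by (simp add: linf_maps_def)
      then have "(u ^^ Suc n) a = (\<lambda>h. 0)" for n
        by (induction n) (use linf_map.F_zero[OF ul] in auto)
      with \<open>u a = (\<lambda>h. 0)\<close> show ?thesis by auto
    qed
    then obtain B where B: "\<And>a h n. norm ((u ^^ Suc n) a h - u a h) \<le> B a h" by metis
    define M where "M = (\<Sum>(t, a, h)\<in>E. B a h)"
    have B0: "B a h \<ge> 0" for a h using order_trans[OF norm_ge_zero B] .
    have BM: "B a h \<le> M" if "(t, a, h) \<in> E" for t a h
      using member_le_sum[OF that, of "\<lambda>(t, a, h). B a h"] E B0 by (auto simp: M_def)
    obtain n where n: "real n > 0" "M / \<epsilon> \<le> real n"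
      using reals_Archimedean2[of "max 0 (M / \<epsilon>)"] by (metis less_imp_le max_less_iff_conj)
    have wl: "linf_map G (w n)"
      unfolding w_def by (rule linf_map_average[OF assms(1) _ pw]) (use n in simp)
    have wout: "w n a = (\<lambda>h. 0)" if "a \<notin> linf G" for a
    proof -
      have "u a = (\<lambda>h. 0)" using u that by (simp add: linf_maps_def)
      then have "(u ^^ Suc n) a = (\<lambda>h. 0)" for n
        by (induction n) (use linf_map.F_zero[OF ul] in auto)
      then show ?thesis by (simp add: w_def)
    qed
    have wf: "w n (f a) = w n a" for a
    proof -
      have "u (f a) = u a" using fun_cong[OF uf, of a] by simp
      then have "(u ^^ Suc k) (f a) = (u ^^ Suc k) a" for k
        by (induction k) auto
      then show ?thesis by (simp add: w_def)
    qed
    have "norm (w n (u a) h - w n a h) \<le> \<epsilon>" if "(t, a, h) \<in> E" for t a h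
    proof -
      have "norm (w n (u a) h - w n a h) = norm ((u ^^ Suc n) a h - u a h) / real n"
        by (simp add: diff norm_divide del: funpow.simps)
      also have "\<dots> \<le> M / real n"
        using B[of n a h] BM[OF that] n by (intro divide_right_mono) auto
      also have "\<dots> \<le> \<epsilon>" using n \<epsilon> by (simp add: field_simps)
      finally show ?thesis .
    qed
    then show "\<exists>w\<in>topspace Z. \<forall>e\<in>E. \<bar>d e w - 0\<bar> \<le> \<epsilon>"
      using wl wout wf \<epsilon> by (intro bexI[of _ "w n"]) (auto simp: Z_def linf_maps_def d_def)
  qed
  then obtain w where w: "w \<in> linf_maps G" "\<And>t a h. d (t, a, h) w = 0" by (auto simp: Z_def)
  have "w \<circ> u = w" using w(2)[of True] by (auto simp: d_def fun_eq_iff)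
  moreover have "w \<circ> f = w" using w(2)[of False] by (auto simp: d_def fun_eq_iff)
  ultimately show ?thesis using w(1) by blast
qed

text \<open>The maps that absorb both \<open>u\<close> and \<open>\<phi>\<close> on the right form a
  nonempty closed subsemigroup, which contains an idempotent \<open>w\<close>. Since
  \<open>w \<circ> \<phi> = w\<close>, the map \<open>\<phi> \<circ> w\<close> is a projection below
  \<open>\<phi>\<close>, hence equals \<open>\<phi>\<close> by minimality. Therefore
  \<open>u = \<phi> u = \<phi> w u = \<phi> w = \<phi>\<close>, all on
  \<open>linf G\<close>.\<close>

theorem minimal_G_projection_rigid:
  fixes G :: "('a, 'm) monoid_scheme"
  assumes "group G" and \<phi>: "minimal_G_projection G \<phi>" and u: "linf_map G u"
    and uphi: "\<And>a. a \<in> linf G \<Longrightarrow> u (\<phi> a) = u a" and phiu: "\<And>a. a \<in> linf G \<Longrightarrow> \<phi> (u a) = u a"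
    and a: "a \<in> linf G"
  shows "u a = \<phi> a"
proof -
  interpret group G by fact
  interpret compact_right_semigroup "top_of_set (linf_maps G)" "(\<circ>)"
    by (rule compact_right_semigroup_linf_maps)
  have "G_projection G \<phi>" using \<phi> by (simp add: minimal_G_projection_def)
  then have \<phi>l: "linf_map G \<phi>" and \<phi>\<phi>: "\<And>a. a \<in> linf G \<Longrightarrow> \<phi> (\<phi> a) = \<phi> a"
    by (auto simp: G_projection_iff[OF assms(1)])
  interpret \<phi>: linf_map G \<phi> by fact
  interpret u: linf_map G u by fact
  define f where "f = linf_normalise G \<phi>"
  define v where "v = linf_normalise G u"
  have f: "f \<in> linf_maps G" and v: "v \<in> linf_maps G"
    unfolding f_def v_def using \<phi>l u by (auto intro: linf_normalise_in)
  have vf: "v \<circ> f = v"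
    by (auto simp: fun_eq_iff v_def f_def linf_normalise_def uphi \<phi>.F_in u.F_zero linf_zero)
  define T where "T = {w \<in> linf_maps G. w \<circ> v = w \<and> w \<circ> f = w}"
  have "T = linf_maps G \<inter> {w. \<forall>a h. w (v a) h = w a h \<and> w (f a) h = w a h}"
    by (auto simp: T_def fun_eq_iff)
  moreover have "closed {w :: ('a \<Rightarrow> complex) \<Rightarrow> 'a \<Rightarrow> complex. \<forall>a h. w (v a) h = w a h \<and> w (f a) h = w a h}"
    by (intro closed_Collect_all closed_Collect_conj closed_Collect_eq continuous_on_eval2)
  ultimately have "closedin (top_of_set (linf_maps G)) T"
    by (simp only: closedin_closed_Int)
  moreover have "T \<noteq> {}"
    using ex_right_fixed[OF assms(1) v vf] by (auto simp: T_def)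
  moreover have "x \<circ> y \<in> T" if "x \<in> T" "y \<in> T" for x y
    using that linf_maps_comp[of x G y] by (auto simp: T_def comp_assoc)
  ultimately obtain w where "w \<in> T" and ww: "w \<circ> w = w"
    using ellis_numakura[of T] by blast
  then have w: "w \<in> linf_maps G" "w \<circ> v = w" "w \<circ> f = w" by (auto simp: T_def)
  then interpret w: linf_map G w by (simp add: linf_maps_def)
  have wphi: "w (\<phi> b) = w b" and wu: "w (u b) = w b" and w2: "w (w b) = w b" if "b \<in> linf G" for b
    using fun_cong[OF w(3), of b] fun_cong[OF w(2), of b] fun_cong[OF ww, of b] that
    by (auto simp: f_def v_def linf_normalise_def)
  let ?\<psi> = "\<phi> \<circ> w"
  have "G_projection G ?\<psi>"
    unfolding G_projection_iff[OF assms(1)]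
    using linf_map_comp[OF \<phi>l w.linf_map_axioms] by (auto simp: wphi w.F_in w2)
  moreover have "\<forall>a\<in>linf G. ?\<psi> (\<phi> a) = ?\<psi> a \<and> \<phi> (?\<psi> a) = ?\<psi> a"
    by (auto simp: wphi \<phi>\<phi> w.F_in)
  ultimately have eq: "?\<psi> b = \<phi> b" if "b \<in> linf G" for b
    using \<phi> that unfolding minimal_G_projection_def by blast
  have "u a = \<phi> (u a)" using phiu[OF a] by simp
  also have "\<dots> = ?\<psi> (u a)" using eq[OF u.F_in[OF a]] by simp
  also have "\<dots> = ?\<psi> a" by (simp add: wu[OF a])
  also have "\<dots> = \<phi> a" by (rule eq[OF a])
  finally show ?thesis .
qed

subsection \<open>The Choi--Effros product and its characters\<close>

lemma linf_posD: "linf_pos a \<Longrightarrow> 0 \<le> Re (a h)"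
  by (simp add: linf_pos_def)

locale linf_projection = linf_map G \<phi>
  for G :: "('g, 'm) monoid_scheme" (structure) and \<phi> :: "('g \<Rightarrow> complex) \<Rightarrow> ('g \<Rightarrow> complex)" +
  assumes idem: "a \<in> linf G \<Longrightarrow> \<phi> (\<phi> a) = \<phi> a"
begin

lemma IG_iff: "a \<in> IG G \<phi> \<longleftrightarrow> a \<in> linf G \<and> \<phi> a = a"
proof
  assume "a \<in> IG G \<phi>"
  then obtain b where "b \<in> linf G" "a = \<phi> b" unfolding IG_def by blast
  then show "a \<in> linf G \<and> \<phi> a = a" by (simp add: F_in idem)
next
  assume "a \<in> linf G \<and> \<phi> a = a"
  then show "a \<in> IG G \<phi>" unfolding IG_def by (intro image_eqI[of _ _ a]) auto
qed

lemma IG_linf: "a \<in> IG G \<phi> \<Longrightarrow> a \<in> linf G" and IG_fixed: "a \<in> IG G \<phi> \<Longrightarrow> \<phi> a = a"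
  by (simp_all add: IG_iff)

lemma IG_range: "a \<in> linf G \<Longrightarrow> \<phi> a \<in> IG G \<phi>"
  by (simp add: IG_def)

lemma IG_add: "a \<in> IG G \<phi> \<Longrightarrow> b \<in> IG G \<phi> \<Longrightarrow> (\<lambda>h. a h + b h) \<in> IG G \<phi>"
  by (simp add: IG_iff linf_add F_add)

lemma IG_diff: "a \<in> IG G \<phi> \<Longrightarrow> b \<in> IG G \<phi> \<Longrightarrow> (\<lambda>h. a h - b h) \<in> IG G \<phi>"
  by (simp add: IG_iff linf_diff F_diff)

lemma IG_scale: "a \<in> IG G \<phi> \<Longrightarrow> (\<lambda>h. c * a h) \<in> IG G \<phi>"
  by (simp add: IG_iff linf_scale F_scale)

lemma IG_one: "linf_one G \<in> IG G \<phi>"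
  by (simp add: IG_iff linf_one_in F_one)

lemma IG_const: "(\<lambda>h. c * linf_one G h) \<in> IG G \<phi>"
  by (rule IG_scale[OF IG_one])

lemma IG_sum: "finite A \<Longrightarrow> (\<And>i. i \<in> A \<Longrightarrow> a i \<in> IG G \<phi>) \<Longrightarrow> (\<lambda>h. \<Sum>i\<in>A. a i h) \<in> IG G \<phi>"
  by (simp add: IG_iff linf_sum F_sum)

lemma IG_cnj: "a \<in> IG G \<phi> \<Longrightarrow> (\<lambda>h. cnj (a h)) \<in> IG G \<phi>"
  by (simp add: IG_iff linf_cnj F_cnj)

lemma IG_Re: "a \<in> IG G \<phi> \<Longrightarrow> (\<lambda>h. complex_of_real (Re (a h))) \<in> IG G \<phi>"
  and IG_Im: "a \<in> IG G \<phi> \<Longrightarrow> (\<lambda>h. complex_of_real (Im (a h))) \<in> IG G \<phi>"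
  by (simp_all add: IG_iff linf_Re linf_Im F_Re F_Im fun_eq_iff)

lemma IG_ltr: "a \<in> IG G \<phi> \<Longrightarrow> g \<in> carrier G \<Longrightarrow> ltr G g a \<in> IG G \<phi>"
  by (simp add: IG_iff linf_ltr F_ltr)

text \<open>Fix \<open>h\<close> and let \<open>c\<close> be the real number
  \<open>\<phi> w h\<close>. The square of \<open>w - c\<close> is positive, with \<open>c\<close>
  read as a multiple of the unit, and its image takes the value
  \<open>\<phi> (w * w) h - c * c\<close> at \<open>h\<close>.\<close>

lemma schwarz_real:
  assumes w: "w \<in> linf G" and re: "\<And>h. Im (w h) = 0"
  shows "(Re (\<phi> w h))\<^sup>2 \<le> Re (\<phi> (\<lambda>h. w h * w h) h)"
proof (cases "h \<in> carrier G")
  case False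
  then show ?thesis
    using linf_outside[OF F_in[OF w]] linf_outside[OF F_in[OF linf_mult[OF w w]]] by simp
next
  case True
  define c where "c = complex_of_real (Re (\<phi> w h))"
  have \<phi>w: "\<phi> w h = c" using F_real[OF w re, of h] by (simp add: c_def complex_eq_iff)
  let ?v = "\<lambda>h. w h * w h - (2 * c) * w h + (c * c) * linf_one G h"
  have "linf_pos ?v"
    unfolding linf_pos_def
  proof (intro allI)
    fix k
    have "?v k = complex_of_real ((Re (w k) - Re (\<phi> w h))\<^sup>2)" if "k \<in> carrier G"
      using that re[of k] by (simp add: linf_one_def complex_eq_iff c_def power2_eq_square algebra_simps)
    moreover have "?v k = 0" if "k \<notin> carrier G" using that linf_outside[OF w] by (simp add: linf_one_def)
    ultimately show "Im (?v k) = 0 \<and> 0 \<le> Re (?v k)" by (cases "k \<in> carrier G") auto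
  qed
  moreover have "?v \<in> linf G"
    by (intro linf_add linf_diff linf_mult linf_scale linf_one_in w)
  ultimately have "linf_pos (\<phi> ?v)" by (rule F_pos[rotated])
  moreover have "\<phi> ?v h = \<phi> (\<lambda>h. w h * w h) h - c * c"
    using True w
    by (simp add: F_add F_diff F_scale F_one linf_add linf_diff linf_mult linf_scale linf_one_in \<phi>w)
       (simp add: linf_one_def)
  ultimately have "0 \<le> Re (\<phi> (\<lambda>h. w h * w h) h - c * c)" using linf_posD[of "\<phi> ?v" h] by simp
  then show ?thesis by (simp add: c_def power2_eq_square)
qed

text \<open>Applying \<open>\<phi>\<close> to the Schwarz inequality for \<open>a + t z\<close> cancels the terms of order zero,
  which leaves a quadratic in \<open>t\<close> that is nonnegative only if its linear coefficient vanishes.\<close>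

lemma choi_effros_real:
  assumes a: "a \<in> IG G \<phi>" and z: "z \<in> linf G" and re: "\<And>h. Im (a h) = 0" "\<And>h. Im (z h) = 0"
    and z0: "\<phi> z = (\<lambda>h. 0)"
  shows "\<phi> (\<lambda>h. a h * z h) h = 0"
proof -
  have al: "a \<in> linf G" and fa: "\<phi> a = a" using a by (simp_all add: IG_iff)
  define p where "p = Re (\<phi> (\<lambda>h. a h * z h) h)"
  define q where "q = Re (\<phi> (\<lambda>h. z h * z h) h)"
  have imp: "Im (\<phi> (\<lambda>h. a h * z h) h) = 0"
    using re by (intro F_real linf_mult al z) simp
  note lin = linf_add linf_diff linf_mult linf_scale al z F_in
  have quad: "0 \<le> 2 * t * p + t\<^sup>2 * q" for t :: real
  proof -
    let ?t = "complex_of_real t"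
    let ?w = "\<lambda>h. a h + ?t * z h"
    have w: "?w \<in> linf G" by (intro lin)
    have \<phi>w: "\<phi> ?w = a" by (simp add: F_add F_scale fa z0 lin)
    let ?az = "\<lambda>h. a h * z h" and ?aa = "\<lambda>h. a h * a h" and ?zz = "\<lambda>h. z h * z h"
    have ww: "(\<lambda>h. ?w h * ?w h) = (\<lambda>h. ?aa h + (2 * ?t) * ?az h + (?t * ?t) * ?zz h)"
      by (simp add: fun_eq_iff algebra_simps)
    have \<phi>ww: "\<phi> (\<lambda>h. ?w h * ?w h) = (\<lambda>h. \<phi> ?aa h + (2 * ?t) * \<phi> ?az h + (?t * ?t) * \<phi> ?zz h)"
      unfolding ww by (simp add: F_add F_scale lin)
    let ?D = "\<lambda>h. \<phi> ?aa h + (2 * ?t) * \<phi> ?az h + (?t * ?t) * \<phi> ?zz h - ?aa h"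
    have D: "?D \<in> linf G" by (intro lin)
    have "linf_pos ?D"
      unfolding linf_pos_def
    proof (intro allI conjI)
      fix k
      have "Im (\<phi> ?aa k) = 0" "Im (\<phi> ?az k) = 0" "Im (\<phi> ?zz k) = 0"
        using re by (auto intro!: F_real lin)
      then show "Im (?D k) = 0" by (simp add: re)
      have "(Re (\<phi> ?w k))\<^sup>2 \<le> Re (\<phi> (\<lambda>h. ?w h * ?w h) k)"
        using re by (intro schwarz_real w) simp
      then show "0 \<le> Re (?D k)"
        unfolding \<phi>w \<phi>ww by (simp add: re power2_eq_square)
    qed
    then have "linf_pos (\<phi> ?D)" by (rule F_pos[OF D])
    moreover have "\<phi> ?D = (\<lambda>h. \<phi> ?aa h + (2 * ?t) * \<phi> ?az h + (?t * ?t) * \<phi> ?zz h - \<phi> ?aa h)"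
      by (simp add: F_add F_diff F_scale idem lin)
    ultimately have "linf_pos (\<lambda>h. \<phi> ?aa h + (2 * ?t) * \<phi> ?az h + (?t * ?t) * \<phi> ?zz h - \<phi> ?aa h)"
      by (simp only:)
    from linf_posD[OF this, of h] show ?thesis by (simp add: p_def q_def power2_eq_square)
  qed
  have "linf_pos (\<phi> (\<lambda>h. z h * z h))"
    using re by (intro F_pos lin) (simp add: linf_pos_def)
  then have q: "q \<ge> 0" by (simp add: q_def linf_pos_def)
  have "p = 0"
  proof (rule ccontr)
    assume "p \<noteq> 0"
    \<comment> \<open>This \<open>t\<close> is close to the minimiser \<open>- p / q\<close> of the
      quadratic; \<open>q + 1\<close> avoids division by zero and still gives the value
      \<open>- p\<^sup>2 * (q + 2) / (q + 1)\<^sup>2\<close>, which is negative.\<close>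
    define t where "t = - p / (q + 1)"
    have t: "t * (q + 1) = - p" using q by (simp add: t_def)
    have "0 \<le> (2 * t * p + t\<^sup>2 * q) * (q + 1)\<^sup>2"
      using quad[of t] by simp
    also have "\<dots> = - (p\<^sup>2 * (q + 2))" using t by algebra
    finally have "p\<^sup>2 * (q + 2) \<le> 0" by simp
    moreover have "p\<^sup>2 * (q + 2) > 0" using q \<open>p \<noteq> 0\<close> by (intro mult_pos_pos) auto
    ultimately show False by linarith
  qed
  with imp show ?thesis by (simp add: p_def complex_eq_iff)
qed

text \<open>The difference of \<open>x\<close> and \<open>\<phi> x\<close> lies in the kernel of
  \<open>\<phi>\<close>, and so do its real and imaginary parts, as \<open>\<phi>\<close> commutes
  with taking them. Expanding the complex product leaves four real products, each covered by the
  real case.\<close>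

lemma choi_effros:
  assumes a: "a \<in> IG G \<phi>" and x: "x \<in> linf G"
  shows "\<phi> (\<lambda>h. a h * \<phi> x h) = \<phi> (\<lambda>h. a h * x h)"
proof
  fix h
  have al: "a \<in> linf G" using a by (rule IG_linf)
  let ?z = "\<lambda>h. x h - \<phi> x h"
  have z: "?z \<in> linf G" by (intro linf_diff x F_in)
  have z0: "\<phi> ?z = (\<lambda>h. 0)" using x by (simp add: F_diff F_in idem)
  let ?R = "\<lambda>b h. complex_of_real (Re (b h))" and ?I = "\<lambda>b h. complex_of_real (Im (b h))"
  have zR: "\<phi> (?R ?z) = (\<lambda>h. 0)" and zI: "\<phi> (?I ?z) = (\<lambda>h. 0)"
    unfolding fun_eq_iff F_Re[OF z] F_Im[OF z] z0 by auto
  note R = IG_Re[OF a] and I = IG_Im[OF a]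
  note van = choi_effros_real[OF R linf_Re[OF z] _ _ zR, of h] choi_effros_real[OF R linf_Im[OF z] _ _ zI, of h]
    choi_effros_real[OF I linf_Re[OF z] _ _ zR, of h] choi_effros_real[OF I linf_Im[OF z] _ _ zI, of h]
  note lin = linf_mult linf_add linf_diff linf_scale linf_Re linf_Im al z
  have "\<phi> (\<lambda>h. a h * ?z h) = \<phi> (\<lambda>h. (?R a h * ?R ?z h - ?I a h * ?I ?z h) + \<i> * (?R a h * ?I ?z h + ?I a h * ?R ?z h))"
    by (rule arg_cong[where f=\<phi>]) (simp add: fun_eq_iff complex_eq_iff)
  also have "\<dots> = (\<lambda>h. (\<phi> (\<lambda>h. ?R a h * ?R ?z h) h - \<phi> (\<lambda>h. ?I a h * ?I ?z h) h)
      + \<i> * (\<phi> (\<lambda>h. ?R a h * ?I ?z h) h + \<phi> (\<lambda>h. ?I a h * ?R ?z h) h))"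
    by (simp only: F_add F_diff F_scale lin)
  finally have "\<phi> (\<lambda>h. a h * ?z h) h = 0" using van by simp
  moreover have "(\<lambda>h. a h * ?z h) = (\<lambda>h. a h * x h - a h * \<phi> x h)"
    by (simp add: algebra_simps)
  ultimately show "\<phi> (\<lambda>h. a h * \<phi> x h) h = \<phi> (\<lambda>h. a h * x h) h"
    using al x by (simp add: F_diff linf_mult F_in)
qed

text \<open>Moving \<open>\<phi>\<close> into and out of one factor at a time shows that
  \<open>\<phi>\<close> cannot distinguish \<open>a * b * w\<close> from
  \<open>\<phi> (a * b) * w\<close>, even though \<open>w\<close> is arbitrary. Taking for
  \<open>w\<close> the conjugate of the defect gives its squared modulus.\<close>

lemma product_defect_null:
  assumes a: "a \<in> IG G \<phi>" and b: "b \<in> IG G \<phi>" and w: "w \<in> linf G"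
  shows "\<phi> (\<lambda>h. (a h * b h - \<phi> (\<lambda>h. a h * b h) h) * w h) = (\<lambda>h. 0)"
proof -
  have al: "a \<in> linf G" and bl: "b \<in> linf G" using a b by (auto intro: IG_linf)
  note lin = linf_mult al bl w F_in
  let ?c = "\<phi> (\<lambda>h. a h * b h)"
  have c: "?c \<in> IG G \<phi>" by (intro IG_range lin)
  have "\<phi> (\<lambda>h. ?c h * w h) = \<phi> (\<lambda>h. ?c h * \<phi> w h)" by (rule choi_effros[OF c w, symmetric])
  also have "\<dots> = \<phi> (\<lambda>h. \<phi> w h * ?c h)" by (simp add: mult.commute)
  also have "\<dots> = \<phi> (\<lambda>h. \<phi> w h * (a h * b h))" by (intro choi_effros IG_range lin)
  also have "\<dots> = \<phi> (\<lambda>h. a h * (b h * \<phi> w h))" by (simp add: mult_ac)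
  also have "\<dots> = \<phi> (\<lambda>h. a h * \<phi> (\<lambda>h. b h * \<phi> w h) h)" by (intro choi_effros[symmetric] a lin)
  also have "\<dots> = \<phi> (\<lambda>h. a h * \<phi> (\<lambda>h. b h * w h) h)" by (simp add: choi_effros[OF b w])
  also have "\<dots> = \<phi> (\<lambda>h. a h * (b h * w h))" by (intro choi_effros a lin)
  finally have "\<phi> (\<lambda>h. a h * b h * w h) = \<phi> (\<lambda>h. ?c h * w h)" by (simp add: mult_ac)
  moreover have "\<phi> (\<lambda>h. (a h * b h - ?c h) * w h) = (\<lambda>h. \<phi> (\<lambda>h. a h * b h * w h) h - \<phi> (\<lambda>h. ?c h * w h) h)"
    by (simp add: left_diff_distrib F_diff lin)
  ultimately show ?thesis by simp
qed

text \<open>If every point failed, the sum of the squared moduli of the finitely many defects would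
  be at least \<open>\<epsilon>\<^sup>2\<close> on the whole carrier, and so would its image under
  the unital positive map \<open>\<phi>\<close>. That image is zero.\<close>

lemma ex_approx_multiplicative_point:
  assumes P: "finite P" "P \<subseteq> IG G \<phi> \<times> IG G \<phi>" and "\<epsilon> > 0"
  shows "\<exists>h\<in>carrier G. \<forall>(a, b)\<in>P. norm (\<phi> (\<lambda>h. a h * b h) h - a h * b h) \<le> \<epsilon>"
proof (rule ccontr)
  assume neg: "\<not> ?thesis"
  define y where "y = (\<lambda>(a, b) h. a h * b h - \<phi> (\<lambda>h. a h * b h) h)"
  have y: "y p \<in> linf G" if "p \<in> P" for p
  proof -
    obtain a b where ab: "p = (a, b)" "a \<in> IG G \<phi>" "b \<in> IG G \<phi>" using \<open>p \<in> P\<close> P(2) by (cases p) auto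
    show ?thesis unfolding y_def ab(1) prod.case
      by (intro linf_diff linf_mult F_in IG_linf[OF ab(2)] IG_linf[OF ab(3)])
  qed
  let ?x = "\<lambda>h. \<Sum>p\<in>P. y p h * cnj (y p h)"
  have x: "?x \<in> linf G"
    using P(1) by (intro linf_sum linf_mult linf_cnj y)
  have "\<phi> (\<lambda>h. y p h * cnj (y p h)) = (\<lambda>h. 0)" if p: "p \<in> P" for p
  proof -
    obtain a b where ab: "p = (a, b)" "a \<in> IG G \<phi>" "b \<in> IG G \<phi>" using p P(2) by (cases p) auto
    show ?thesis
      using product_defect_null[OF ab(2,3) linf_cnj[OF y[OF p]]] by (simp add: y_def ab(1))
  qed
  then have \<phi>x: "\<phi> ?x = (\<lambda>h. 0)"
    using P(1) by (subst F_sum) (simp_all add: y linf_mult linf_cnj)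
  have "Re (\<phi> (\<lambda>h. complex_of_real (\<epsilon>\<^sup>2) * linf_one G h) \<one>) \<le> Re (\<phi> ?x \<one>)"
  proof (rule F_le[OF linf_const x])
    fix k
    have yy: "y p k * cnj (y p k) = complex_of_real ((norm (y p k))\<^sup>2)" for p
      by (rule complex_norm_square[symmetric])
    show "Im (complex_of_real (\<epsilon>\<^sup>2) * linf_one G k) = 0" by (simp add: linf_one_def)
    show "Im (?x k) = 0" unfolding yy by simp
    show "Re (complex_of_real (\<epsilon>\<^sup>2) * linf_one G k) \<le> Re (?x k)"
    proof (cases "k \<in> carrier G")
      case True
      with neg obtain p where p: "p \<in> P" "norm (y p k) > \<epsilon>"
        by (force simp: y_def norm_minus_commute not_le)
      then have "\<epsilon>\<^sup>2 \<le> (norm (y p k))\<^sup>2" using \<open>\<epsilon> > 0\<close> by (intro power_mono) auto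
      also have "\<dots> \<le> (\<Sum>p\<in>P. (norm (y p k))\<^sup>2)" using p P(1) by (intro member_le_sum) auto
      finally show ?thesis unfolding yy using True by (simp add: linf_one_def)
    next
      case False
      then show ?thesis unfolding yy by (simp add: linf_one_def sum_nonneg)
    qed
  qed
  also have "\<phi> (\<lambda>h. complex_of_real (\<epsilon>\<^sup>2) * linf_one G h) \<one> = complex_of_real (\<epsilon>\<^sup>2)"
    using fun_cong[OF F_scale[OF linf_one_in, of "complex_of_real (\<epsilon>\<^sup>2)"], of \<one>]
    by (simp add: F_one) (simp add: linf_one_def)
  finally have "\<epsilon>\<^sup>2 \<le> 0" by (simp add: \<phi>x)
  then show False using \<open>\<epsilon> > 0\<close> by simp
qed

section \<open>Characters for the Choi--Effros product\<close>

lemma charD: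
  assumes "\<kappa> \<in> hamana_chars G \<phi>"
  shows char_extensional: "\<kappa> \<in> extensional (IG G \<phi>)"
    and char_add: "a \<in> IG G \<phi> \<Longrightarrow> b \<in> IG G \<phi> \<Longrightarrow> \<kappa> (\<lambda>h. a h + b h) = \<kappa> a + \<kappa> b"
    and char_scale: "a \<in> IG G \<phi> \<Longrightarrow> \<kappa> (\<lambda>h. c * a h) = c * \<kappa> a"
    and char_one: "\<kappa> (linf_one G) = 1"
    and char_mult: "a \<in> IG G \<phi> \<Longrightarrow> b \<in> IG G \<phi> \<Longrightarrow> \<kappa> (\<phi> (\<lambda>h. a h * b h)) = \<kappa> a * \<kappa> b"
  using assms unfolding hamana_chars_def by auto

lemma char_diff:
  assumes "\<kappa> \<in> hamana_chars G \<phi>" "a \<in> IG G \<phi>" "b \<in> IG G \<phi>"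
  shows "\<kappa> (\<lambda>h. a h - b h) = \<kappa> a - \<kappa> b"
  using char_add[OF assms(1,2) IG_scale[OF assms(3), of "-1"]] char_scale[OF assms(1,3), of "-1"] by simp

lemma char_sum:
  assumes \<kappa>: "\<kappa> \<in> hamana_chars G \<phi>"
  shows "finite A \<Longrightarrow> (\<And>i. i \<in> A \<Longrightarrow> a i \<in> IG G \<phi>) \<Longrightarrow> \<kappa> (\<lambda>h. \<Sum>i\<in>A. a i h) = (\<Sum>i\<in>A. \<kappa> (a i))"
proof (induction A rule: finite_induct)
  case empty
  then show ?case using char_scale[OF \<kappa> IG_one, of 0] by simp
next
  case (insert i A)
  then show ?case using char_add[OF \<kappa>, of "a i" "\<lambda>h. \<Sum>i\<in>A. a i h"] by (simp add: IG_sum)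
qed

text \<open>If \<open>a\<close> stays away from \<open>\<lambda>\<close>, then \<open>\<phi> (1 / (a - \<lambda>))\<close> inverts \<open>a - \<lambda>\<close> for the Choi--Effros product.\<close>

lemma char_in_closure_range:
  assumes \<kappa>: "\<kappa> \<in> hamana_chars G \<phi>" and a: "a \<in> IG G \<phi>" and "\<epsilon> > 0"
  shows "\<exists>h\<in>carrier G. norm (a h - \<kappa> a) < \<epsilon>"
proof (rule ccontr)
  assume "\<not> ?thesis"
  then have far: "\<And>h. h \<in> carrier G \<Longrightarrow> norm (a h - \<kappa> a) \<ge> \<epsilon>" by force
  let ?a = "\<lambda>h. a h - \<kappa> a * linf_one G h"
  have a': "?a \<in> IG G \<phi>" by (intro IG_diff a IG_const)
  define x where "x = (\<lambda>h. if h \<in> carrier G then 1 / (a h - \<kappa> a) else 0)"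
  have x: "x \<in> linf G"
  proof (rule linfI)
    fix h assume "h \<in> carrier G"
    then show "norm (x h) \<le> 1 / \<epsilon>"
      using far[of h] \<open>\<epsilon> > 0\<close> by (simp add: x_def norm_divide frac_le)
  qed (simp add: x_def)
  have "(\<lambda>h. ?a h * x h) = linf_one G"
    using far \<open>\<epsilon> > 0\<close> by (force simp: fun_eq_iff x_def linf_one_def)
  then have "\<phi> (\<lambda>h. ?a h * \<phi> x h) = linf_one G"
    using choi_effros[OF a' x] by (simp add: F_one)
  then have "\<kappa> ?a * \<kappa> (\<phi> x) = 1"
    using char_mult[OF \<kappa> a' IG_range[OF x]] char_one[OF \<kappa>] by simp
  moreover have "\<kappa> ?a = 0"
    using char_diff[OF \<kappa> a IG_const] char_scale[OF \<kappa> IG_one] char_one[OF \<kappa>] by simp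
  ultimately show False by simp
qed

text \<open>A character is assumed to be linear, unital and multiplicative only. Its bounds, reality
  and positivity all come from the fact that \<open>\<kappa> a\<close> is a limit of values of
  \<open>a\<close> on the carrier.\<close>

lemma char_bound:
  assumes \<kappa>: "\<kappa> \<in> hamana_chars G \<phi>" and a: "a \<in> IG G \<phi>" and B: "\<And>h. norm (a h) \<le> B"
  shows "norm (\<kappa> a) \<le> B"
proof (rule field_le_epsilon)
  fix e :: real assume "e > 0"
  then obtain h where h: "norm (a h - \<kappa> a) < e" using char_in_closure_range[OF \<kappa> a] by blast
  show "norm (\<kappa> a) \<le> B + e"
    using norm_triangle_ineq3[of "\<kappa> a" "a h"] h B[of h] by (simp add: norm_minus_commute)
qed

lemma char_real:
  assumes \<kappa>: "\<kappa> \<in> hamana_chars G \<phi>" and a: "a \<in> IG G \<phi>" and re: "\<And>h. Im (a h) = 0"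
  shows "Im (\<kappa> a) = 0"
proof (rule ccontr)
  assume "Im (\<kappa> a) \<noteq> 0"
  then obtain h where "norm (a h - \<kappa> a) < \<bar>Im (\<kappa> a)\<bar>"
    using char_in_closure_range[OF \<kappa> a, of "\<bar>Im (\<kappa> a)\<bar>"] by auto
  then show False using abs_Im_le_cmod[of "a h - \<kappa> a"] re by simp
qed

lemma char_lower:
  assumes \<kappa>: "\<kappa> \<in> hamana_chars G \<phi>" and a: "a \<in> IG G \<phi>"
    and c: "\<And>h. h \<in> carrier G \<Longrightarrow> c \<le> Re (a h)"
  shows "c \<le> Re (\<kappa> a)"
proof (rule field_le_epsilon)
  fix e :: real assume "e > 0"
  then obtain h where h: "h \<in> carrier G" "norm (a h - \<kappa> a) < e"
    using char_in_closure_range[OF \<kappa> a] by blast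
  show "c \<le> Re (\<kappa> a) + e"
    using abs_Re_le_cmod[of "a h - \<kappa> a"] h(2) c[OF h(1)] by simp
qed

lemma char_cnj:
  assumes \<kappa>: "\<kappa> \<in> hamana_chars G \<phi>" and a: "a \<in> IG G \<phi>"
  shows "\<kappa> (\<lambda>h. cnj (a h)) = cnj (\<kappa> a)"
proof -
  let ?R = "\<lambda>h. complex_of_real (Re (a h))" and ?I = "\<lambda>h. complex_of_real (Im (a h))"
  note R = IG_Re[OF a] and I = IG_Im[OF a]
  have "\<kappa> (\<lambda>h. ?R h + \<i> * ?I h) = \<kappa> ?R + \<i> * \<kappa> ?I"
    using char_add[OF \<kappa> R IG_scale[OF I]] char_scale[OF \<kappa> I] by simp
  moreover have "(\<lambda>h. ?R h + \<i> * ?I h) = a" by (simp add: fun_eq_iff complex_eq_iff)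
  moreover have "\<kappa> (\<lambda>h. ?R h - \<i> * ?I h) = \<kappa> ?R - \<i> * \<kappa> ?I"
    using char_diff[OF \<kappa> R IG_scale[OF I]] char_scale[OF \<kappa> I] by simp
  moreover have "(\<lambda>h. ?R h - \<i> * ?I h) = (\<lambda>h. cnj (a h))" by (simp add: fun_eq_iff complex_eq_iff)
  moreover have "Im (\<kappa> ?R) = 0" "Im (\<kappa> ?I) = 0" using char_real[OF \<kappa> R] char_real[OF \<kappa> I] by auto
  ultimately show ?thesis by (simp add: complex_eq_iff)
qed

end

subsection \<open>The Hamana boundary is a boundary\<close>

text \<open>Extensional functions are constant in the coordinates off \<open>I\<close>, so
  restricting the index set to \<open>I\<close> does not change the topology. This makes the type
  class lemmas on compactness and continuity available for the Hamana boundary.\<close>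

lemma subtopology_product_extensional:
  fixes S :: "('a \<Rightarrow> 'b::topological_space) set"
  assumes S: "S \<subseteq> extensional I"
  shows "subtopology (product_topology (\<lambda>_. euclidean) I) S = top_of_set S"
proof -
  let ?P = "subtopology (product_topology (\<lambda>_. euclidean :: 'b topology) I) S"
  have ts: "topspace ?P = S"
    using S by (auto simp: PiE_def)
  have c1: "continuous_map ?P (top_of_set S) (\<lambda>x. x)"
  proof -
    have "continuous_map ?P euclidean (\<lambda>x. x k)" for k
    proof (cases "k \<in> I")
      case True
      then show ?thesis
        by (intro continuous_map_from_subtopology continuous_map_product_projection)
    next
      case False
      have "continuous_map ?P euclidean (\<lambda>x. undefined)" by simp
      then show ?thesis
        by (rule continuous_map_eq) (use S ts False in \<open>auto simp: extensional_def\<close>)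
    qed
    then have "continuous_map ?P (product_topology (\<lambda>_. euclidean) UNIV) (\<lambda>x. x)"
      by (simp add: continuous_map_componentwise_UNIV)
    then show ?thesis
      using ts by (simp add: continuous_map_in_subtopology euclidean_product_topology)
  qed
  have c2: "continuous_map (top_of_set S) ?P (\<lambda>x. x)"
  proof -
    have "continuous_map (top_of_set S) (product_topology (\<lambda>_. euclidean) I) (\<lambda>x. x)"
      unfolding continuous_map_componentwise
      using S by (auto intro: continuous_on_product_then_coordinatewise)
    then show ?thesis by (simp add: continuous_map_in_subtopology)
  qed
  have "openin ?P U \<longleftrightarrow> openin (top_of_set S) U" for U
  proof -
    have "{x \<in> S. x \<in> U} = U" if "U \<subseteq> S" using that by blast
    moreover have "openin ?P U \<Longrightarrow> openin (top_of_set S) {x \<in> S. x \<in> U}"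
      using openin_continuous_map_preimage[OF c2, of U] by simp
    moreover have "openin (top_of_set S) U \<Longrightarrow> openin ?P {x \<in> S. x \<in> U}"
      using openin_continuous_map_preimage[OF c1, of U] unfolding ts .
    moreover have "openin ?P U \<Longrightarrow> U \<subseteq> S" "openin (top_of_set S) U \<Longrightarrow> U \<subseteq> S"
      using openin_subset[of ?P U] openin_subset[of "top_of_set S" U] unfolding ts by auto
    ultimately show ?thesis by metis
  qed
  then show ?thesis by (simp add: topology_eq)
qed

lemma continuous_on_eval:
  "continuous_on S (\<lambda>\<kappa> :: 'a \<Rightarrow> 'b::topological_space. \<kappa> a)"
  using continuous_on_product_coordinates[of a] by (rule continuous_on_subset) simp

lemma compact_dependent_box:
  fixes C :: "'a \<Rightarrow> 'b::topological_space set"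
  assumes "\<And>a. compact (C a)"
  shows "compact {f. \<forall>a. f a \<in> C a}"
proof -
  have "compactin euclidean (Pi\<^sub>E UNIV C)"
    by (subst euclidean_product_topology[symmetric], subst compactin_PiE) (use assms in auto)
  moreover have "Pi\<^sub>E UNIV C = {f. \<forall>a. f a \<in> C a}" by (auto simp: PiE_UNIV_domain)
  ultimately show ?thesis by simp
qed

context linf_projection
begin

abbreviation I where "I \<equiv> IG G \<phi>"
abbreviation chars where "chars \<equiv> hamana_chars G \<phi>"

text \<open>Contractive unital functionals on the range. Extensionality is written as membership in
  the one-point set \<open>{undefined}\<close>, so that the first clause is a product of compact
  sets over all coordinates.\<close>

definition states :: "(('g \<Rightarrow> complex) \<Rightarrow> complex) set" where
  "states = {\<kappa>. (\<forall>a. \<kappa> a \<in> (if a \<in> I then cball 0 (SUP k. norm (a k)) else {undefined})) \<and>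
     (\<forall>a\<in>I. \<forall>b\<in>I. \<kappa> (\<lambda>h. a h + b h) = \<kappa> a + \<kappa> b) \<and>
     (\<forall>a\<in>I. \<forall>c. \<kappa> (\<lambda>h. c * a h) = c * \<kappa> a) \<and> \<kappa> (linf_one G) = 1}"

lemma norm_le_SUP: "a \<in> I \<Longrightarrow> norm (a h) \<le> (SUP k. norm (a k))"
proof -
  assume "a \<in> I"
  then obtain B where "\<And>k. norm (a k) \<le> B" using linf_bound[OF IG_linf] by blast
  then have "bdd_above (range (\<lambda>k. norm (a k)))" by (auto simp: bdd_above_def)
  then show ?thesis by (intro cSUP_upper) auto
qed

lemma compact_states: "compact states"
  unfolding states_def Collect_conj_eq[of "\<lambda>\<kappa>. \<forall>a. \<kappa> a \<in> _ a"]
  by (intro compact_Int_closed compact_dependent_box closed_Collect_conj closed_Collect_ball closed_Collect_all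
      closed_Collect_eq continuous_on_eval continuous_on_add continuous_on_mult continuous_on_const)
     auto

lemma chars_eq: "chars = states \<inter> {\<kappa>. \<forall>a\<in>I. \<forall>b\<in>I. \<kappa> (\<phi> (\<lambda>h. a h * b h)) = \<kappa> a * \<kappa> b}"
proof (intro equalityI subsetI)
  fix \<kappa> assume \<kappa>: "\<kappa> \<in> chars"
  have "\<kappa> a \<in> (if a \<in> I then cball 0 (SUP k. norm (a k)) else {undefined})" for a
    using char_bound[OF \<kappa> _ norm_le_SUP] char_extensional[OF \<kappa>] by (auto simp: extensional_def)
  then show "\<kappa> \<in> states \<inter> {\<kappa>. \<forall>a\<in>I. \<forall>b\<in>I. \<kappa> (\<phi> (\<lambda>h. a h * b h)) = \<kappa> a * \<kappa> b}"
    using charD[OF \<kappa>] by (simp add: states_def)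
next
  fix \<kappa> assume "\<kappa> \<in> states \<inter> {\<kappa>. \<forall>a\<in>I. \<forall>b\<in>I. \<kappa> (\<phi> (\<lambda>h. a h * b h)) = \<kappa> a * \<kappa> b}"
  then show "\<kappa> \<in> chars"
    unfolding states_def hamana_chars_def extensional_def by (auto split: if_splits)
qed

lemma compact_chars: "compact chars"
  unfolding chars_eq
  by (intro compact_Int_closed compact_states closed_Collect_ball closed_Collect_eq continuous_on_eval continuous_on_mult)

lemma hamana_topology_eq: "hamana_topology G \<phi> = top_of_set chars"
  unfolding hamana_topology_def
  by (rule subtopology_product_extensional) (auto simp: hamana_chars_def)

lemma topspace_hamana: "topspace (hamana_topology G \<phi>) = chars"
  by (simp add: hamana_topology_eq)

lemma compact_space_hamana: "compact_space (hamana_topology G \<phi>)"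
  unfolding hamana_topology_eq using compact_chars by (simp add: compact_space_subtopology)

lemma Hausdorff_space_hamana: "Hausdorff_space (hamana_topology G \<phi>)"
  unfolding hamana_topology_def
  by (intro Hausdorff_space_subtopology) (simp add: Hausdorff_space_product_topology)

lemma continuous_map_hamana_eval: "continuous_map (hamana_topology G \<phi>) euclidean (\<lambda>\<kappa>. \<kappa> a)"
  unfolding hamana_topology_eq by (simp add: continuous_on_eval)

text \<open>Evaluation at a group element is a state, and suitable elements make it nearly
  multiplicative on any finite set of pairs; compactness of \<open>states\<close> provides an
  exactly multiplicative one.\<close>

lemma chars_nonempty: "chars \<noteq> {}"
proof -
  let ?Z = "top_of_set states"
  have "\<exists>\<kappa>\<in>topspace ?Z. \<forall>p\<in>I \<times> I. norm (\<kappa> (\<phi> (\<lambda>h. fst p h * snd p h)) - \<kappa> (fst p) * \<kappa> (snd p)) = 0"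
  proof (rule compact_space_approx_solution)
    show "compact_space ?Z" using compact_states by (simp add: compact_space_subtopology)
    fix p :: "('g \<Rightarrow> complex) \<times> ('g \<Rightarrow> complex)"
    show "continuous_map ?Z euclideanreal (\<lambda>\<kappa>. norm (\<kappa> (\<phi> (\<lambda>h. fst p h * snd p h)) - \<kappa> (fst p) * \<kappa> (snd p)))"
      by (auto intro!: continuous_on_norm continuous_on_diff continuous_on_mult continuous_on_eval)
  next
    fix P and \<epsilon> :: real assume P: "finite P" "P \<subseteq> I \<times> I" and "\<epsilon> > 0"
    then obtain h where h: "h \<in> carrier G" "\<forall>(a, b)\<in>P. norm (\<phi> (\<lambda>h. a h * b h) h - a h * b h) \<le> \<epsilon>"
      using ex_approx_multiplicative_point by blast
    define \<kappa> where "\<kappa> = (\<lambda>a. if a \<in> I then a h else undefined)"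
    have "\<kappa> \<in> states"
      using h(1) by (auto simp: states_def \<kappa>_def IG_add IG_scale IG_one norm_le_SUP) (simp add: linf_one_def)
    moreover have "norm (\<kappa> (\<phi> (\<lambda>h. a h * b h)) - \<kappa> a * \<kappa> b) \<le> \<epsilon>" if "(a, b) \<in> P" for a b
      using h(2) that P(2) by (auto simp: \<kappa>_def IG_range linf_mult IG_linf)
    ultimately show "\<exists>\<kappa>\<in>topspace ?Z. \<forall>p\<in>P. \<bar>norm (\<kappa> (\<phi> (\<lambda>h. fst p h * snd p h)) - \<kappa> (fst p) * \<kappa> (snd p)) - 0\<bar> \<le> \<epsilon>"
      by (intro bexI[of _ \<kappa>]) auto
  qed
  then show ?thesis unfolding chars_eq by force
qed

section \<open>The action on the character space\<close>

lemma hamana_act_apply: "a \<in> I \<Longrightarrow> hamana_act G \<phi> g \<kappa> a = \<kappa> (ltr G (inv g) a)"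
  by (simp add: hamana_act_def)

lemma hamana_act_chars:
  assumes \<kappa>: "\<kappa> \<in> chars" and g: "g \<in> carrier G"
  shows "hamana_act G \<phi> g \<kappa> \<in> chars"
proof -
  have ig: "inv g \<in> carrier G" using g by simp
  note L = IG_ltr[OF _ ig]
  have "hamana_act G \<phi> g \<kappa> (\<phi> (\<lambda>h. a h * b h)) = hamana_act G \<phi> g \<kappa> a * hamana_act G \<phi> g \<kappa> b"
    if a: "a \<in> I" and b: "b \<in> I" for a b
  proof -
    have ab: "(\<lambda>h. a h * b h) \<in> linf G" using a b by (intro linf_mult IG_linf)
    show ?thesis
      using char_mult[OF \<kappa> L[OF a] L[OF b]]
      by (simp add: hamana_act_apply a b IG_range[OF ab] F_ltr[OF ig ab, symmetric] ltr_mult)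
  qed
  moreover have "hamana_act G \<phi> g \<kappa> \<in> extensional I" by (simp add: hamana_act_def)
  ultimately show ?thesis
    unfolding hamana_chars_def
    using ig by (auto simp: hamana_act_apply IG_add IG_scale IG_one ltr_add ltr_scale ltr_one
        char_add[OF \<kappa> L L] char_scale[OF \<kappa> L] char_one[OF \<kappa>])
qed

lemma compact_G_space_hamana: "compact_G_space G (hamana_topology G \<phi>) (hamana_act G \<phi>)"
  unfolding compact_G_space_def topspace_hamana
proof (intro conjI ballI)
  fix g assume g: "g \<in> carrier G"
  have "continuous_on chars (hamana_act G \<phi> g)"
  proof (rule continuous_on_coordinatewise_then_product)
    fix a
    show "continuous_on chars (\<lambda>\<kappa>. hamana_act G \<phi> g \<kappa> a)"
      by (cases "a \<in> I") (simp_all add: hamana_act_def continuous_on_eval)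
  qed
  then show "continuous_map (hamana_topology G \<phi>) (hamana_topology G \<phi>) (hamana_act G \<phi> g)"
    using hamana_act_chars[OF _ g] by (auto simp: hamana_topology_eq continuous_map_in_subtopology)
next
  fix \<kappa> assume \<kappa>: "\<kappa> \<in> chars"
  show "hamana_act G \<phi> \<one> \<kappa> = \<kappa>"
    using char_extensional[OF \<kappa>] by (auto simp: hamana_act_def fun_eq_iff restrict_def extensional_def ltr_id IG_linf)
  fix g k assume g: "g \<in> carrier G" and k: "k \<in> carrier G"
  then show "hamana_act G \<phi> (g \<otimes> k) \<kappa> = hamana_act G \<phi> g (hamana_act G \<phi> k \<kappa>)"
    by (auto simp: hamana_act_def fun_eq_iff restrict_def IG_ltr ltr_ltr inv_mult_group)
qed (use chars_nonempty compact_space_hamana Hausdorff_space_hamana in auto)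

text \<open>\<open>W\<close> contains a basic neighbourhood given by finitely many coordinates
  \<open>i\<close> and radii \<open>\<delta> i\<close>. The sum \<open>b\<close> of the Choi--Effros
  squares of \<open>(i - \<kappa>0 i) / \<delta> i\<close> satisfies \<open>\<kappa> b =
  (\<Sum>i\<in>J. (norm (\<kappa> i - \<kappa>0 i) / \<delta> i)\<^sup>2)\<close>, and outside
  \<open>W\<close> some summand is at least 1. Thus \<open>b\<close> acts as a Urysohn function
  realised in the range of \<open>\<phi>\<close>.\<close>

lemma ex_peak_function:
  assumes W: "openin (hamana_topology G \<phi>) W" and \<kappa>0: "\<kappa>0 \<in> W"
  obtains b where "b \<in> I" "\<kappa>0 b = 0" "\<And>\<kappa>. \<kappa> \<in> chars \<Longrightarrow> 0 \<le> Re (\<kappa> b)"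
    "\<And>\<kappa>. \<kappa> \<in> chars - W \<Longrightarrow> 1 \<le> Re (\<kappa> b)"
proof -
  have \<kappa>0c: "\<kappa>0 \<in> chars" using openin_subset[OF W] \<kappa>0 topspace_hamana by blast
  obtain V where V: "openin (product_topology (\<lambda>_. euclidean) I) V" "W = V \<inter> chars"
    using W unfolding hamana_topology_def openin_subtopology by blast
  then obtain U where U: "\<kappa>0 \<in> Pi\<^sub>E I U" "\<And>i. open (U i)" "finite {i. U i \<noteq> UNIV}" "Pi\<^sub>E I U \<subseteq> V"
    using product_topology_open_contains_basis[OF V(1), of \<kappa>0] \<kappa>0 by auto
  define J where "J = {i \<in> I. U i \<noteq> UNIV}"
  have J: "finite J" "J \<subseteq> I" using U(3) by (auto simp: J_def)
  have "\<forall>i\<in>J. \<exists>\<delta>>0. ball (\<kappa>0 i) \<delta> \<subseteq> U i"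
    using U(1,2) J(2) by (auto simp: PiE_iff open_contains_ball)
  then obtain \<delta> where \<delta>: "\<And>i. i \<in> J \<Longrightarrow> \<delta> i > 0" "\<And>i. i \<in> J \<Longrightarrow> ball (\<kappa>0 i) (\<delta> i) \<subseteq> U i"
    by metis
  define v where "v = (\<lambda>i h. i h - \<kappa>0 i * linf_one G h)"
  define s where "s = (\<lambda>i h. complex_of_real (1 / (\<delta> i)\<^sup>2) * \<phi> (\<lambda>h. v i h * cnj (v i h)) h)"
  have v: "v i \<in> I" if "i \<in> J" for i
    unfolding v_def using that J(2) by (intro IG_diff IG_const) auto
  have s: "s i \<in> I" if "i \<in> J" for i
    unfolding s_def using v[OF that] by (intro IG_scale IG_range linf_mult linf_cnj IG_linf)
  have \<kappa>s: "\<kappa> (s i) = complex_of_real ((norm (\<kappa> i - \<kappa>0 i) / \<delta> i)\<^sup>2)" if "i \<in> J" "\<kappa> \<in> chars" for i \<kappa>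
  proof -
    have "\<kappa> (v i) = \<kappa> i - \<kappa>0 i"
      unfolding v_def using that J(2)
      by (subst char_diff) (auto simp: IG_const char_scale IG_one char_one)
    moreover have "\<kappa> (\<phi> (\<lambda>h. v i h * cnj (v i h))) = \<kappa> (v i) * cnj (\<kappa> (v i))"
      using char_mult[OF that(2) v[OF that(1)] IG_cnj[OF v[OF that(1)]]] char_cnj[OF that(2) v[OF that(1)]] by simp
    moreover have "\<kappa> (s i) = complex_of_real (1 / (\<delta> i)\<^sup>2) * \<kappa> (\<phi> (\<lambda>h. v i h * cnj (v i h)))"
      unfolding s_def using v[OF that(1)] that(2)
      by (intro char_scale IG_range linf_mult linf_cnj IG_linf)
    ultimately show ?thesis
      using complex_norm_square[of "\<kappa> i - \<kappa>0 i"] by (simp add: power_divide)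
  qed
  define b where "b = (\<lambda>h. \<Sum>i\<in>J. s i h)"
  have b: "b \<in> I" unfolding b_def using J(1) s by (rule IG_sum)
  have \<kappa>b: "\<kappa> b = complex_of_real (\<Sum>i\<in>J. (norm (\<kappa> i - \<kappa>0 i) / \<delta> i)\<^sup>2)" if "\<kappa> \<in> chars" for \<kappa>
    unfolding b_def using char_sum[OF that J(1), of s] s \<kappa>s that by simp
  have Re\<kappa>b: "Re (\<kappa> b) = (\<Sum>i\<in>J. (norm (\<kappa> i - \<kappa>0 i) / \<delta> i)\<^sup>2)" if "\<kappa> \<in> chars" for \<kappa>
    unfolding \<kappa>b[OF that] by (rule Re_complex_of_real)
  have "1 \<le> Re (\<kappa> b)" if \<kappa>: "\<kappa> \<in> chars - W" for \<kappa>
  proof -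
    have "\<kappa> \<notin> Pi\<^sub>E I U" using that V(2) U(4) by blast
    then obtain i where i: "i \<in> I" "\<kappa> i \<notin> U i"
      using \<kappa> char_extensional[of \<kappa>] by (auto simp: PiE_iff)
    then have iJ: "i \<in> J" by (auto simp: J_def)
    then have "\<kappa> i \<notin> ball (\<kappa>0 i) (\<delta> i)" using \<delta>(2) i by blast
    then have "\<delta> i \<le> norm (\<kappa> i - \<kappa>0 i)" by (simp add: dist_norm norm_minus_commute)
    then have "1 \<le> (norm (\<kappa> i - \<kappa>0 i) / \<delta> i)\<^sup>2"
      using \<delta>(1)[OF iJ] by (simp add: one_le_power)
    also have "\<dots> \<le> (\<Sum>i\<in>J. (norm (\<kappa> i - \<kappa>0 i) / \<delta> i)\<^sup>2)"
      using iJ J(1) by (intro member_le_sum) auto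
    finally show ?thesis using Re\<kappa>b \<kappa> by simp
  qed
  moreover have "0 \<le> Re (\<kappa> b)" if "\<kappa> \<in> chars" for \<kappa>
    using Re\<kappa>b[OF that] by (simp add: sum_nonneg)
  moreover have "\<kappa>0 b = 0" using \<kappa>b[OF \<kappa>0c] by simp
  ultimately show thesis by (intro that[OF b])
qed

end

section \<open>Minimality and strong proximality\<close>

locale hamana = linf_projection G \<phi>
  for G :: "('g, 'm) monoid_scheme" (structure) and \<phi> :: "('g \<Rightarrow> complex) \<Rightarrow> ('g \<Rightarrow> complex)" +
  assumes minimal: "minimal_G_projection G \<phi>"
begin

text \<open>By rigidity, \<open>\<phi>\<close> inverts the Poisson transform of the state \<open>L\<close>; hence a lower bound on the
  values of \<open>L\<close> on the translates of \<open>b\<close> is a lower bound for \<open>b\<close>.\<close>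

lemma ex_small_translate:
  fixes L :: "('g \<Rightarrow> complex) \<Rightarrow> complex"
  assumes add: "\<And>a b. a \<in> I \<Longrightarrow> b \<in> I \<Longrightarrow> L (\<lambda>h. a h + b h) = L a + L b"
    and scale: "\<And>a c. a \<in> I \<Longrightarrow> L (\<lambda>h. c * a h) = c * L a"
    and one: "L (linf_one G) = 1"
    and pos: "\<And>a. a \<in> I \<Longrightarrow> linf_pos a \<Longrightarrow> Im (L a) = 0 \<and> 0 \<le> Re (L a)"
    and bound: "\<And>a B. a \<in> I \<Longrightarrow> (\<And>h. norm (a h) \<le> B) \<Longrightarrow> norm (L a) \<le> B"
    and b: "b \<in> I" and \<kappa>0: "\<kappa>0 \<in> chars" "\<kappa>0 b = 0" and "\<eta> > 0"
  shows "\<exists>g\<in>carrier G. Re (L (ltr G (inv g) b)) < \<eta>"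
proof (rule ccontr)
  assume "\<not> ?thesis"
  then have low: "\<And>g. g \<in> carrier G \<Longrightarrow> \<eta> \<le> Re (L (ltr G (inv g) b))" by force
  define T where "T = (\<lambda>a g. if g \<in> carrier G then L (ltr G (inv g) a) else 0)"
  have T: "T a \<in> linf G" if a: "a \<in> I" for a
  proof -
    obtain B where B: "B \<ge> 0" "\<And>h. norm (a h) \<le> B" using linf_bound[OF IG_linf[OF a]] by blast
    have "norm (ltr G k a h) \<le> B" for k h using B by (simp add: ltr_def)
    then show ?thesis
      by (intro linfI[of _ _ B]) (auto simp: T_def intro!: bound IG_ltr a)
  qed
  have Tadd: "T (\<lambda>h. a h + b h) = (\<lambda>h. T a h + T b h)" if "a \<in> I" "b \<in> I" for a b
    using that by (auto simp: T_def ltr_add add IG_ltr fun_eq_iff)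
  have Tscale: "T (\<lambda>h. c * a h) = (\<lambda>h. c * T a h)" if "a \<in> I" for a c
    using that by (auto simp: T_def ltr_scale scale IG_ltr fun_eq_iff)
  have Tone: "T (linf_one G) = linf_one G"
    by (auto simp: T_def ltr_one one fun_eq_iff) (auto simp: linf_one_def)
  have Tpos: "linf_pos (T a)" if "a \<in> I" "linf_pos a" for a
    using pos[OF IG_ltr[OF that(1)] ltr_pos[OF that(2)]] by (auto simp: T_def linf_pos_def)
  have Tltr: "T (ltr G g a) = ltr G g (T a)" if g: "g \<in> carrier G" and a: "a \<in> I" for g a
  proof
    fix k
    show "T (ltr G g a) k = ltr G g (T a) k"
    proof (cases "k \<in> carrier G")
      case True
      then have "inv (inv g \<otimes> k) = inv k \<otimes> g" using g by (simp add: inv_mult_group)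
      then have "T a (inv g \<otimes> k) = L (ltr G (inv k) (ltr G g a))"
        using True g by (simp add: T_def ltr_ltr)
      also have "\<dots> = T (ltr G g a) k" using True by (simp add: T_def)
      finally show ?thesis using True by (simp add: ltr_def[of G g "T a"])
    next
      case False
      then have "T (ltr G g a) k = 0" by (simp add: T_def)
      then show ?thesis using False by (simp add: ltr_def[of G g "T a"])
    qed
  qed
  \<comment> \<open>\<open>T\<close> is linear and bounded only on the range of
    \<open>\<phi>\<close>, so \<open>\<phi>\<close> comes first; the outer \<open>\<phi>\<close>
    returns to the range. The composite absorbs \<open>\<phi>\<close> on both sides, as rigidity
    requires.\<close>
  let ?u = "\<lambda>a. \<phi> (T (\<phi> a))"
  have "linf_map G ?u"
    by unfold_locales
      (simp_all add: F_in T IG_range F_add Tadd linf_add F_scale Tscale linf_scale F_one Tone F_pos Tpos F_ltr Tltr linf_ltr)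
  then have "?u a = \<phi> a" if "a \<in> linf G" for a
    using minimal_G_projection_rigid[OF is_group minimal, of ?u a] that
    by (simp add: idem T IG_range)
  from this[OF IG_linf[OF b]] have \<phi>T: "\<phi> (T b) = b" by (simp add: IG_fixed[OF b])
  have "\<eta> \<le> Re (b h)" if h: "h \<in> carrier G" for h
  proof -
    have "Re (\<phi> (\<lambda>h. complex_of_real \<eta> * linf_one G h) h) \<le> Re (\<phi> (\<lambda>h. complex_of_real (Re (T b h))) h)"
      by (rule F_le[OF linf_const linf_Re[OF T[OF b]]]) (auto simp: linf_one_def T_def low)
    also have "\<dots> = Re (b h)" unfolding F_Re[OF T[OF b]] \<phi>T by simp
    finally show ?thesis unfolding F_scale[OF linf_one_in] F_one using h by (simp add: linf_one_def)
  qed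
  from char_lower[OF \<kappa>0(1) b this] \<kappa>0(2) \<open>\<eta> > 0\<close> show False by simp
qed

lemma char_pos:
  assumes "\<kappa> \<in> chars" "a \<in> I" "linf_pos a"
  shows "Im (\<kappa> a) = 0 \<and> 0 \<le> Re (\<kappa> a)"
  using assms char_real[OF assms(1,2)] char_lower[OF assms(1,2), of 0] by (auto simp: linf_pos_def)

text \<open>An element \<open>b\<close> that vanishes at \<open>\<kappa>0\<close> and is at least 1
  outside \<open>W\<close> detects entry into \<open>W\<close>: a translate of
  \<open>\<kappa>\<close> with value below 1 on \<open>b\<close> must lie in
  \<open>W\<close>.\<close>

lemma G_minimal_hamana: "G_minimal G (hamana_topology G \<phi>) (hamana_act G \<phi>)"
  unfolding G_minimal_def topspace_hamana
proof (intro ballI)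
  fix \<kappa> assume \<kappa>: "\<kappa> \<in> chars"
  let ?O = "(\<lambda>g. hamana_act G \<phi> g \<kappa>) ` carrier G"
  have "\<kappa>0 \<in> hamana_topology G \<phi> closure_of ?O" if \<kappa>0: "\<kappa>0 \<in> chars" for \<kappa>0
    unfolding in_closure_of topspace_hamana
  proof (intro conjI allI impI \<kappa>0)
    fix W assume W: "\<kappa>0 \<in> W \<and> openin (hamana_topology G \<phi>) W"
    obtain b where b: "b \<in> I" "\<kappa>0 b = 0" "\<And>\<kappa>. \<kappa> \<in> chars \<Longrightarrow> 0 \<le> Re (\<kappa> b)"
      "\<And>\<kappa>. \<kappa> \<in> chars - W \<Longrightarrow> 1 \<le> Re (\<kappa> b)"
      by (rule ex_peak_function[OF conjunct2[OF W] conjunct1[OF W]]) (rule that; simp)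
    have "\<exists>g\<in>carrier G. Re (\<kappa> (ltr G (inv g) b)) < 1"
    proof (rule ex_small_translate[where L = \<kappa> and \<eta> = 1, OF _ _ _ _ _ b(1) \<kappa>0 b(2)])
      show "\<And>a B. a \<in> I \<Longrightarrow> (\<And>h. norm (a h) \<le> B) \<Longrightarrow> norm (\<kappa> a) \<le> B" by (rule char_bound[OF \<kappa>])
    qed (simp_all add: char_add[OF \<kappa>] char_scale[OF \<kappa>] char_one[OF \<kappa>] char_pos[OF \<kappa>])
    then obtain g where g: "g \<in> carrier G" "Re (\<kappa> (ltr G (inv g) b)) < 1" by blast
    have "hamana_act G \<phi> g \<kappa> \<in> W"
      using b(4)[of "hamana_act G \<phi> g \<kappa>"] g hamana_act_chars[OF \<kappa> g(1)]
      by (auto simp: hamana_act_apply b(1))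
    then show "\<exists>y. y \<in> ?O \<and> y \<in> W" using g(1) by blast
  qed
  then show "hamana_topology G \<phi> closure_of ?O = chars"
    using closure_of_subset_topspace[of "hamana_topology G \<phi>" ?O] topspace_hamana by blast
qed

text \<open>Averaging characters over \<open>\<nu>\<close> gives a state \<open>L\<close>. If
  \<open>b\<close> dominates \<open>\<bar>f \<kappa> - f \<kappa>0\<bar>\<close> up to
  \<open>\<epsilon>/2\<close>, a translate with \<open>L\<close> below \<open>\<epsilon>/2\<close>
  bounds the integral by \<open>\<epsilon>\<close>. Any character \<open>\<kappa>0\<close> can carry
  the limiting point mass.\<close>

lemma G_strongly_proximal_hamana: "G_strongly_proximal G (hamana_topology G \<phi>) (hamana_act G \<phi>)"
  unfolding G_strongly_proximal_def
proof (intro allI impI)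
  fix \<nu> :: "(('g \<Rightarrow> complex) \<Rightarrow> complex) measure"
  let ?X = "hamana_topology G \<phi>"
  assume \<nu>: "prob_space \<nu> \<and> sets \<nu> = sets (borel_of ?X)"
  then interpret prob_space \<nu> by simp
  have sets: "sets \<nu> = sets (borel_of ?X)" using \<nu> by simp
  have space: "space \<nu> = chars"
    using sets_eq_imp_space_eq[OF sets] by (simp add: space_borel_of topspace_hamana)
  have int: "integrable \<nu> f" if "continuous_map ?X euclidean f" for f :: "_ \<Rightarrow> 'z::{banach, second_countable_topology}"
    by (rule integrable_continuous_map[OF compact_space_hamana that sets prob_space_axioms])
  have inte: "integrable \<nu> (\<lambda>\<kappa>. \<kappa> a)" for a by (rule int[OF continuous_map_hamana_eval])
  define L where "L = (\<lambda>a. \<integral>\<kappa>. \<kappa> a \<partial>\<nu>)"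
  have Ladd: "L (\<lambda>h. a h + b h) = L a + L b" if "a \<in> I" "b \<in> I" for a b
  proof -
    have "L (\<lambda>h. a h + b h) = (\<integral>\<kappa>. \<kappa> a + \<kappa> b \<partial>\<nu>)"
      unfolding L_def by (rule Bochner_Integration.integral_cong) (auto simp: space char_add that)
    then show ?thesis using inte by (simp add: L_def)
  qed
  have Lscale: "L (\<lambda>h. c * a h) = c * L a" if "a \<in> I" for a c
  proof -
    have "L (\<lambda>h. c * a h) = (\<integral>\<kappa>. c * \<kappa> a \<partial>\<nu>)"
      unfolding L_def by (rule Bochner_Integration.integral_cong) (auto simp: space char_scale that)
    then show ?thesis by (simp add: L_def)
  qed
  have Lone: "L (linf_one G) = 1"
  proof -
    have "L (linf_one G) = (\<integral>\<kappa>. 1 \<partial>\<nu>)"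
      unfolding L_def by (rule Bochner_Integration.integral_cong) (auto simp: space char_one)
    then show ?thesis by (simp add: prob_space)
  qed
  have ReL: "Re (L a) = (\<integral>\<kappa>. Re (\<kappa> a) \<partial>\<nu>)" and ImL: "Im (L a) = (\<integral>\<kappa>. Im (\<kappa> a) \<partial>\<nu>)" for a
    unfolding L_def using inte by auto
  have Lpos: "Im (L a) = 0 \<and> 0 \<le> Re (L a)" if "a \<in> I" "linf_pos a" for a
  proof
    have "(\<integral>\<kappa>. Im (\<kappa> a) \<partial>\<nu>) = (\<integral>\<kappa>. 0 \<partial>\<nu>)"
      by (rule Bochner_Integration.integral_cong) (auto simp: space char_pos that)
    then show "Im (L a) = 0" by (simp add: ImL)
    show "0 \<le> Re (L a)" unfolding ReL by (rule Bochner_Integration.integral_nonneg_AE) (auto simp: space char_pos that)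
  qed
  have Lbound: "norm (L a) \<le> B" if "a \<in> I" "\<And>h. norm (a h) \<le> B" for a B
  proof -
    have "norm (L a) \<le> (\<integral>\<kappa>. norm (\<kappa> a) \<partial>\<nu>)" unfolding L_def by (rule integral_norm_bound)
    also have "\<dots> \<le> (\<integral>\<kappa>. B \<partial>\<nu>)"
      using inte by (intro integral_mono) (auto simp: space char_bound that)
    finally show ?thesis by (simp add: prob_space)
  qed
  obtain \<kappa>0 where \<kappa>0: "\<kappa>0 \<in> chars" using chars_nonempty by blast
  show "\<exists>x\<in>topspace ?X. \<forall>F \<epsilon>. finite F \<and> F \<subseteq> {f. continuous_map ?X euclideanreal f} \<and> \<epsilon> > 0 \<longrightarrow>
           (\<exists>g\<in>carrier G. \<forall>f\<in>F. \<bar>(\<integral>y. f (hamana_act G \<phi> g y) \<partial>\<nu>) - f x\<bar> < \<epsilon>)"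
  proof (intro bexI[of _ \<kappa>0] allI impI)
    show "\<kappa>0 \<in> topspace ?X" using \<kappa>0 topspace_hamana by simp
    fix F :: "((('g \<Rightarrow> complex) \<Rightarrow> complex) \<Rightarrow> real) set" and \<epsilon> :: real
    assume F: "finite F \<and> F \<subseteq> {f. continuous_map ?X euclideanreal f} \<and> \<epsilon> > 0"
    then have \<epsilon>: "\<epsilon> > 0" and cont: "\<And>f. f \<in> F \<Longrightarrow> continuous_map ?X euclideanreal f" by auto
    have "\<exists>b\<in>I. \<kappa>0 b = 0 \<and> (\<forall>\<kappa>\<in>chars. 0 \<le> Re (\<kappa> b) \<and> \<bar>f \<kappa> - f \<kappa>0\<bar> \<le> \<epsilon>/2 + Re (\<kappa> b))" if f: "f \<in> F" for f
    proof -
      obtain M where M: "M > 0" "\<And>\<kappa>. \<kappa> \<in> chars \<Longrightarrow> norm (f \<kappa>) \<le> M"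
        using continuous_map_bounded[OF compact_space_hamana cont[OF f]] topspace_hamana by metis
      define W where "W = {\<kappa> \<in> topspace ?X. f \<kappa> \<in> ball (f \<kappa>0) (\<epsilon>/2)}"
      have W: "openin ?X W" unfolding W_def using cont[OF f] by (intro openin_continuous_map_preimage) auto
      have \<kappa>0W: "\<kappa>0 \<in> W" using \<kappa>0 \<epsilon> by (simp add: W_def topspace_hamana)
      obtain b where b: "b \<in> I" "\<kappa>0 b = 0" "\<And>\<kappa>. \<kappa> \<in> chars \<Longrightarrow> 0 \<le> Re (\<kappa> b)"
        "\<And>\<kappa>. \<kappa> \<in> chars - W \<Longrightarrow> 1 \<le> Re (\<kappa> b)"
        by (rule ex_peak_function[OF W \<kappa>0W]) (rule that; simp)
      \<comment> \<open>Outside \<open>W\<close> the difference of two values of \<open>f\<close> is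
        at most \<open>2 * M\<close> while \<open>\<kappa> b\<close> has real part at least 1;
        inside \<open>W\<close> the \<open>\<epsilon>/2\<close> is enough.\<close>
      let ?b = "\<lambda>h. complex_of_real (2 * M) * b h"
      have \<kappa>b: "\<kappa> ?b = complex_of_real (2 * M) * \<kappa> b" if "\<kappa> \<in> chars" for \<kappa>
        using char_scale[OF that b(1)] .
      have "\<bar>f \<kappa> - f \<kappa>0\<bar> \<le> \<epsilon>/2 + Re (\<kappa> ?b)" if \<kappa>: "\<kappa> \<in> chars" for \<kappa>
      proof (cases "\<kappa> \<in> W")
        case True
        then have "\<bar>f \<kappa> - f \<kappa>0\<bar> < \<epsilon>/2" by (simp add: W_def dist_real_def abs_minus_commute)
        moreover have "0 \<le> 2 * M * Re (\<kappa> b)" using b(3)[OF \<kappa>] M(1) by simp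
        ultimately show ?thesis using \<kappa>b[OF \<kappa>] by simp
      next
        case False
        have "\<bar>f \<kappa> - f \<kappa>0\<bar> \<le> 2 * M" using M(2)[OF \<kappa>] M(2)[OF \<kappa>0] by simp
        also have "\<dots> \<le> 2 * M * Re (\<kappa> b)" using b(4)[of \<kappa>] \<kappa> False M(1) by simp
        finally show ?thesis using \<kappa>b[OF \<kappa>] \<epsilon> by simp
      qed
      moreover have "0 \<le> Re (\<kappa> ?b)" if \<kappa>: "\<kappa> \<in> chars" for \<kappa> using b(3)[OF \<kappa>] \<kappa>b[OF \<kappa>] M(1) by simp
      moreover have "\<kappa>0 ?b = 0" using \<kappa>b[OF \<kappa>0] b(2) by simp
      ultimately show ?thesis using IG_scale[OF b(1)] by blast
    qed
    then obtain \<beta> where \<beta>: "\<And>f. f \<in> F \<Longrightarrow> \<beta> f \<in> I" "\<And>f. f \<in> F \<Longrightarrow> \<kappa>0 (\<beta> f) = 0"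
      "\<And>f \<kappa>. f \<in> F \<Longrightarrow> \<kappa> \<in> chars \<Longrightarrow> 0 \<le> Re (\<kappa> (\<beta> f)) \<and> \<bar>f \<kappa> - f \<kappa>0\<bar> \<le> \<epsilon>/2 + Re (\<kappa> (\<beta> f))"
      by metis
    \<comment> \<open>A single \<open>b\<close> dominates all \<open>f\<close> in \<open>F\<close>
      at once, so that one group element serves them all.\<close>
    define b where "b = (\<lambda>h. \<Sum>f\<in>F. \<beta> f h)"
    have finF: "finite F" using F by simp
    have b: "b \<in> I" unfolding b_def using finF \<beta>(1) by (rule IG_sum)
    have \<kappa>b: "\<kappa> b = (\<Sum>f\<in>F. \<kappa> (\<beta> f))" if "\<kappa> \<in> chars" for \<kappa>
      unfolding b_def using char_sum[OF that finF \<beta>(1)] .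
    have dom: "\<bar>f \<kappa> - f \<kappa>0\<bar> \<le> \<epsilon>/2 + Re (\<kappa> b)" if "f \<in> F" "\<kappa> \<in> chars" for f \<kappa>
    proof -
      have "Re (\<kappa> (\<beta> f)) \<le> (\<Sum>f\<in>F. Re (\<kappa> (\<beta> f)))"
        using that \<beta>(3) finF by (intro member_le_sum) auto
      then show ?thesis using \<beta>(3)[OF that] \<kappa>b[OF that(2)] by simp
    qed
    have \<kappa>0b: "\<kappa>0 b = 0" using \<kappa>b[OF \<kappa>0] \<beta>(2) by simp
    have "\<exists>g\<in>carrier G. Re (L (ltr G (inv g) b)) < \<epsilon>/2"
    proof (rule ex_small_translate[where L = L and \<eta> = "\<epsilon>/2", OF _ _ _ _ _ b \<kappa>0 \<kappa>0b])
      show "\<And>a B. a \<in> I \<Longrightarrow> (\<And>h. norm (a h) \<le> B) \<Longrightarrow> norm (L a) \<le> B" by (rule Lbound)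
    qed (simp_all add: Ladd Lscale Lone Lpos \<epsilon>)
    then obtain g where g: "g \<in> carrier G" "Re (L (ltr G (inv g) b)) < \<epsilon>/2" by blast
    have "\<bar>(\<integral>y. f (hamana_act G \<phi> g y) \<partial>\<nu>) - f \<kappa>0\<bar> < \<epsilon>" if f: "f \<in> F" for f
    proof -
      have "continuous_map ?X ?X (hamana_act G \<phi> g)"
        using compact_G_space_hamana g(1) unfolding compact_G_space_def by blast
      then have cfg: "continuous_map ?X euclideanreal (\<lambda>y. f (hamana_act G \<phi> g y))"
        using continuous_map_compose[OF _ cont[OF f]] by (simp add: comp_def)
      have "(\<integral>y. f (hamana_act G \<phi> g y) \<partial>\<nu>) - f \<kappa>0 = (\<integral>y. f (hamana_act G \<phi> g y) - f \<kappa>0 \<partial>\<nu>)"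
        using int[OF cfg] by (simp add: prob_space)
      also have "\<bar>\<dots>\<bar> \<le> (\<integral>y. \<bar>f (hamana_act G \<phi> g y) - f \<kappa>0\<bar> \<partial>\<nu>)"
        using integral_norm_bound[of \<nu> "\<lambda>y. f (hamana_act G \<phi> g y) - f \<kappa>0"] by simp
      also have "\<dots> \<le> (\<integral>y. \<epsilon>/2 + Re (y (ltr G (inv g) b)) \<partial>\<nu>)"
      proof (rule integral_mono)
        show "integrable \<nu> (\<lambda>y. \<bar>f (hamana_act G \<phi> g y) - f \<kappa>0\<bar>)"
          using int[OF cfg] by simp
        show "integrable \<nu> (\<lambda>y. \<epsilon>/2 + Re (y (ltr G (inv g) b)))"
          using inte by simp
        fix y assume "y \<in> space \<nu>"
        then show "\<bar>f (hamana_act G \<phi> g y) - f \<kappa>0\<bar> \<le> \<epsilon>/2 + Re (y (ltr G (inv g) b))"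
          using dom[OF f hamana_act_chars[OF _ g(1)], of y] by (simp add: space hamana_act_apply b)
      qed
      also have "\<dots> = \<epsilon>/2 + Re (L (ltr G (inv g) b))"
        using inte by (simp add: ReL prob_space)
      finally show ?thesis using g(2) by linarith
    qed
    then show "\<exists>g\<in>carrier G. \<forall>f\<in>F. \<bar>(\<integral>y. f (hamana_act G \<phi> g y) \<partial>\<nu>) - f \<kappa>0\<bar> < \<epsilon>"
      using g(1) by blast
  qed
qed

theorem G_boundary_hamana: "G_boundary G (hamana_topology G \<phi>) (hamana_act G \<phi>)"
  by (simp add: G_boundary_def compact_G_space_hamana G_minimal_hamana G_strongly_proximal_hamana)

end

subsection \<open>Mapping the Hamana boundary onto a boundary\<close>

lemma compact_Hausdorff_separating_function:
  assumes "compact_space X" "Hausdorff_space X" "closedin X C" "p \<in> topspace X" "p \<notin> C"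
  obtains f where "continuous_map X euclideanreal f" "f p = 0" "\<And>x. x \<in> C \<Longrightarrow> f x = 1"
proof -
  have "closedin X {p}" using assms(2,4) by (simp add: closedin_Hausdorff_singleton)
  moreover have "normal_space X"
    using assms(1,2) compact_Hausdorff_or_regular_imp_normal_space by blast
  ultimately obtain f where "continuous_map X euclideanreal f" "f ` {p} \<subseteq> {0}" "f ` C \<subseteq> {1}"
    using Urysohn_lemma_alt[of X "{p}" C 0 1] assms(3,5) by (auto simp: disjnt_def)
  then show thesis by (intro that[of f]) auto
qed

text \<open>Real continuous functions separate points of \<open>X\<close> from closed sets, so
  preimages of sets \<open>f < 1\<close> give enough open neighbourhoods.\<close>

lemma continuous_map_into_compact_Hausdorff:
  assumes "compact_space X" "Hausdorff_space X" and p: "p \<in> topspace Z \<rightarrow> topspace X"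
    and cont: "\<And>f. continuous_map X euclideanreal f \<Longrightarrow> continuous_map Z euclideanreal (\<lambda>z. f (p z))"
  shows "continuous_map Z X p"
  unfolding continuous_map_closedin
proof (intro conjI allI impI p)
  fix C assume C: "closedin X C"
  have "openin Z (topspace Z - {z \<in> topspace Z. p z \<in> C})"
  proof (subst openin_subopen, intro ballI)
    fix z assume "z \<in> topspace Z - {z \<in> topspace Z. p z \<in> C}"
    then have z: "z \<in> topspace Z" "p z \<notin> C" "p z \<in> topspace X" using p by auto
    obtain f where f: "continuous_map X euclideanreal f" "f (p z) = 0" "\<And>x. x \<in> C \<Longrightarrow> f x = 1"
      by (rule compact_Hausdorff_separating_function[OF assms(1,2) C z(3,2)]) (erule that; simp)
    let ?T = "{z \<in> topspace Z. f (p z) \<in> {..<1}}"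
    have "openin Z ?T" using cont[OF f(1)] by (intro openin_continuous_map_preimage) auto
    moreover have "z \<in> ?T" using z f(2) by simp
    moreover have "?T \<subseteq> topspace Z - {z \<in> topspace Z. p z \<in> C}" using f(3) by auto
    ultimately show "\<exists>T. openin Z T \<and> z \<in> T \<and> T \<subseteq> topspace Z - {z \<in> topspace Z. p z \<in> C}" by blast
  qed
  then show "closedin Z {z \<in> topspace Z. p z \<in> C}" by (simp add: closedin_def)
qed

context hamana
begin

text \<open>\<open>\<phi>\<close> after the pullback \<open>P\<close> along an orbit map is unital,
  positive and equivariant, but nothing makes it multiplicative in advance. Composing with a
  character therefore yields merely a state on C(X), and the work lies in showing that this state is
  evaluation at a point; that point is the image of the character.\<close>

theorem ex_factor_map:
  fixes X :: "'b topology" and act :: "'g \<Rightarrow> 'b \<Rightarrow> 'b"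
  assumes B: "G_boundary G X act"
  shows "\<exists>p. G_factor_map G (hamana_topology G \<phi>) (hamana_act G \<phi>) X act p"
proof -
  let ?H = "hamana_topology G \<phi>"
  let ?cts = "continuous_map X euclideanreal"
  have X: "compact_space X" "Hausdorff_space X" "topspace X \<noteq> {}"
    and actc: "\<And>g. g \<in> carrier G \<Longrightarrow> continuous_map X X (act g)"
    and act_mult: "\<And>g k x. g \<in> carrier G \<Longrightarrow> k \<in> carrier G \<Longrightarrow> x \<in> topspace X \<Longrightarrow> act (g \<otimes> k) x = act g (act k x)"
    and min: "\<And>x. x \<in> topspace X \<Longrightarrow> X closure_of ((\<lambda>g. act g x) ` carrier G) = topspace X"
    and prox: "G_strongly_proximal G X act"
    using B unfolding G_boundary_def compact_G_space_def G_minimal_def by auto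
  have act_in: "act g x \<in> topspace X" if "g \<in> carrier G" "x \<in> topspace X" for g x
    using actc[OF that(1)] that(2) by (auto simp: continuous_map_def)
  have fact: "?cts (\<lambda>x. f (act g x))" if "?cts f" "g \<in> carrier G" for f g
    using continuous_map_compose[OF actc[OF that(2)] that(1)] by (simp add: comp_def)
  obtain x0 where x0: "x0 \<in> topspace X" using X(3) by blast
  define P where "P = (\<lambda>(f :: 'b \<Rightarrow> real) h. if h \<in> carrier G then complex_of_real (f (act h x0)) else 0)"
  have P: "P f \<in> linf G" if f: "?cts f" for f
  proof -
    obtain M where M: "M > 0" "\<And>x. x \<in> topspace X \<Longrightarrow> norm (f x) \<le> M"
      using continuous_map_bounded[OF X(1) f] by blast
    show ?thesis
      by (rule linfI[of _ _ M]) (use M(2)[OF act_in[OF _ x0]] in \<open>auto simp: P_def\<close>)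
  qed
  have Padd: "P (\<lambda>x. f x + g x) = (\<lambda>h. P f h + P g h)" for f g by (auto simp: P_def)
  have Pscale: "P (\<lambda>x. c * f x) = (\<lambda>h. complex_of_real c * P f h)" for f c by (auto simp: P_def)
  have Pone: "P (\<lambda>x. 1) = linf_one G" by (auto simp: P_def linf_one_def)
  have Pltr: "ltr G (inv g) (P f) = P (\<lambda>x. f (act g x))" if g: "g \<in> carrier G" for f g
    using g act_mult[OF g _ x0] by (auto simp: P_def ltr_def fun_eq_iff)
  define L where "L = (\<lambda>\<kappa> f. Re (\<kappa> (\<phi> (P f))))"
  note \<phi>P = IG_range[OF P]
  have state: "compact_state X (L \<kappa>)" if \<kappa>: "\<kappa> \<in> chars" for \<kappa>
  proof
    fix f g :: "'b \<Rightarrow> real" and c :: real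
    assume f: "?cts f"
    show "L \<kappa> (\<lambda>x. c * f x) = c * L \<kappa> f"
      using char_scale[OF \<kappa> \<phi>P[OF f], of "complex_of_real c"] by (simp add: L_def Pscale F_scale[OF P[OF f]])
    show "L \<kappa> (\<lambda>x. f x + g x) = L \<kappa> f + L \<kappa> g" if g: "?cts g"
      using char_add[OF \<kappa> \<phi>P[OF f] \<phi>P[OF g]] by (simp add: L_def Padd F_add[OF P[OF f] P[OF g]])
    show "0 \<le> L \<kappa> f" if "\<And>x. x \<in> topspace X \<Longrightarrow> 0 \<le> f x"
    proof -
      have "linf_pos (P f)" using that act_in[OF _ x0] by (auto simp: linf_pos_def P_def)
      then have "linf_pos (\<phi> (P f))" by (rule F_pos[OF P[OF f]])
      then show ?thesis using char_pos[OF \<kappa> \<phi>P[OF f]] by (simp add: L_def)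
    qed
  next
    show "L \<kappa> (\<lambda>_. 1) = 1" using char_one[OF \<kappa>] by (simp add: L_def Pone F_one)
  qed (use X in auto)
  have Lact: "L (hamana_act G \<phi> g \<kappa>) f = L \<kappa> (\<lambda>x. f (act g x))" if "g \<in> carrier G" "?cts f" for g \<kappa> f
    using that by (simp add: L_def hamana_act_apply \<phi>P F_ltr[symmetric] P Pltr)
  have Lcont: "continuous_map ?H euclideanreal (\<lambda>\<kappa>. L \<kappa> f)" for f
    unfolding L_def hamana_topology_eq by (auto intro!: continuous_on_Re continuous_on_eval)
  obtain \<kappa>1 where \<kappa>1: "\<kappa>1 \<in> chars" using chars_nonempty by blast
  \<comment> \<open>Strong proximality is applied to the measure representing
    \<open>L \<kappa>1\<close>. Translating that measure amounts to translating the character, by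
    \<open>Lact\<close>.\<close>
  have "\<exists>x\<in>topspace X. \<forall>F \<epsilon>. finite F \<and> F \<subseteq> {f. ?cts f} \<and> \<epsilon> > 0 \<longrightarrow>
           (\<exists>g\<in>carrier G. \<forall>f\<in>F. \<bar>L (hamana_act G \<phi> g \<kappa>1) f - f x\<bar> < \<epsilon>)"
  proof -
    interpret compact_state X "L \<kappa>1" by (rule state[OF \<kappa>1])
    obtain x where x: "x \<in> topspace X" and near: "\<And>F \<epsilon>. finite F \<and> F \<subseteq> {f. ?cts f} \<and> \<epsilon> > 0 \<Longrightarrow>
           \<exists>g\<in>carrier G. \<forall>f\<in>F. \<bar>(\<integral>y. f (act g y) \<partial>riesz_measure) - f x\<bar> < \<epsilon>"
      using prox[unfolded G_strongly_proximal_def, rule_format, OF conjI[OF prob_space_riesz sets_riesz]] by blast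
    show ?thesis
    proof (intro bexI[OF _ x] allI impI)
      fix F :: "('b \<Rightarrow> real) set" and \<epsilon> :: real
      assume F: "finite F \<and> F \<subseteq> {f. ?cts f} \<and> \<epsilon> > 0"
      from near[OF this] obtain g where g: "g \<in> carrier G"
        "\<And>f. f \<in> F \<Longrightarrow> \<bar>(\<integral>y. f (act g y) \<partial>riesz_measure) - f x\<bar> < \<epsilon>" by blast
      have "\<bar>L (hamana_act G \<phi> g \<kappa>1) f - f x\<bar> < \<epsilon>" if f: "f \<in> F" for f
      proof -
        have "?cts f" using f F by blast
        then show ?thesis using g(2)[OF f] integral_riesz[OF fact[OF _ g(1)]] by (simp add: Lact[OF g(1)])
      qed
      then show "\<exists>g\<in>carrier G. \<forall>f\<in>F. \<bar>L (hamana_act G \<phi> g \<kappa>1) f - f x\<bar> < \<epsilon>"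
        using g(1) by blast
    qed
  qed
  then obtain x where x: "x \<in> topspace X" and near: "\<And>F \<epsilon>. finite F \<Longrightarrow> F \<subseteq> {f. ?cts f} \<Longrightarrow> \<epsilon> > 0 \<Longrightarrow>
           \<exists>g\<in>carrier G. \<forall>f\<in>F. \<bar>L (hamana_act G \<phi> g \<kappa>1) f - f x\<bar> < \<epsilon>" by meson
  have "\<exists>\<kappa>\<in>topspace ?H. \<forall>f\<in>{f. ?cts f}. L \<kappa> f = f x"
  proof (rule compact_space_approx_solution[OF compact_space_hamana Lcont])
    fix F :: "('b \<Rightarrow> real) set" and \<epsilon> :: real
    assume "finite F" "F \<subseteq> {f. ?cts f}" "\<epsilon> > 0"
    then obtain g where "g \<in> carrier G" "\<forall>f\<in>F. \<bar>L (hamana_act G \<phi> g \<kappa>1) f - f x\<bar> < \<epsilon>"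
      using near by meson
    then show "\<exists>\<kappa>\<in>topspace ?H. \<forall>f\<in>F. \<bar>L \<kappa> f - f x\<bar> \<le> \<epsilon>"
      using hamana_act_chars[OF \<kappa>1] topspace_hamana by (intro bexI[of _ "hamana_act G \<phi> g \<kappa>1"]) (auto intro: less_imp_le)
  qed
  then obtain \<kappa>2 where \<kappa>2: "\<kappa>2 \<in> chars" "\<And>f. ?cts f \<Longrightarrow> L \<kappa>2 f = f x"
    using topspace_hamana by auto
  have "\<exists>p\<in>topspace X. \<forall>f\<in>{f. ?cts f}. f p = L \<kappa> f" if \<kappa>: "\<kappa> \<in> chars" for \<kappa>
  proof (rule compact_space_approx_solution[OF X(1)])
    fix F :: "('b \<Rightarrow> real) set" and \<epsilon> :: real
    assume F: "finite F" "F \<subseteq> {f. ?cts f}" "\<epsilon> > 0"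
    \<comment> \<open>Intersecting with the space keeps \<open>W\<close> open when \<open>F\<close>
      is empty.\<close>
    define W where "W = topspace ?H \<inter> (\<Inter>f\<in>F. {\<kappa>' \<in> topspace ?H. L \<kappa>' f \<in> ball (L \<kappa> f) \<epsilon>})"
    have "openin ?H W"
      unfolding W_def using F(1) Lcont
      by (intro openin_Int_Inter) (auto simp del: mem_ball intro!: openin_continuous_map_preimage)
    moreover have "\<kappa> \<in> W" using \<kappa> F(3) topspace_hamana by (simp add: W_def)
    moreover have "\<kappa> \<in> ?H closure_of ((\<lambda>g. hamana_act G \<phi> g \<kappa>2) ` carrier G)"
      using G_minimal_hamana \<kappa>2(1) \<kappa> unfolding G_minimal_def topspace_hamana by simp
    ultimately obtain g where g: "g \<in> carrier G" "hamana_act G \<phi> g \<kappa>2 \<in> W"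
      unfolding in_closure_of by blast
    have "\<bar>f (act g x) - L \<kappa> f\<bar> \<le> \<epsilon>" if f: "f \<in> F" for f
    proof -
      have fc: "?cts f" using f F(2) by blast
      have "L (hamana_act G \<phi> g \<kappa>2) f \<in> ball (L \<kappa> f) \<epsilon>"
        using g(2) f by (auto simp: W_def)
      then show ?thesis using \<kappa>2(2)[OF fact[OF fc g(1)]]
        by (simp add: Lact[OF g(1) fc] dist_real_def abs_minus_commute)
    qed
    then show "\<exists>p\<in>topspace X. \<forall>f\<in>F. \<bar>f p - L \<kappa> f\<bar> \<le> \<epsilon>"
      using act_in[OF g(1) x] by blast
  qed simp
  then obtain p where p: "\<And>\<kappa>. \<kappa> \<in> chars \<Longrightarrow> p \<kappa> \<in> topspace X"
    "\<And>\<kappa> f. \<kappa> \<in> chars \<Longrightarrow> ?cts f \<Longrightarrow> f (p \<kappa>) = L \<kappa> f" by (metis mem_Collect_eq)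
  have pcont: "continuous_map ?H X p"
  proof (rule continuous_map_into_compact_Hausdorff[OF X(1,2)])
    show "p \<in> topspace ?H \<rightarrow> topspace X" using p(1) topspace_hamana by auto
    fix f assume "?cts f"
    then show "continuous_map ?H euclideanreal (\<lambda>z. f (p z))"
      by (intro continuous_map_eq[OF Lcont[of f]]) (simp add: p(2) topspace_hamana)
  qed
  have equiv: "p (hamana_act G \<phi> g \<kappa>) = act g (p \<kappa>)" if g: "g \<in> carrier G" and \<kappa>: "\<kappa> \<in> chars" for g \<kappa>
  proof (rule ccontr)
    assume ne: "p (hamana_act G \<phi> g \<kappa>) \<noteq> act g (p \<kappa>)"
    note g\<kappa> = hamana_act_chars[OF \<kappa> g]
    have in1: "act g (p \<kappa>) \<in> topspace X" by (rule act_in[OF g p(1)[OF \<kappa>]])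
    have "closedin X {act g (p \<kappa>)}" using X(2) in1 by (simp add: closedin_Hausdorff_singleton)
    moreover have "p (hamana_act G \<phi> g \<kappa>) \<notin> {act g (p \<kappa>)}" using ne by simp
    ultimately obtain f where f: "?cts f" "f (p (hamana_act G \<phi> g \<kappa>)) = 0" "f (act g (p \<kappa>)) = 1"
      using compact_Hausdorff_separating_function[OF X(1,2) _ p(1)[OF g\<kappa>]] by (metis singletonI)
    have "f (p (hamana_act G \<phi> g \<kappa>)) = f (act g (p \<kappa>))"
      using p(2)[OF g\<kappa> f(1)] p(2)[OF \<kappa> fact[OF f(1) g]] Lact[OF g f(1)] by simp
    then show False using f(2,3) by simp
  qed
  \<comment> \<open>The image is compact, hence closed, and contains an orbit, which is dense as
    \<open>X\<close> is minimal.\<close>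
  have "p ` topspace ?H = topspace X"
  proof
    show "p ` topspace ?H \<subseteq> topspace X" using p(1) topspace_hamana by auto
    have "compactin X (p ` topspace ?H)"
      using compact_space_hamana pcont by (intro image_compactin[of ?H]) (auto simp: compact_space_def)
    then have "closedin X (p ` topspace ?H)" using X(2) compactin_imp_closedin by blast
    moreover have "(\<lambda>g. act g (p \<kappa>1)) ` carrier G \<subseteq> p ` topspace ?H"
      using equiv[OF _ \<kappa>1] hamana_act_chars[OF \<kappa>1] unfolding topspace_hamana
      by (metis (no_types, lifting) image_eqI image_subsetI)
    ultimately have "X closure_of ((\<lambda>g. act g (p \<kappa>1)) ` carrier G) \<subseteq> p ` topspace ?H"
      by (rule closure_of_minimal[rotated])
    then show "topspace X \<subseteq> p ` topspace ?H" using min[OF p(1)[OF \<kappa>1]] by simp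
  qed
  then have "G_factor_map G ?H (hamana_act G \<phi>) X act p"
    unfolding G_factor_map_def using pcont equiv topspace_hamana by auto
  then show ?thesis by blast
qed

end

lemma minimal_G_projection_hamana:
  assumes "group G" "minimal_G_projection G \<phi>"
  shows "hamana G \<phi>"
proof -
  have "G_projection G \<phi>" using assms(2) by (simp add: minimal_G_projection_def)
  then show ?thesis
    using assms by (simp add: G_projection_iff hamana_def hamana_axioms_def linf_projection_def linf_projection_axioms_def)
qed

text \<open>Existence of \<open>\<phi>\<close> is part of the conclusion so that the statement about
  all minimal projections is not vacuous. The type of \<open>X\<close> is arbitrary, so the Hamana
  boundary is a boundary that maps onto every boundary, which is the property that characterises the
  Furstenberg boundary.\<close>

theorem theorem3p7:
  fixes G :: "('g, 'm) monoid_scheme"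
    and X :: "'b topology" and act :: "'g \<Rightarrow> 'b \<Rightarrow> 'b"
  assumes "group G"
    and "G_boundary G X act"
  shows "(\<exists>\<phi>. minimal_G_projection G \<phi>) \<and>
         (\<forall>\<phi>. minimal_G_projection G \<phi> \<longrightarrow>
             G_boundary G (hamana_topology G \<phi>) (hamana_act G \<phi>) \<and>
             (\<exists>f. G_factor_map G (hamana_topology G \<phi>) (hamana_act G \<phi>) X act f))"
proof (intro conjI allI impI)
  show "\<exists>\<phi>. minimal_G_projection G \<phi>" by (rule ex_minimal_G_projection[OF assms(1)])
  fix \<phi> assume "minimal_G_projection G \<phi>"
  then interpret hamana G \<phi> by (rule minimal_G_projection_hamana[OF assms(1)])
  show "G_boundary G (hamana_topology G \<phi>) (hamana_act G \<phi>)" by (rule G_boundary_hamana)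
  show "\<exists>f. G_factor_map G (hamana_topology G \<phi>) (hamana_act G \<phi>) X act f"
    by (rule ex_factor_map[OF assms(2)])
qed

end
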